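(* Let $\alpha\ge 1/2$, let $P_0$ be the $Gamma(\alpha,1)$ distribution, and let $X_1,X_2,\ldots$ be i.i.d. $Gamma(\alpha,1)$-distributed random variables. For $n\ge 1$ let $\overline{X}_n=n^{-1}\sum_{j=1}^n X_j$, $Y_j=X_j/\overline{X}_n$ for $j=1,\ldots,n$, and let $$Z_n(t)=\frac{1}{\sqrt n}\sum_{j=1}^n\Big[\Gamma(\alpha)(tY_j)^{(1-\alpha)/2}J_{\alpha-1}\big(2\sqrt{tY_j}\big)-e^{-t/\alpha}\Big],\qquad t\ge 0,$$ regarded as a random element $Z_n=\{Z_n(t),t\ge0\}$ of $L^2=L^2(P_0)$. Let $T_n^2=\int_0^\infty Z_n(t)^2\,dP_0(t)$. Then there exists a centered Gaussian process $Z=\{Z(t),t\ge 0\}$, with sample paths in $L^2$ and with covariance function $$K(s,t)=e^{-(s+t)/\alpha}\Big[\Gamma(\alpha)(st/\alpha^2)^{(1-\alpha)/2}I_{\alpha-1}\big(2\sqrt{st}/\alpha\big)-\alpha^{-3}st-1\Big],\qquad s,t\ge 0,$$ such that $Z_n\xrightarrow{d}Z$ in $L^2$ as $n\to\infty$. Moreover, $$T_n^2\xrightarrow{d}\int_0^\infty Z^2(t)\,dP_0(t).$$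
   Context: $Gamma(\alpha,\lambda)$ denotes the distribution on $(0,\infty)$ with density $\lambda^\alpha x^{\alpha-1}e^{-\lambda x}/\Gamma(\alpha)$. $J_\nu(z)=\sum_{j\ge0}\frac{(-1)^j}{j!\,\Gamma(\nu+1+j)}(z/2)^{2j+\nu}$ is the Bessel function of the first kind and $I_\nu(x)=\sum_{j\ge0}\frac{1}{j!\,\Gamma(\nu+1+j)}(x/2)^{2j+\nu}$ the modified Bessel function of the first kind. The functions $x^{(1-\alpha)/2}J_{\alpha-1}(2\sqrt x)$ and $x^{(1-\alpha)/2}I_{\alpha-1}(2\sqrt x)$ are power series in $x$ and take the value $1/\Gamma(\alpha)$ at $x=0$. $L^2=L^2(P_0)$ is the separable Hilbert space of (classes of) Borel functions $f:[0,\infty)\to\mathbb{C}$ with $\int_0^\infty|f|^2\,dP_0<\infty$; $\xrightarrow{d}$ denotes convergence in distribution. *)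

theory Defs
  imports "HOL-Probability.Probability"
begin

definition bessel_J :: "real \<Rightarrow> real \<Rightarrow> real" where
  "bessel_J \<nu> z = (\<Sum>j. (-1) ^ j / (fact j * Gamma (\<nu> + 1 + real j)) * (z / 2) powr (2 * real j + \<nu>))"

definition bessel_I :: "real \<Rightarrow> real \<Rightarrow> real" where
  "bessel_I \<nu> x = (\<Sum>j. 1 / (fact j * Gamma (\<nu> + 1 + real j)) * (x / 2) powr (2 * real j + \<nu>))"

text \<open>
  The functions \<open>x\<^bsup>(1-\<alpha>)/2\<^esup> J\<^bsub>\<alpha>-1\<^esub>(2 \<surd>x)\<close> and \<open>x\<^bsup>(1-\<alpha>)/2\<^esup> I\<^bsub>\<alpha>-1\<^esub>(2 \<surd>x)\<close> are power
  series in \<open>x\<close> with value \<open>1 / \<Gamma>(\<alpha>)\<close> at \<open>0\<close>. The case distinction is needed because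
  \<open>0 powr a = 0\<close>. Negative arguments carry no meaning; they get the value at \<open>0\<close>.
\<close>

definition hankel_J :: "real \<Rightarrow> real \<Rightarrow> real" where
  "hankel_J \<alpha> x = (if x > 0 then x powr ((1 - \<alpha>) / 2) * bessel_J (\<alpha> - 1) (2 * sqrt x) else 1 / Gamma \<alpha>)"

definition hankel_I :: "real \<Rightarrow> real \<Rightarrow> real" where
  "hankel_I \<alpha> x = (if x > 0 then x powr ((1 - \<alpha>) / 2) * bessel_I (\<alpha> - 1) (2 * sqrt x) else 1 / Gamma \<alpha>)"

definition gamma_density :: "real \<Rightarrow> real \<Rightarrow> real \<Rightarrow> real" where
  "gamma_density \<alpha> l x =
     (if x > 0 then l powr \<alpha> * x powr (\<alpha> - 1) * exp (- l * x) / Gamma \<alpha> else 0)"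

definition gamma_distr :: "real \<Rightarrow> real \<Rightarrow> real measure" where
  "gamma_distr \<alpha> l = density lborel (\<lambda>x. ennreal (gamma_density \<alpha> l x))"

text \<open>
  The points of \<open>L2 P\<close> are classes of almost everywhere equal square integrable functions;
  each class is represented as a set of functions. The distance does not depend on the
  representatives chosen by \<open>SOME\<close>, see \<open>L2_dist_class\<close> below.
\<close>

definition L2_fun :: "'a measure \<Rightarrow> ('a \<Rightarrow> complex) set" where
  "L2_fun P = {f \<in> borel_measurable P. integrable P (\<lambda>x. (cmod (f x))\<^sup>2)}"

definition L2_class :: "'a measure \<Rightarrow> ('a \<Rightarrow> complex) \<Rightarrow> ('a \<Rightarrow> complex) set" where
  "L2_class P f = {g \<in> L2_fun P. AE x in P. g x = f x}"

definition L2 :: "'a measure \<Rightarrow> ('a \<Rightarrow> complex) set set" where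
  "L2 P = L2_class P ` L2_fun P"

definition L2_dist :: "'a measure \<Rightarrow> ('a \<Rightarrow> complex) set \<Rightarrow> ('a \<Rightarrow> complex) set \<Rightarrow> real" where
  "L2_dist P A B =
     sqrt (LINT x|P. (cmod ((SOME f. f \<in> A) x - (SOME g. g \<in> B) x))\<^sup>2)"

definition L2_topology :: "'a measure \<Rightarrow> ('a \<Rightarrow> complex) set topology" where
  "L2_topology P = Metric_space.mtopology (L2 P) (L2_dist P)"

lemma L2_class_self: "f \<in> L2_fun P \<Longrightarrow> f \<in> L2_class P f"
  by (simp add: L2_class_def)

lemma L2_dist_class:
  assumes f: "f \<in> L2_fun P" and g: "g \<in> L2_fun P"
  shows "L2_dist P (L2_class P f) (L2_class P g) = sqrt (LINT x|P. (cmod (f x - g x))\<^sup>2)"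
proof -
  define f' where "f' = (SOME h. h \<in> L2_class P f)"
  define g' where "g' = (SOME h. h \<in> L2_class P g)"
  have f': "f' \<in> L2_class P f" and g': "g' \<in> L2_class P g"
    unfolding f'_def g'_def using L2_class_self[OF f] L2_class_self[OF g]
    by (simp_all add: someI[of "\<lambda>h. h \<in> L2_class P f"] someI[of "\<lambda>h. h \<in> L2_class P g"])
  have [measurable]: "f \<in> borel_measurable P" "g \<in> borel_measurable P"
    "f' \<in> borel_measurable P" "g' \<in> borel_measurable P"
    using f g f' g' by (auto simp: L2_fun_def L2_class_def)
  have "AE x in P. f' x = f x" "AE x in P. g' x = g x"
    using f' g' by (auto simp: L2_class_def)
  then have "(LINT x|P. (cmod (f' x - g' x))\<^sup>2) = (LINT x|P. (cmod (f x - g x))\<^sup>2)"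
    by (intro integral_cong_AE) auto
  then show ?thesis
    by (simp add: L2_dist_def f'_def g'_def)
qed

lemma L2_fun_add:
  assumes f: "f \<in> L2_fun P" and g: "g \<in> L2_fun P"
  shows "(\<lambda>x. f x + g x) \<in> L2_fun P"
proof -
  have [measurable]: "f \<in> borel_measurable P" "g \<in> borel_measurable P"
    using f g by (auto simp: L2_fun_def)
  have "integrable P (\<lambda>x. 2 * (cmod (f x))\<^sup>2 + 2 * (cmod (g x))\<^sup>2)"
    using f g by (auto simp: L2_fun_def)
  moreover have "(cmod (f x + g x))\<^sup>2 \<le> 2 * (cmod (f x))\<^sup>2 + 2 * (cmod (g x))\<^sup>2" for x
  proof -
    have "(cmod (f x + g x))\<^sup>2 \<le> (cmod (f x) + cmod (g x))\<^sup>2"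
      by (intro power_mono norm_triangle_ineq) auto
    also have "\<dots> \<le> 2 * (cmod (f x))\<^sup>2 + 2 * (cmod (g x))\<^sup>2"
      using sum_squares_bound[of "cmod (f x)" "cmod (g x)"] by (simp add: power2_sum)
    finally show ?thesis .
  qed
  ultimately have "integrable P (\<lambda>x. (cmod (f x + g x))\<^sup>2)"
    by (elim Bochner_Integration.integrable_bound) (auto intro!: AE_I2)
  then show ?thesis
    by (auto simp: L2_fun_def)
qed

lemma L2_fun_diff:
  assumes "f \<in> L2_fun P" and "g \<in> L2_fun P"
  shows "(\<lambda>x. f x - g x) \<in> L2_fun P"
proof -
  have "(\<lambda>x. - g x) \<in> L2_fun P"
    using assms(2) by (auto simp: L2_fun_def)
  from L2_fun_add[OF assms(1) this] show ?thesis by simp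
qed

lemma L2_null_iff:
  assumes "f \<in> L2_fun P"
  shows "sqrt (LINT x|P. (cmod (f x))\<^sup>2) = 0 \<longleftrightarrow> (AE x in P. f x = 0)"
proof -
  have "(LINT x|P. (cmod (f x))\<^sup>2) = 0 \<longleftrightarrow> (AE x in P. (cmod (f x))\<^sup>2 = 0)"
    using assms by (intro integral_nonneg_eq_0_iff_AE) (auto simp: L2_fun_def)
  then show ?thesis by simp
qed

lemma L2_Minkowski:
  assumes f: "f \<in> L2_fun P" and g: "g \<in> L2_fun P"
  shows "sqrt (LINT x|P. (cmod (f x + g x))\<^sup>2)
    \<le> sqrt (LINT x|P. (cmod (f x))\<^sup>2) + sqrt (LINT x|P. (cmod (g x))\<^sup>2)"
proof -
  define A where "A = sqrt (LINT x|P. (cmod (f x))\<^sup>2)"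
  define B where "B = sqrt (LINT x|P. (cmod (g x))\<^sup>2)"
  have [measurable]: "f \<in> borel_measurable P" "g \<in> borel_measurable P"
    using f g by (auto simp: L2_fun_def)
  have fi: "integrable P (\<lambda>x. (cmod (f x))\<^sup>2)" and gi: "integrable P (\<lambda>x. (cmod (g x))\<^sup>2)"
    and fgi: "integrable P (\<lambda>x. (cmod (f x + g x))\<^sup>2)"
    using f g L2_fun_add[OF f g] by (auto simp: L2_fun_def)
  have A2: "A\<^sup>2 = (LINT x|P. (cmod (f x))\<^sup>2)" and B2: "B\<^sup>2 = (LINT x|P. (cmod (g x))\<^sup>2)"
    by (simp_all add: A_def B_def)
  have nonneg: "A \<ge> 0" "B \<ge> 0"
    by (simp_all add: A_def B_def)
  consider "A = 0" | "B = 0" | "A > 0" "B > 0"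
    using nonneg by linarith
  then show ?thesis
  proof cases
    case 1
    then have "AE x in P. f x = 0"
      using L2_null_iff[OF f] by (simp add: A_def)
    then have "(LINT x|P. (cmod (f x + g x))\<^sup>2) = (LINT x|P. (cmod (g x))\<^sup>2)"
      by (intro integral_cong_AE) auto
    then show ?thesis using nonneg by (simp add: A_def)
  next
    case 2
    then have "AE x in P. g x = 0"
      using L2_null_iff[OF g] by (simp add: B_def)
    then have "(LINT x|P. (cmod (f x + g x))\<^sup>2) = (LINT x|P. (cmod (f x))\<^sup>2)"
      by (intro integral_cong_AE) auto
    then show ?thesis using nonneg by (simp add: B_def)
  next
    case 3
    have bound: "(cmod (f x + g x))\<^sup>2 \<le> (1 + B / A) * (cmod (f x))\<^sup>2 + (1 + A / B) * (cmod (g x))\<^sup>2"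
      for x
    proof -
      define a b where "a = cmod (f x)" and "b = cmod (g x)"
      have "(cmod (f x + g x))\<^sup>2 \<le> (a + b)\<^sup>2"
        unfolding a_def b_def by (intro power_mono norm_triangle_ineq) auto
      also have "2 * a * b \<le> B / A * a\<^sup>2 + A / B * b\<^sup>2"
      proof -
        have "0 \<le> (B * a - A * b)\<^sup>2 / (A * B)"
          using 3 by simp
        also have "\<dots> = B / A * a\<^sup>2 + A / B * b\<^sup>2 - 2 * a * b"
          using 3 by (simp add: field_simps power2_eq_square)
        finally show ?thesis by simp
      qed
      then have "(a + b)\<^sup>2 \<le> (1 + B / A) * a\<^sup>2 + (1 + A / B) * b\<^sup>2"
        by (simp add: power2_sum algebra_simps)
      finally show ?thesis by (simp add: a_def b_def)
    qed
    have "(LINT x|P. (cmod (f x + g x))\<^sup>2)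
      \<le> (LINT x|P. (1 + B / A) * (cmod (f x))\<^sup>2 + (1 + A / B) * (cmod (g x))\<^sup>2)"
      using fi gi fgi bound by (intro integral_mono) auto
    also have "\<dots> = (1 + B / A) * A\<^sup>2 + (1 + A / B) * B\<^sup>2"
      using fi gi by (simp add: A2 B2)
    also have "\<dots> = (A + B)\<^sup>2"
      using 3 by (simp add: field_simps power2_eq_square)
    finally show ?thesis
      unfolding A_def[symmetric] B_def[symmetric] using nonneg by (intro real_le_lsqrt) auto
  qed
qed

lemma L2_class_eqI:
  assumes "AE x in P. f x = g x"
  shows "L2_class P f = L2_class P g"
proof -
  have "(AE x in P. h x = f x) \<longleftrightarrow> (AE x in P. h x = g x)" for h
    using assms by (auto elim: AE_mp)
  then show ?thesis by (simp add: L2_class_def)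
qed

lemma Metric_space_L2: "Metric_space (L2 P) (L2_dist P)"
proof
  fix A B show "0 \<le> L2_dist P A B"
    by (simp add: L2_dist_def)
  show "L2_dist P A B = L2_dist P B A"
    by (simp add: L2_dist_def norm_minus_commute)
next
  fix A B assume "A \<in> L2 P" "B \<in> L2 P"
  then obtain f g where fg: "f \<in> L2_fun P" "g \<in> L2_fun P" "A = L2_class P f" "B = L2_class P g"
    by (auto simp: L2_def)
  have "L2_dist P A B = 0 \<longleftrightarrow> (AE x in P. f x = g x)"
    using L2_null_iff[OF L2_fun_diff[OF fg(1,2)]] fg by (simp add: L2_dist_class)
  moreover have "(AE x in P. f x = g x) \<longleftrightarrow> A = B"
    using L2_class_eqI[of f g P] L2_class_self[OF fg(1)] fg by (auto simp: L2_class_def)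
  ultimately show "L2_dist P A B = 0 \<longleftrightarrow> A = B" by simp
next
  fix A B C assume "A \<in> L2 P" "B \<in> L2 P" "C \<in> L2 P"
  then obtain f g h where "f \<in> L2_fun P" "g \<in> L2_fun P" "h \<in> L2_fun P"
    "A = L2_class P f" "B = L2_class P g" "C = L2_class P h"
    by (auto simp: L2_def)
  then show "L2_dist P A C \<le> L2_dist P A B + L2_dist P B C"
    using L2_Minkowski[OF L2_fun_diff[of f P g] L2_fun_diff[of g P h]]
    by (simp add: L2_dist_class)
qed

definition borel_of_topology :: "'a topology \<Rightarrow> 'a measure" where
  "borel_of_topology T = sigma (topspace T) {U. openin T U}"

definition converges_in_distribution ::
  "'b topology \<Rightarrow> 'a measure \<Rightarrow> (nat \<Rightarrow> 'a \<Rightarrow> 'b) \<Rightarrow> 'c measure \<Rightarrow> ('c \<Rightarrow> 'b) \<Rightarrow> bool" where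
  "converges_in_distribution T M V N W \<longleftrightarrow>
     (\<forall>n. V n \<in> M \<rightarrow>\<^sub>M borel_of_topology T) \<and> W \<in> N \<rightarrow>\<^sub>M borel_of_topology T \<and>
     (\<forall>F. continuous_map T euclideanreal F \<and> bounded (F ` topspace T) \<longrightarrow>
        (\<lambda>n. LINT \<omega>|M. F (V n \<omega>)) \<longlonglongrightarrow> (LINT \<omega>|N. F (W \<omega>)))"

text \<open>Normal distributions include the degenerate case of zero variance.\<close>

definition gaussian_rv :: "'a measure \<Rightarrow> ('a \<Rightarrow> real) \<Rightarrow> bool" where
  "gaussian_rv N V \<longleftrightarrow> V \<in> borel_measurable N \<and>
     (\<exists>\<mu> \<sigma>. \<sigma> \<ge> 0 \<and> distr N borel V =
        (if \<sigma> = 0 then return borel \<mu> else density lborel (\<lambda>x. ennreal (normal_density \<mu> \<sigma> x))))"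

definition gaussian_process :: "'a measure \<Rightarrow> 't set \<Rightarrow> ('t \<Rightarrow> 'a \<Rightarrow> real) \<Rightarrow> bool" where
  "gaussian_process N T Z \<longleftrightarrow>
     (\<forall>t\<in>T. Z t \<in> borel_measurable N) \<and>
     (\<forall>S c. finite S \<and> S \<subseteq> T \<longrightarrow> gaussian_rv N (\<lambda>\<omega>. \<Sum>t\<in>S. c t * Z t \<omega>))"

definition covariance :: "'a measure \<Rightarrow> ('a \<Rightarrow> real) \<Rightarrow> ('a \<Rightarrow> real) \<Rightarrow> real" where
  "covariance N V W =
     (LINT \<omega>|N. (V \<omega> - (LINT \<omega>'|N. V \<omega>')) * (W \<omega> - (LINT \<omega>'|N. W \<omega>')))"

definition sample_mean :: "(nat \<Rightarrow> 'a \<Rightarrow> real) \<Rightarrow> nat \<Rightarrow> 'a \<Rightarrow> real" where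
  "sample_mean X n \<omega> = (\<Sum>j=1..n. X j \<omega>) / real n"

definition scaled_obs :: "(nat \<Rightarrow> 'a \<Rightarrow> real) \<Rightarrow> nat \<Rightarrow> nat \<Rightarrow> 'a \<Rightarrow> real" where
  "scaled_obs X n j \<omega> = X j \<omega> / sample_mean X n \<omega>"

definition hankel_process :: "real \<Rightarrow> (nat \<Rightarrow> 'a \<Rightarrow> real) \<Rightarrow> nat \<Rightarrow> real \<Rightarrow> 'a \<Rightarrow> real" where
  "hankel_process \<alpha> X n t \<omega> =
     1 / sqrt (real n) *
       (\<Sum>j=1..n. (Gamma \<alpha> * hankel_J \<alpha> (t * scaled_obs X n j \<omega>) - exp (- t / \<alpha>)))"

definition hankel_statistic :: "real \<Rightarrow> (nat \<Rightarrow> 'a \<Rightarrow> real) \<Rightarrow> nat \<Rightarrow> 'a \<Rightarrow> real" where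
  "hankel_statistic \<alpha> X n \<omega> = (LINT t:{0..}|gamma_distr \<alpha> 1. (hankel_process \<alpha> X n t \<omega>)\<^sup>2)"

definition limit_covariance :: "real \<Rightarrow> real \<Rightarrow> real \<Rightarrow> real" where
  "limit_covariance \<alpha> s t =
     exp (- (s + t) / \<alpha>) * (Gamma \<alpha> * hankel_I \<alpha> (s * t / \<alpha>\<^sup>2) - s * t / \<alpha> ^ 3 - 1)"

text \<open>
  A path \<open>z\<close> is regarded as a point of \<open>L\<^sup>2(P\<^sub>0)\<close>. Paths are functions on all of
  \<open>\<real>\<close>, but the Gamma distribution does not charge the negative half line, so only the
  values on \<open>[0, \<infinity>)\<close> matter for the class.
\<close>

definition L2_path :: "real \<Rightarrow> (real \<Rightarrow> real) \<Rightarrow> (real \<Rightarrow> complex) set" where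
  "L2_path \<alpha> z = L2_class (gamma_distr \<alpha> 1) (\<lambda>t. complex_of_real (z t))"

end

theory Submission
  imports Defs
begin

text \<open>
  Write \<open>H\<close> for the power series \<open>hyp01 \<alpha>\<close>, so that
  \<open>H x = \<Gamma>(\<alpha>) x\<^bsup>(1-\<alpha>)/2\<^esup> J\<^bsub>\<alpha>-1\<^esub>(2 \<surd>x)\<close> for \<open>x \<ge> 0\<close>, and \<open>(\<alpha>)\<^sub>k\<close> for the
  rising factorial. Everything rests on one explicit expansion: the generating function of the
  Laguerre polynomials, multiplied by \<open>exp (- t / \<alpha>)\<close>, reads

    \<open>H (t x / \<alpha>) = (\<Sum>k. \<phi>\<^sub>k(t) \<ell>\<^sub>k(x))\<close>  with  \<open>\<phi>\<^sub>k(t) = exp (- t / \<alpha>) (t / \<alpha>)\<^sup>k / sqrt (k! (\<alpha>)\<^sub>k)\<close>,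

  where \<open>\<ell>\<^sub>k\<close> are the orthonormal polynomials of the Gamma distribution
  (\<open>laguerre_expansion\<close>, \<open>laguerre_n_orthonormal\<close>). The term \<open>k = 0\<close> is the mean
  \<open>exp (- t / \<alpha>)\<close>, and the term \<open>k = 1\<close> is a multiple of \<open>x - \<alpha>\<close>. Dividing the observations by
  their mean instead of \<open>\<alpha>\<close> changes the empirical sum, to first order, by exactly minus this second
  term. So \<open>Z\<^sub>n\<close> is close to \<open>(\<Sum>k\<ge>2. \<phi>\<^sub>k S\<^bsub>n,k\<^esub>)\<close> with the scores
  \<open>S\<^bsub>n,k\<^esub> = n\<^bsup>-1/2\<^esup> (\<Sum>j\<le>n. \<ell>\<^sub>k(X\<^sub>j))\<close>, which are uncorrelated with mean 0 and variance 1. By the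
  central limit theorem the scores become independent standard normal variables \<open>\<xi>\<^sub>k\<close>, and the limit
  is \<open>Z = (\<Sum>k\<ge>2. \<phi>\<^sub>k \<xi>\<^sub>k)\<close>. Its covariance \<open>(\<Sum>k\<ge>2. \<phi>\<^sub>k(s) \<phi>\<^sub>k(t))\<close> is the asserted one, because
  \<open>- \<alpha>\<^bsup>-3\<^esup> s t - 1\<close> removes the first two terms from the power series of the modified Bessel
  function (\<open>limit_covariance_sums\<close>).

  Three estimates turn this into a proof.

  Linearization (\<open>linearization_error\<close>): for \<open>\<alpha> \<ge> 1/2\<close> an energy argument for the differential
  equation of \<open>H\<close> gives \<open>\<bar>H\<bar> \<le> 1\<close> on the half line (\<open>abs_hyp01_le_1\<close>). Since derivatives of \<open>H\<close> are
  multiples of the same function with a larger \<open>\<alpha>\<close>, they are bounded too, and the remainder of a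
  second order Taylor expansion is controlled by moments of the observations. On the event that the sample mean is within \<open>n\<^bsup>-1/3\<^esup>\<close>
  of \<open>\<alpha>\<close> the mean square error tends to 0, and the probability of this event tends to 1.

  Truncation (\<open>orthonormal_series_tail\<close>): by Fatou's lemma the tail from \<open>K\<close> on of an orthonormal
  series has second moment at most \<open>(\<Sum>k\<ge>K. \<phi>\<^sub>k(t)\<^sup>2)\<close>. This bound depends neither on \<open>n\<close> nor on
  whether the scores or their normal limits are used, and it is geometrically small in \<open>K\<close> after
  integration over \<open>t\<close> (\<open>abs_mode_le\<close>).

  Weak convergence (\<open>L2_random_series_limit\<close>): Lipschitz functions suffice to test convergence in
  distribution in a metric space (\<open>converges_in_distribution_LipschitzI\<close>). Applied to a truncated
  series, such a function becomes a Lipschitz function of finitely many scores, and these are handled by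
  trigonometric approximation (\<open>Lipschitz_expectation_limit\<close>), which reduces the claim to the
  central limit theorem for linear combinations of scores. The statement on \<open>T\<^sub>n\<^sup>2\<close> follows because
  the squared norm is continuous on \<open>L\<^sup>2\<close>.
\<close>

section \<open>The Gamma distribution\<close>

lemma gamma_density_measurable [measurable]: "gamma_density \<alpha> l \<in> borel_measurable borel"
  unfolding gamma_density_def by measurable

lemma gamma_density_nonneg: "\<alpha> > 0 \<Longrightarrow> gamma_density \<alpha> l x \<ge> 0"
  by (auto simp: gamma_density_def intro!: divide_nonneg_pos Gamma_real_pos)

lemma sets_gamma_distr [simp, measurable_cong]: "sets (gamma_distr \<alpha> l) = sets borel"
  and space_gamma_distr [simp]: "space (gamma_distr \<alpha> l) = UNIV"
  by (simp_all add: gamma_distr_def)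

lemma borel_measurable_gamma_distr_iff: "f \<in> borel_measurable (gamma_distr \<alpha> l) \<longleftrightarrow> f \<in> borel_measurable borel"
  by (simp cong: measurable_cong_sets)

lemma AE_gamma_distr_pos: "AE x in gamma_distr \<alpha> l. x > 0"
  unfolding gamma_distr_def by (subst AE_density) (auto simp: gamma_density_def)

text \<open>
  The factor \<open>x\<^sup>m\<close> shifts the shape parameter and the factor \<open>exp (c x)\<close> the rate, so both
  the moments and the exponential integrability used below come from one Gamma integral.
\<close>

lemma nn_integral_gamma_exp_tilt:
  assumes "\<alpha> > 0" "c < 1"
  shows "(\<integral>\<^sup>+x. ennreal (\<bar>x\<bar> ^ m * exp (c * x)) \<partial>gamma_distr \<alpha> 1)
    = ennreal (Gamma (\<alpha> + real m) / Gamma \<alpha> / (1 - c) powr (\<alpha> + real m))"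
proof -
  let ?s = "\<alpha> + real m"
  have G: "Gamma \<alpha> > 0" "Gamma ?s > 0" using assms by (auto intro!: Gamma_real_pos add_pos_nonneg)
  have "(\<integral>\<^sup>+x. ennreal (\<bar>x\<bar> ^ m * exp (c * x)) \<partial>gamma_distr \<alpha> 1)
    = (\<integral>\<^sup>+x. ennreal (gamma_density \<alpha> 1 x) * ennreal (\<bar>x\<bar> ^ m * exp (c * x)) \<partial>lborel)"
    unfolding gamma_distr_def by (subst nn_integral_density) auto
  also have "\<dots> = (\<integral>\<^sup>+x. ennreal (1 / Gamma \<alpha>) * ennreal (indicator {0..} x * x powr (?s - 1) / exp ((1 - c) * x)) \<partial>lborel)"
  proof (intro nn_integral_cong)
    fix x :: real
    have "gamma_density \<alpha> 1 x * (\<bar>x\<bar> ^ m * exp (c * x)) = (1 / Gamma \<alpha>) * (indicator {0..} x * x powr (?s - 1) / exp ((1 - c) * x))"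
    proof (cases "x > 0")
      case True
      then have "x powr (?s - 1) = x powr (\<alpha> - 1) * x ^ m"
        by (simp add: powr_add [symmetric] powr_realpow [symmetric] algebra_simps)
      moreover have e: "exp (- x) * exp (c * x) = 1 / exp ((1 - c) * x)"
        by (simp add: exp_add [symmetric] exp_minus [symmetric] divide_inverse algebra_simps)
      moreover have "gamma_density \<alpha> 1 x * (\<bar>x\<bar> ^ m * exp (c * x))
        = (x powr (\<alpha> - 1) * x ^ m) * (exp (- x) * exp (c * x)) / Gamma \<alpha>"
        using True by (simp add: gamma_density_def)
      ultimately show ?thesis using True by simp
    qed (auto simp: gamma_density_def indicator_def)
    then show "ennreal (gamma_density \<alpha> 1 x) * ennreal (\<bar>x\<bar> ^ m * exp (c * x)) =
      ennreal (1 / Gamma \<alpha>) * ennreal (indicator {0..} x * x powr (?s - 1) / exp ((1 - c) * x))"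
      using G gamma_density_nonneg[OF assms(1)] by (simp add: ennreal_mult [symmetric])
  qed
  also have "\<dots> = ennreal (1 / Gamma \<alpha>) * (\<integral>\<^sup>+x. ennreal (indicator {0..} x * x powr (?s - 1) / exp ((1 - c) * x)) \<partial>lborel)"
    by (rule nn_integral_cmult) measurable
  also have "(\<integral>\<^sup>+x. ennreal (indicator {0..} x * x powr (?s - 1) / exp ((1 - c) * x)) \<partial>lborel)
    = ennreal \<bar>1 / (1 - c)\<bar> * (\<integral>\<^sup>+u. ennreal (indicator {0..} (0 + 1 / (1 - c) * u) * (0 + 1 / (1 - c) * u) powr (?s - 1) / exp ((1 - c) * (0 + 1 / (1 - c) * u))) \<partial>lborel)"
    using assms by (intro nn_integral_real_affine) auto
  also have "(\<integral>\<^sup>+u. ennreal (indicator {0..} (0 + 1 / (1 - c) * u) * (0 + 1 / (1 - c) * u) powr (?s - 1) / exp ((1 - c) * (0 + 1 / (1 - c) * u))) \<partial>lborel)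
    = (\<integral>\<^sup>+u. ennreal ((1 / (1 - c)) powr (?s - 1)) * ennreal (indicator {0..} u * u powr (?s - 1) / exp u) \<partial>lborel)"
    using assms by (intro nn_integral_cong)
      (auto simp: ennreal_mult [symmetric] indicator_def powr_mult zero_le_divide_iff powr_divide)
  also have "\<dots> = ennreal ((1 / (1 - c)) powr (?s - 1)) * ennreal (Gamma ?s)"
    using assms by (subst nn_integral_cmult) (auto simp: Gamma_conv_nn_integral_real)
  also have "ennreal (1 / Gamma \<alpha>) * (ennreal \<bar>1 / (1 - c)\<bar> * (ennreal ((1 / (1 - c)) powr (?s - 1)) * ennreal (Gamma ?s)))
    = ennreal (1 / Gamma \<alpha> * (\<bar>1 / (1 - c)\<bar> * ((1 / (1 - c)) powr (?s - 1) * Gamma ?s)))"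
    using G by (intro ennreal_mult'[symmetric, THEN trans[rotated]] arg_cong2[of _ _ _ _ "(*)"]) (simp_all add: ennreal_mult' [symmetric])
  also have "1 / Gamma \<alpha> * (\<bar>1 / (1 - c)\<bar> * ((1 / (1 - c)) powr (?s - 1) * Gamma ?s)) = Gamma ?s / Gamma \<alpha> / (1 - c) powr ?s"
  proof -
    have "(1 - c) powr ?s = (1 - c) powr (?s - 1) * (1 - c)"
      using assms by (simp add: powr_diff)
    then show ?thesis using assms by (simp only: powr_divide) (simp add: powr_divide)
  qed
  finally show ?thesis .
qed

lemma prob_space_gamma_distr:
  assumes "\<alpha> > 0" shows "prob_space (gamma_distr \<alpha> 1)"
proof
  have "emeasure (gamma_distr \<alpha> 1) (space (gamma_distr \<alpha> 1)) = (\<integral>\<^sup>+x. ennreal (\<bar>x\<bar> ^ 0 * exp (0 * x)) \<partial>gamma_distr \<alpha> 1)"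
    by simp
  also have "\<dots> = 1" using less_imp_neq[OF Gamma_real_pos[OF assms]] assms
    by (simp only: nn_integral_gamma_exp_tilt[OF assms, of 0 0] zero_less_one) simp
  finally show "emeasure (gamma_distr \<alpha> 1) (space (gamma_distr \<alpha> 1)) = 1" .
qed

lemma integrable_gamma_exp_tilt:
  assumes "\<alpha> > 0" "c < 1"
  shows "integrable (gamma_distr \<alpha> 1) (\<lambda>x. x ^ m * exp (c * x))"
  by (rule integrableI_bounded) (use assms in \<open>auto simp: abs_mult power_abs nn_integral_gamma_exp_tilt\<close>)

lemma gamma_moment:
  assumes "\<alpha> > 0"
  shows "integrable (gamma_distr \<alpha> 1) (\<lambda>x. x ^ m)"
    and "(LINT x|gamma_distr \<alpha> 1. x ^ m) = pochhammer \<alpha> m"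
    and "(LINT x|gamma_distr \<alpha> 1. \<bar>x\<bar> ^ m) = pochhammer \<alpha> m"
proof -
  show i: "integrable (gamma_distr \<alpha> 1) (\<lambda>x. x ^ m)"
    using integrable_gamma_exp_tilt[OF assms, of 0 m] by simp
  have "\<alpha> \<notin> \<int>\<^sub>\<le>\<^sub>0" using assms by auto
  then have p: "pochhammer \<alpha> m = Gamma (\<alpha> + real m) / Gamma \<alpha>"
    by (rule pochhammer_Gamma)
  show a: "(LINT x|gamma_distr \<alpha> 1. \<bar>x\<bar> ^ m) = pochhammer \<alpha> m"
    using nn_integral_gamma_exp_tilt[OF assms, of 0 m] assms unfolding p
    by (subst integral_eq_nn_integral) (auto intro!: divide_nonneg_pos Gamma_real_pos less_imp_le[OF Gamma_real_pos])
  have "(LINT x|gamma_distr \<alpha> 1. x ^ m) = (LINT x|gamma_distr \<alpha> 1. \<bar>x\<bar> ^ m)"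
    using AE_gamma_distr_pos[of \<alpha> 1] by (intro integral_cong_AE) (auto elim!: eventually_mono)
  with a show "(LINT x|gamma_distr \<alpha> 1. x ^ m) = pochhammer \<alpha> m" by simp
qed

section \<open>The normalized Bessel function\<close>

text \<open>
  The hypergeometric function \<open>\<^sub>0F\<^sub>1(\<alpha>; - x)\<close>. It continues both Bessel kernels to the real
  line: positive arguments give \<open>J\<close>, negative ones give \<open>I\<close>.
\<close>

definition hyp01 :: "real \<Rightarrow> real \<Rightarrow> real" where
  "hyp01 \<alpha> x = (\<Sum>m. (- x) ^ m / (fact m * pochhammer \<alpha> m))"

lemma summable_hyp01_abs:
  assumes a: "\<alpha> > (0::real)"
  shows "summable (\<lambda>m. y ^ m / (fact m * pochhammer \<alpha> m))"
proof -
  define N where "N = nat \<lceil>2 * \<bar>y\<bar> / \<alpha>\<rceil>"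
  show ?thesis
  proof (rule summable_ratio_test[where c = "1/2" and N = N])
    fix m assume m: "m \<ge> N"
    have "2 * \<bar>y\<bar> / \<alpha> \<le> real m" using m unfolding N_def by linarith
    then have "2 * \<bar>y\<bar> \<le> real m * \<alpha>" using a by (simp add: field_simps)
    also have "\<dots> \<le> (1 + real m) * (\<alpha> + real m)" using a by (simp add: algebra_simps)
    finally have q: "\<bar>y\<bar> / ((1 + real m) * (\<alpha> + real m)) \<le> 1 / 2"
      using a by (subst divide_le_eq) (auto intro: add_pos_nonneg)
    have "norm (y ^ Suc m / (fact (Suc m) * pochhammer \<alpha> (Suc m)))
      = \<bar>y\<bar> / ((1 + real m) * (\<alpha> + real m)) * norm (y ^ m / (fact m * pochhammer \<alpha> m))"
      using a pochhammer_pos[of \<alpha> m] by (simp add: pochhammer_Suc abs_mult power_abs abs_divide)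
    also have "\<dots> \<le> 1 / 2 * norm (y ^ m / (fact m * pochhammer \<alpha> m))"
      by (rule mult_right_mono[OF q]) simp
    finally show "norm (y ^ Suc m / (fact (Suc m) * pochhammer \<alpha> (Suc m)))
        \<le> 1 / 2 * norm (y ^ m / (fact m * pochhammer \<alpha> m))" .
  qed simp
qed

lemma hyp01_sums:
  assumes "\<alpha> > (0::real)"
  shows "(\<lambda>m. (- x) ^ m / (fact m * pochhammer \<alpha> m)) sums hyp01 \<alpha> x"
  unfolding hyp01_def using summable_hyp01_abs[OF assms] by (rule summable_sums)

lemma hyp01_0 [simp]: "hyp01 \<alpha> 0 = 1"
  unfolding hyp01_def by (subst suminf_finite[of "{0}"]) auto

lemma hyp01_deriv:
  assumes a: "\<alpha> > (0::real)"
  shows "(hyp01 \<alpha> has_real_derivative - hyp01 (\<alpha> + 1) x / \<alpha>) (at x)"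
proof -
  define c where "c m = (-1) ^ m / (fact m * pochhammer \<alpha> m)" for m
  have h: "hyp01 \<alpha> = (\<lambda>x. \<Sum>m. c m * x ^ m)"
    unfolding hyp01_def c_def by (intro ext suminf_cong) (subst power_minus, simp)
  have d: "diffs c m * x ^ m = - 1 / \<alpha> * ((- x) ^ m / (fact m * pochhammer (\<alpha> + 1) m))" for m
  proof -
    have "diffs c m = real (Suc m) / fact (Suc m) * ((-1) ^ Suc m / (\<alpha> * pochhammer (\<alpha> + 1) m))"
      by (simp add: diffs_def c_def pochhammer_rec[of \<alpha>] del: of_nat_Suc fact_Suc)
    also have "real (Suc m) / fact (Suc m) = 1 / fact m"
      by (simp del: of_nat_Suc)
    finally show ?thesis by (subst power_minus) simp
  qed
  have s: "summable (\<lambda>m. c m * y ^ m)" for y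
    using summable_hyp01_abs[OF a, of "- y"] unfolding c_def by (subst (asm) power_minus) simp
  have "((\<lambda>x. \<Sum>m. c m * x ^ m) has_real_derivative (\<Sum>m. diffs c m * x ^ m)) (at x)"
    by (rule termdiffs_strong_converges_everywhere[OF s])
  also have "(\<Sum>m. diffs c m * x ^ m) = - 1 / \<alpha> * hyp01 (\<alpha> + 1) x"
    unfolding d hyp01_def by (rule suminf_mult) (use summable_hyp01_abs[of "\<alpha> + 1"] a in auto)
  finally show ?thesis by (simp add: h)
qed

lemma continuous_on_hyp01: "\<alpha> > 0 \<Longrightarrow> continuous_on S (hyp01 \<alpha>)"
  by (rule DERIV_continuous_on) (auto intro!: DERIV_subset[OF hyp01_deriv])

text \<open>
  The differential equation \<open>x H'' + \<alpha> H' + H = 0\<close>, with the derivatives written through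
  \<open>hyp01_deriv\<close>.
\<close>

lemma hyp01_ODE:
  assumes a: "\<alpha> > (0::real)"
  shows "x * hyp01 (\<alpha> + 2) x / (\<alpha> * (\<alpha> + 1)) - hyp01 (\<alpha> + 1) x + hyp01 \<alpha> x = 0"
proof -
  have 0: "(\<lambda>m. (- x) ^ m / (fact m * pochhammer (\<alpha> + 1) m) - (- x) ^ m / (fact m * pochhammer \<alpha> m)) sums
    (hyp01 (\<alpha> + 1) x - hyp01 \<alpha> x)"
    by (intro sums_diff hyp01_sums) (use a in auto)
  \<comment> \<open>The constant terms of the two series on the left cancel, so the difference starts with the linear term.\<close>
  have e: "(- x) ^ Suc m / (fact (Suc m) * pochhammer (\<alpha> + 1) (Suc m)) - (- x) ^ Suc m / (fact (Suc m) * pochhammer \<alpha> (Suc m))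
    = x / (\<alpha> * (\<alpha> + 1)) * ((- x) ^ m / (fact m * pochhammer (\<alpha> + 2) m))" for m
  proof -
    have 2: "pochhammer (\<alpha> + 1) (Suc m) = (\<alpha> + 1) * pochhammer (\<alpha> + 2) m"
      by (simp add: pochhammer_rec add.assoc)
    have 3: "pochhammer \<alpha> (Suc m) * (\<alpha> + 1 + m) = \<alpha> * pochhammer (\<alpha> + 1) (Suc m)"
      by (simp add: pochhammer_rec[of \<alpha>] pochhammer_Suc[of "\<alpha> + 1"])
    have 4: "1 / pochhammer \<alpha> (Suc m) = (\<alpha> + 1 + m) / (\<alpha> * pochhammer (\<alpha> + 1) (Suc m))"
      unfolding 3[symmetric] using a by (simp del: pochhammer_Suc add: add_pos_nonneg)
    have "(- x) ^ Suc m / (fact (Suc m) * pochhammer (\<alpha> + 1) (Suc m)) - (- x) ^ Suc m / (fact (Suc m) * pochhammer \<alpha> (Suc m))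
      = (- x) ^ Suc m / fact (Suc m) * (1 / pochhammer (\<alpha> + 1) (Suc m) - 1 / pochhammer \<alpha> (Suc m))"
      by (simp only: right_diff_distrib) simp
    also have "1 / pochhammer (\<alpha> + 1) (Suc m) - 1 / pochhammer \<alpha> (Suc m) = - (1 + m) / (\<alpha> * pochhammer (\<alpha> + 1) (Suc m))"
      unfolding 4 using a pochhammer_pos[of "\<alpha> + 1" "Suc m"] by (simp add: field_simps)
    also have "(- x) ^ Suc m / fact (Suc m) * (- (1 + m) / (\<alpha> * pochhammer (\<alpha> + 1) (Suc m)))
      = x / (\<alpha> * (\<alpha> + 1)) * ((- x) ^ m / (fact m * pochhammer (\<alpha> + 2) m))"
    proof -
      have "(- x * y) / (n * f) * (- n / (\<alpha> * ((\<alpha> + 1) * p))) = x / (\<alpha> * (\<alpha> + 1)) * (y / (f * p))"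
        if "n \<noteq> 0" for y n f p :: real
        using that by simp
      from this[of "1 + real m" "(- x) ^ m" "fact m" "pochhammer (\<alpha> + 2) m"] show ?thesis
        unfolding 2 by (simp add: add_eq_0_iff)
    qed
    finally show ?thesis .
  qed
  have "(\<lambda>m. x / (\<alpha> * (\<alpha> + 1)) * ((- x) ^ m / (fact m * pochhammer (\<alpha> + 2) m))) sums (x / (\<alpha> * (\<alpha> + 1)) * hyp01 (\<alpha> + 2) x)"
    by (intro sums_mult hyp01_sums) (use a in auto)
  then have "(\<lambda>m. (- x) ^ m / (fact m * pochhammer (\<alpha> + 1) m) - (- x) ^ m / (fact m * pochhammer \<alpha> m)) sums
      (x / (\<alpha> * (\<alpha> + 1)) * hyp01 (\<alpha> + 2) x)"
    unfolding e[symmetric] by (drule_tac sums_Suc) simp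
  from sums_unique2[OF 0 this] show ?thesis by simp
qed

text \<open>
  The energy \<open>H\<^sup>2 + x H'\<^sup>2\<close> has derivative \<open>(1 - 2 \<alpha>) H'\<^sup>2\<close> by the differential equation,
  and it equals 1 at 0. So it stays below 1 on the half line as soon as \<open>\<alpha> \<ge> 1/2\<close>.
\<close>

lemma abs_hyp01_le_1:
  assumes a: "\<alpha> \<ge> 1 / 2" and x: "x \<ge> 0"
  shows "\<bar>hyp01 \<alpha> x\<bar> \<le> 1"
proof -
  have a0: "\<alpha> > 0" using a by simp
  define v where "v x = hyp01 (\<alpha> + 1) x / \<alpha>" for x
  define E where "E x = (hyp01 \<alpha> x)\<^sup>2 + x * (v x)\<^sup>2" for x
  have "E x \<le> E 0"
  proof (rule DERIV_nonpos_imp_nonincreasing[OF x])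
    fix y :: real assume y: "0 \<le> y"
    define w where "w = hyp01 (\<alpha> + 2) y / (\<alpha> * (\<alpha> + 1))"
    have du: "(hyp01 \<alpha> has_real_derivative - v y) (at y)"
      using hyp01_deriv[OF a0, of y] by (simp add: v_def)
    have dv: "(v has_real_derivative - w) (at y)"
      using DERIV_cdivide[OF hyp01_deriv[of "\<alpha> + 1" y], of \<alpha>] a0
      by (simp add: v_def[abs_def] w_def add.assoc mult.commute)
    have "(E has_real_derivative 2 * hyp01 \<alpha> y * - v y + ((v y)\<^sup>2 + y * (2 * v y * - w))) (at y)"
      unfolding E_def by (auto intro!: derivative_eq_intros du dv)
    moreover have "hyp01 \<alpha> y + y * w = \<alpha> * v y"
      using hyp01_ODE[OF a0, of y] a0 by (simp add: v_def w_def)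
    then have "2 * hyp01 \<alpha> y * - v y + ((v y)\<^sup>2 + y * (2 * v y * - w)) = (1 - 2 * \<alpha>) * (v y)\<^sup>2"
      by algebra
    ultimately show "\<exists>D. (E has_real_derivative D) (at y) \<and> D \<le> 0"
      using a by (intro exI conjI) (auto intro!: mult_nonpos_nonneg)
  qed
  then have "(hyp01 \<alpha> x)\<^sup>2 + x * (v x)\<^sup>2 \<le> 1" by (simp add: E_def)
  moreover have "x * (v x)\<^sup>2 \<ge> 0" using x by simp
  ultimately have "(hyp01 \<alpha> x)\<^sup>2 \<le> 1" by linarith
  then show ?thesis by (simp add: abs_square_le_1)
qed

lemma bessel_series_term:
  assumes x: "x > 0"
  shows "x powr ((1 - \<alpha>) / 2) * ((2 * sqrt x) / 2) powr (2 * real j + (\<alpha> - 1)) = x ^ j"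
proof -
  have "((2 * sqrt x) / 2) powr (2 * real j + (\<alpha> - 1)) = x powr ((2 * real j + (\<alpha> - 1)) / 2)"
    using x by (simp add: powr_half_sqrt[symmetric] powr_powr)
  then have "x powr ((1 - \<alpha>) / 2) * ((2 * sqrt x) / 2) powr (2 * real j + (\<alpha> - 1))
    = x powr ((1 - \<alpha>) / 2 + (2 * real j + (\<alpha> - 1)) / 2)" by (simp add: powr_add)
  also have "(1 - \<alpha>) / 2 + (2 * real j + (\<alpha> - 1)) / 2 = real j" by (simp add: field_simps)
  finally show ?thesis using x by (simp add: powr_realpow)
qed

lemma Gamma_shift_pochhammer:
  "(\<alpha>::real) > 0 \<Longrightarrow> Gamma (\<alpha> + real j) = Gamma \<alpha> * pochhammer \<alpha> j"
  using less_imp_neq[OF Gamma_real_pos[of \<alpha>]] by (subst pochhammer_Gamma) (auto elim: nonpos_Ints_cases)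

lemma hankel_series_aux:
  assumes a: "\<alpha> > 0" and x: "x > 0"
  shows "Gamma \<alpha> * (x powr ((1 - \<alpha>) / 2) * (\<Sum>j. c ^ j / (fact j * Gamma (\<alpha> - 1 + 1 + real j)) * ((2 * sqrt x) / 2) powr (2 * real j + (\<alpha> - 1))))
    = (\<Sum>j. (c * x) ^ j / (fact j * pochhammer \<alpha> j))"
proof -
  have G: "Gamma \<alpha> > 0" using a by (rule Gamma_real_pos)
  define w where "w = x powr ((1 - \<alpha>) / 2)"
  have w: "w > 0" using x by (simp add: w_def)
  have t: "c ^ j / (fact j * Gamma (\<alpha> - 1 + 1 + real j)) * ((2 * sqrt x) / 2) powr (2 * real j + (\<alpha> - 1))
    = (1 / (Gamma \<alpha> * w)) * ((c * x) ^ j / (fact j * pochhammer \<alpha> j))" for j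
    using bessel_series_term[OF x, of \<alpha> j, folded w_def] w G pochhammer_pos[OF a, of j]
    by (simp add: Gamma_shift_pochhammer[OF a] field_simps power_mult_distrib)
  have "(\<Sum>j. c ^ j / (fact j * Gamma (\<alpha> - 1 + 1 + real j)) * ((2 * sqrt x) / 2) powr (2 * real j + (\<alpha> - 1)))
    = 1 / (Gamma \<alpha> * w) * (\<Sum>j. (c * x) ^ j / (fact j * pochhammer \<alpha> j))"
    unfolding t by (rule suminf_mult[OF summable_hyp01_abs[OF a]])
  then show ?thesis using G w by (simp add: w_def[symmetric])
qed

lemma Gamma_hankel_J:
  assumes a: "\<alpha> > 0"
  shows "Gamma \<alpha> * hankel_J \<alpha> x = hyp01 \<alpha> (max 0 x)"
proof (cases "x > 0")
  case True
  then show ?thesis using hankel_series_aux[OF a True, of "-1"]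
    by (simp add: hankel_J_def bessel_J_def hyp01_def)
next
  case False
  then show ?thesis using Gamma_real_pos[OF a] by (simp add: hankel_J_def max_def)
qed

lemma Gamma_hankel_I:
  assumes a: "\<alpha> > 0" and x: "x \<ge> 0"
  shows "Gamma \<alpha> * hankel_I \<alpha> x = hyp01 \<alpha> (- x)"
proof (cases "x > 0")
  case True
  then show ?thesis using hankel_series_aux[OF a True, of 1]
    by (simp add: hankel_I_def bessel_I_def hyp01_def)
next
  case False
  then show ?thesis using Gamma_real_pos[OF a] x by (simp add: hankel_I_def)
qed

section \<open>Laguerre polynomials\<close>

text \<open>
  The Laguerre polynomial \<open>L\<^sub>k\<^bsup>(\<alpha>-1)\<^esup>\<close>, scaled to the value 1 at 0.
\<close>

definition laguerre :: "real \<Rightarrow> nat \<Rightarrow> real \<Rightarrow> real" where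
  "laguerre \<alpha> k x = (\<Sum>i\<le>k. (-1) ^ i * real (k choose i) * x ^ i / pochhammer \<alpha> i)"

text \<open>
  The Cauchy product of the exponential series and the series of \<open>hyp01\<close>.
\<close>

lemma laguerre_generating_function:
  assumes a: "\<alpha> > 0"
  shows "(\<lambda>k. laguerre \<alpha> k x * u ^ k / fact k) sums (exp u * hyp01 \<alpha> (x * u))"
proof -
  define p where "p i = (- (x * u)) ^ i / (fact i * pochhammer \<alpha> i)" for i
  define q where "q i = u ^ i / fact i" for i
  have sp: "summable (\<lambda>i. norm (p i))"
    using summable_hyp01_abs[OF a, of "\<bar>x * u\<bar>"] pochhammer_pos[OF a]
    by (simp add: p_def abs_mult power_abs less_imp_le abs_of_pos)
  have sq: "summable (\<lambda>i. norm (q i))"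
    using summable_exp_generic[of "\<bar>u\<bar>"] by (simp add: q_def power_abs divide_inverse mult.commute abs_mult)
  have "(\<lambda>k. \<Sum>i\<le>k. p i * q (k - i)) sums ((\<Sum>k. p k) * (\<Sum>k. q k))"
    by (rule Cauchy_product_sums[OF sp sq])
  moreover have "(\<Sum>k. p k) = hyp01 \<alpha> (x * u)" by (simp add: p_def hyp01_def)
  moreover have "(\<Sum>k. q k) = exp u" by (simp add: q_def exp_def divide_inverse mult.commute)
  moreover have "(\<Sum>i\<le>k. p i * q (k - i)) = laguerre \<alpha> k x * u ^ k / fact k" for k
    unfolding laguerre_def sum_distrib_right sum_divide_distrib
  proof (rule sum.cong[OF refl])
    fix i assume "i \<in> {..k}"
    then have i: "i \<le> k" by simp
    have u: "u ^ k = u ^ i * u ^ (k - i)" using i by (simp add: power_add [symmetric])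
    have "p i * q (k - i) = (-1) ^ i * x ^ i * u ^ k / pochhammer \<alpha> i / (fact i * fact (k - i))"
      unfolding p_def q_def u by (subst power_minus) (simp add: power_mult_distrib mult_ac)
    also have "\<dots> = (-1) ^ i * real (k choose i) * x ^ i / pochhammer \<alpha> i * u ^ k / fact k"
      using i by (simp add: binomial_fact mult_ac)
    finally show "p i * q (k - i) = (-1) ^ i * real (k choose i) * x ^ i / pochhammer \<alpha> i * u ^ k / fact k" .
  qed
  ultimately show ?thesis by (simp add: mult.commute)
qed

lemma alternating_binomial_sum_Suc:
  fixes f :: "nat \<Rightarrow> real"
  shows "(\<Sum>i\<le>Suc k. (-1) ^ i * real (Suc k choose i) * f i) = (\<Sum>i\<le>k. (-1) ^ i * real (k choose i) * (f i - f (Suc i)))"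
proof -
  have "(\<Sum>i\<le>Suc k. (-1) ^ i * real (Suc k choose i) * f i)
    = f 0 + (\<Sum>i\<le>k. (-1) ^ Suc i * real (k choose Suc i) * f (Suc i)) + (\<Sum>i\<le>k. (-1) ^ Suc i * real (k choose i) * f (Suc i))"
    by (subst sum.atMost_Suc_shift) (simp add: sum.distrib [symmetric] algebra_simps)
  also have "f 0 + (\<Sum>i\<le>k. (-1) ^ Suc i * real (k choose Suc i) * f (Suc i)) = (\<Sum>i\<le>Suc k. (-1) ^ i * real (k choose i) * f i)"
    by (subst sum.atMost_Suc_shift) simp
  also have "\<dots> = (\<Sum>i\<le>k. (-1) ^ i * real (k choose i) * f i)" by simp
  finally show ?thesis by (simp add: sum.distrib [symmetric] algebra_simps)
qed

text \<open>
  The sum is, up to sign, a \<open>k\<close>-th finite difference of a polynomial of degree \<open>m\<close> with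
  leading coefficient 1. The induction uses that the difference of a rising factorial is
  again one: \<open>(a)\<^sub>m - (a+1)\<^sub>m = - m (a+1)\<^bsub>m-1\<^esub>\<close>.
\<close>

lemma alternating_binomial_pochhammer:
  fixes a :: real
  assumes "m \<le> k"
  shows "(\<Sum>i\<le>k. (-1) ^ i * real (k choose i) * pochhammer (a + real i) m) = (if m < k then 0 else (-1) ^ k * fact k)"
  using assms
proof (induction k arbitrary: m a)
  case (Suc k)
  show ?case
  proof (cases m)
    case 0
    then show ?thesis by (subst alternating_binomial_sum_Suc) simp
  next
    case (Suc m')
    have d: "pochhammer (a + real i) m - pochhammer (a + real (Suc i)) m = - real m * pochhammer ((a + 1) + real i) m'" for i
      unfolding Suc pochhammer_rec[of "a + real i"] pochhammer_Suc[of "a + real (Suc i)"]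
      by (simp add: algebra_simps)
    have "(\<Sum>i\<le>Suc k. (-1) ^ i * real (Suc k choose i) * pochhammer (a + real i) m)
      = - real m * (\<Sum>i\<le>k. (-1) ^ i * real (k choose i) * pochhammer ((a + 1) + real i) m')"
      unfolding alternating_binomial_sum_Suc d sum_distrib_left by (intro sum.cong refl) simp
    also have "(\<Sum>i\<le>k. (-1) ^ i * real (k choose i) * pochhammer ((a + 1) + real i) m') = (if m' < k then 0 else (-1) ^ k * fact k)"
      using Suc.prems Suc by (intro Suc.IH) auto
    finally show ?thesis using Suc.prems Suc by (auto simp: algebra_simps)
  qed
qed simp

lemma borel_measurable_laguerre [measurable]: "laguerre \<alpha> k \<in> borel_measurable borel"
  unfolding laguerre_def by measurable

text \<open>
  Since \<open>(\<alpha>)\<^bsub>i+m\<^esub> / (\<alpha>)\<^sub>i = (\<alpha>+i)\<^sub>m\<close>, the moments of the Gamma distribution turn the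
  integral into a finite difference of a rising factorial.
\<close>

lemma laguerre_moment:
  assumes a: "\<alpha> > 0"
  shows "integrable (gamma_distr \<alpha> 1) (\<lambda>x. x ^ m * laguerre \<alpha> k x)"
    and "m \<le> k \<Longrightarrow> (LINT x|gamma_distr \<alpha> 1. x ^ m * laguerre \<alpha> k x) = (if m < k then 0 else (-1) ^ k * fact k)"
proof -
  have e: "x ^ m * laguerre \<alpha> k x = (\<Sum>i\<le>k. ((-1) ^ i * real (k choose i) / pochhammer \<alpha> i) * x ^ (i + m))" for x
    by (simp add: laguerre_def sum_distrib_left power_add mult_ac)
  show "integrable (gamma_distr \<alpha> 1) (\<lambda>x. x ^ m * laguerre \<alpha> k x)"
    unfolding e by (intro Bochner_Integration.integrable_sum integrable_mult_right gamma_moment a)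
  assume m: "m \<le> k"
  have "(LINT x|gamma_distr \<alpha> 1. x ^ m * laguerre \<alpha> k x) = (\<Sum>i\<le>k. ((-1) ^ i * real (k choose i) / pochhammer \<alpha> i) * pochhammer \<alpha> (i + m))"
    unfolding e by (subst Bochner_Integration.integral_sum) (auto intro!: integrable_mult_right gamma_moment a simp: gamma_moment[OF a])
  also have "\<dots> = (\<Sum>i\<le>k. (-1) ^ i * real (k choose i) * pochhammer (\<alpha> + real i) m)"
    using pochhammer_pos[OF a] by (intro sum.cong refl) (simp add: pochhammer_product' less_imp_neq[symmetric])
  finally show "(LINT x|gamma_distr \<alpha> 1. x ^ m * laguerre \<alpha> k x) = (if m < k then 0 else (-1) ^ k * fact k)"
    using alternating_binomial_pochhammer[OF m] by simp
qed

text \<open>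
  Only the leading term of the polynomial of lower degree can contribute.
\<close>

lemma laguerre_orthogonal_le:
  assumes a: "\<alpha> > 0" and jk: "j \<le> k"
  shows "integrable (gamma_distr \<alpha> 1) (\<lambda>x. laguerre \<alpha> j x * laguerre \<alpha> k x)"
    and "(LINT x|gamma_distr \<alpha> 1. laguerre \<alpha> j x * laguerre \<alpha> k x) = (if j = k then fact k / pochhammer \<alpha> k else 0)"
proof -
  have e: "laguerre \<alpha> j x * laguerre \<alpha> k x = (\<Sum>i\<le>j. ((-1) ^ i * real (j choose i) / pochhammer \<alpha> i) * (x ^ i * laguerre \<alpha> k x))" for x
    by (simp add: laguerre_def[of \<alpha> j] sum_distrib_right mult.assoc)
  show "integrable (gamma_distr \<alpha> 1) (\<lambda>x. laguerre \<alpha> j x * laguerre \<alpha> k x)"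
    unfolding e by (intro Bochner_Integration.integrable_sum integrable_mult_right laguerre_moment a)
  have "(LINT x|gamma_distr \<alpha> 1. laguerre \<alpha> j x * laguerre \<alpha> k x)
    = (\<Sum>i\<le>j. ((-1) ^ i * real (j choose i) / pochhammer \<alpha> i) * (if i < k then 0 else (-1) ^ k * fact k))"
    unfolding e by (subst Bochner_Integration.integral_sum)
      (use jk in \<open>auto intro!: integrable_mult_right laguerre_moment a sum.cong simp: laguerre_moment[OF a]\<close>)
  also have "\<dots> = (\<Sum>i\<le>j. if i = k then fact k / pochhammer \<alpha> k else 0)"
    using jk by (intro sum.cong refl) (auto simp: power_mult_distrib [symmetric])
  also have "\<dots> = (if j = k then fact k / pochhammer \<alpha> k else 0)"
    using jk by (auto simp: sum.delta)
  finally show "(LINT x|gamma_distr \<alpha> 1. laguerre \<alpha> j x * laguerre \<alpha> k x) = (if j = k then fact k / pochhammer \<alpha> k else 0)" .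
qed

definition laguerre_n :: "real \<Rightarrow> nat \<Rightarrow> real \<Rightarrow> real" where
  "laguerre_n \<alpha> k x = sqrt (pochhammer \<alpha> k / fact k) * laguerre \<alpha> k x"

lemma borel_measurable_laguerre_n [measurable]: "laguerre_n \<alpha> k \<in> borel_measurable borel"
  unfolding laguerre_n_def by measurable

lemma laguerre_n_0 [simp]: "laguerre_n \<alpha> 0 x = 1"
  and laguerre_n_1: "laguerre_n \<alpha> (Suc 0) x = sqrt \<alpha> * (1 - x / \<alpha>)"
  by (simp_all add: laguerre_n_def laguerre_def)

lemma laguerre_n_orthonormal:
  assumes a: "\<alpha> > 0"
  shows "integrable (gamma_distr \<alpha> 1) (\<lambda>x. laguerre_n \<alpha> j x * laguerre_n \<alpha> k x)"
    and "(LINT x|gamma_distr \<alpha> 1. laguerre_n \<alpha> j x * laguerre_n \<alpha> k x) = (if j = k then 1 else 0)"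
proof -
  have e: "laguerre_n \<alpha> j x * laguerre_n \<alpha> k x
    = sqrt (pochhammer \<alpha> j / fact j) * sqrt (pochhammer \<alpha> k / fact k) * (laguerre \<alpha> j x * laguerre \<alpha> k x)" for j k x
    by (simp add: laguerre_n_def)
  have *: "integrable (gamma_distr \<alpha> 1) (\<lambda>x. laguerre_n \<alpha> j x * laguerre_n \<alpha> k x) \<and>
     (LINT x|gamma_distr \<alpha> 1. laguerre_n \<alpha> j x * laguerre_n \<alpha> k x) = (if j = k then 1 else 0)"
    if "j \<le> k" for j k
    unfolding e using laguerre_orthogonal_le[OF a that] pochhammer_pos[OF a, of k]
    by (auto simp: real_sqrt_mult_self)
  have "j \<le> k \<or> k \<le> j" by linarith
  then show "integrable (gamma_distr \<alpha> 1) (\<lambda>x. laguerre_n \<alpha> j x * laguerre_n \<alpha> k x)"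
    "(LINT x|gamma_distr \<alpha> 1. laguerre_n \<alpha> j x * laguerre_n \<alpha> k x) = (if j = k then 1 else 0)"
    using *[of j k] *[of k j] by (auto simp: mult.commute)
qed

lemma laguerre_n_integral:
  assumes a: "\<alpha> > 0"
  shows "integrable (gamma_distr \<alpha> 1) (laguerre_n \<alpha> k)"
    and "k > 0 \<Longrightarrow> (LINT x|gamma_distr \<alpha> 1. laguerre_n \<alpha> k x) = 0"
  using laguerre_n_orthonormal[OF a, of 0 k] by simp_all

text \<open>
  The coefficient of the \<open>k\<close>-th orthonormal polynomial in the expansion of \<open>H (t x / \<alpha>)\<close>. It
  is cut off at negative \<open>t\<close>, which the Gamma distribution does not charge, to have bounds
  for all real \<open>t\<close>.
\<close>

definition mode :: "real \<Rightarrow> nat \<Rightarrow> real \<Rightarrow> real" where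
  "mode \<alpha> k t = (if t \<ge> 0 then exp (- t / \<alpha>) * (t / \<alpha>) ^ k / sqrt (fact k * pochhammer \<alpha> k) else 0)"

lemma borel_measurable_mode [measurable]: "mode \<alpha> k \<in> borel_measurable borel"
  unfolding mode_def by measurable

lemma laguerre_expansion:
  assumes a: "\<alpha> > 0" and t: "t \<ge> 0"
  shows "(\<lambda>k. mode \<alpha> k t * laguerre_n \<alpha> k x) sums hyp01 \<alpha> (t * x / \<alpha>)"
proof -
  have "(\<lambda>k. exp (- t / \<alpha>) * (laguerre \<alpha> k x * (t / \<alpha>) ^ k / fact k)) sums (exp (- t / \<alpha>) * (exp (t / \<alpha>) * hyp01 \<alpha> (x * (t / \<alpha>))))"
    by (intro sums_mult laguerre_generating_function a)
  moreover have "exp (- t / \<alpha>) * (laguerre \<alpha> k x * (t / \<alpha>) ^ k / fact k) = mode \<alpha> k t * laguerre_n \<alpha> k x" for k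
  proof -
    have "sqrt (pochhammer \<alpha> k / fact k) / sqrt (fact k * pochhammer \<alpha> k) = 1 / fact k"
      using pochhammer_pos[OF a, of k] by (simp add: real_sqrt_divide real_sqrt_mult)
    then have "exp (- t / \<alpha>) * (t / \<alpha>) ^ k * laguerre \<alpha> k x * (1 / fact k) = mode \<alpha> k t * laguerre_n \<alpha> k x"
      using t by (simp add: mode_def laguerre_n_def flip: \<open>_ = 1 / fact k\<close>)
    then show ?thesis by (simp add: mult_ac)
  qed
  moreover have "exp (- t / \<alpha>) * (exp (t / \<alpha>) * hyp01 \<alpha> (x * (t / \<alpha>))) = hyp01 \<alpha> (t * x / \<alpha>)"
    by (simp add: exp_minus mult.commute)
  ultimately show ?thesis by simp
qed

lemma mode_mult_sums:
  assumes a: "\<alpha> > 0" and st: "s \<ge> 0" "t \<ge> 0"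
  shows "(\<lambda>k. mode \<alpha> k s * mode \<alpha> k t) sums (exp (- (s + t) / \<alpha>) * hyp01 \<alpha> (- (s * t / \<alpha>\<^sup>2)))"
proof -
  have "(\<lambda>k. exp (- (s + t) / \<alpha>) * ((- (- (s * t / \<alpha>\<^sup>2))) ^ k / (fact k * pochhammer \<alpha> k))) sums (exp (- (s + t) / \<alpha>) * hyp01 \<alpha> (- (s * t / \<alpha>\<^sup>2)))"
    by (intro sums_mult hyp01_sums a)
  moreover have "exp (- (s + t) / \<alpha>) * ((- (- (s * t / \<alpha>\<^sup>2))) ^ k / (fact k * pochhammer \<alpha> k)) = mode \<alpha> k s * mode \<alpha> k t" for k
  proof -
    have "exp (- (s + t) / \<alpha>) = exp (- s / \<alpha>) * exp (- t / \<alpha>)"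
      by (simp add: exp_add [symmetric] add_divide_distrib diff_divide_distrib)
    moreover have "(s * t / \<alpha>\<^sup>2) ^ k = (s / \<alpha>) ^ k * (t / \<alpha>) ^ k"
      by (simp add: power_mult_distrib [symmetric] power2_eq_square)
    moreover have "fact k * pochhammer \<alpha> k = sqrt (fact k * pochhammer \<alpha> k) * sqrt (fact k * pochhammer \<alpha> k)"
      using pochhammer_pos[OF a, of k] by simp
    ultimately show ?thesis using st by (simp add: mode_def)
  qed
  ultimately show ?thesis by simp
qed

text \<open>
  The two subtracted terms in the covariance are the summands \<open>k = 0\<close> and \<open>k = 1\<close> of the
  full series.
\<close>

lemma limit_covariance_sums:
  assumes a: "\<alpha> > 0" and st: "s \<ge> 0" "t \<ge> 0"
  shows "(\<lambda>k. mode \<alpha> (k + 2) s * mode \<alpha> (k + 2) t) sums limit_covariance \<alpha> s t"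
proof -
  have "exp (- (s + t) / \<alpha>) = exp (- s / \<alpha>) * exp (- t / \<alpha>)"
    by (simp add: exp_add [symmetric] add_divide_distrib diff_divide_distrib)
  then have i: "(\<Sum>k<2. mode \<alpha> k s * mode \<alpha> k t) = exp (- (s + t) / \<alpha>) * (1 + s * t / \<alpha> ^ 3)"
    using st a by (simp add: mode_def numeral_2_eq_2 real_sqrt_mult_self power3_eq_cube algebra_simps)
  have "(\<lambda>k. mode \<alpha> (k + 2) s * mode \<alpha> (k + 2) t) sums (exp (- (s + t) / \<alpha>) * hyp01 \<alpha> (- (s * t / \<alpha>\<^sup>2)) - (\<Sum>k<2. mode \<alpha> k s * mode \<alpha> k t))"
    by (rule sums_split_initial_segment[OF mode_mult_sums[OF assms]])
  also have "exp (- (s + t) / \<alpha>) * hyp01 \<alpha> (- (s * t / \<alpha>\<^sup>2)) - (\<Sum>k<2. mode \<alpha> k s * mode \<alpha> k t) = limit_covariance \<alpha> s t"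
    unfolding i limit_covariance_def using st by (subst Gamma_hankel_I[OF a]) (auto simp: algebra_simps)
  finally show ?thesis .
qed

lemma fact_double_le:
  assumes a: "\<alpha> \<ge> (1 / 2 :: real)"
  shows "fact (2 * k) \<le> 4 ^ k * (fact k * pochhammer \<alpha> k)"
proof (induction k)
  case (Suc k)
  have "fact (2 * Suc k) = (2 * real k + 2) * (2 * real k + 1) * fact (2 * k)"
    by (simp add: algebra_simps)
  also have "\<dots> \<le> (4 * (1 + real k) * (\<alpha> + real k)) * (4 ^ k * (fact k * pochhammer \<alpha> k))"
  proof (rule mult_mono[OF _ Suc.IH])
    have "(2 * real k + 2) * (2 * real k + 1) = (4 * (1 + real k)) * (1 / 2 + real k)" by (simp add: algebra_simps)
    also have "\<dots> \<le> (4 * (1 + real k)) * (\<alpha> + real k)" using a by (intro mult_left_mono) auto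
    finally show "(2 * real k + 2) * (2 * real k + 1) \<le> 4 * (1 + real k) * (\<alpha> + real k)" .
  qed (use a in auto)
  also have "\<dots> = 4 ^ Suc k * (fact (Suc k) * pochhammer \<alpha> (Suc k))"
    by (simp add: pochhammer_Suc)
  finally show ?case .
qed simp

text \<open>
  By \<open>fact_double_le\<close> the square of \<open>R\<^sup>k\<close> times the mode is at most \<open>exp (- 2 u)\<close> times one
  term of the series of \<open>exp (2 R u)\<close>, where \<open>u = t / \<alpha>\<close>. The point is the geometric decay
  in \<open>k\<close>, bought with exponential growth in \<open>t\<close> at a rate that is small for \<open>R\<close> near 1.
\<close>

lemma abs_mode_le:
  assumes a: "\<alpha> \<ge> 1 / 2" and R: "R \<ge> 1"
  shows "\<bar>mode \<alpha> k t\<bar> \<le> exp ((R - 1) * \<bar>t\<bar> / \<alpha>) / R ^ k"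
proof (cases "t \<ge> 0")
  case True
  define u where "u = t / \<alpha>"
  have u: "u \<ge> 0" using True a by (simp add: u_def)
  have p: "pochhammer \<alpha> k > 0" using a by (intro pochhammer_pos) simp
  have "(R ^ k * u ^ k)\<^sup>2 / (fact k * pochhammer \<alpha> k) \<le> (R ^ k * u ^ k)\<^sup>2 / (fact (2 * k) / 4 ^ k)"
    using fact_double_le[OF a, of k] p by (intro divide_left_mono) (auto simp: field_simps)
  also have "\<dots> = (2 * R * u) ^ (2 * k) / fact (2 * k)"
  proof -
    have "(4::real) ^ k = 2 ^ (2 * k)" by (simp add: power_mult)
    then show ?thesis by (simp add: power_mult_distrib power_mult [symmetric] mult.commute)
  qed
  also have "\<dots> \<le> exp (2 * R * u)"
  proof -
    have "(2 * R * u) ^ (2 * k) / fact (2 * k) = (\<Sum>n\<in>{2 * k}. (2 * R * u) ^ n /\<^sub>R fact n)"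
      by (simp add: divide_inverse mult.commute)
    also have "\<dots> \<le> (\<Sum>n. (2 * R * u) ^ n /\<^sub>R fact n)"
      using u R by (intro sum_le_suminf summable_exp_generic) auto
    finally show ?thesis by (simp add: exp_def)
  qed
  also have "exp (2 * R * u) = (exp (R * u))\<^sup>2" by (simp add: power2_eq_square exp_add [symmetric])
  finally have "sqrt ((R ^ k * u ^ k)\<^sup>2 / (fact k * pochhammer \<alpha> k)) \<le> exp (R * u)"
    by (intro real_le_lsqrt) auto
  then have "R ^ k * u ^ k / sqrt (fact k * pochhammer \<alpha> k) \<le> exp (R * u)"
    using u R by (simp add: real_sqrt_divide)
  then have "exp (- u) * (R ^ k * u ^ k / sqrt (fact k * pochhammer \<alpha> k)) \<le> exp (- u) * exp (R * u)"
    by (intro mult_left_mono) auto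
  also have "exp (- u) * exp (R * u) = exp ((R - 1) * u)" by (simp add: exp_add [symmetric] algebra_simps)
  finally have "exp (- u) * (R ^ k * u ^ k / sqrt (fact k * pochhammer \<alpha> k)) / R ^ k \<le> exp ((R - 1) * u) / R ^ k"
    using R by (intro divide_right_mono) auto
  moreover have "exp (- u) * (R ^ k * u ^ k / sqrt (fact k * pochhammer \<alpha> k)) / R ^ k = \<bar>mode \<alpha> k t\<bar>"
    using True R u p by (simp add: mode_def u_def abs_mult)
  ultimately show ?thesis using True by (simp add: u_def)
qed (use R in \<open>simp add: mode_def\<close>)

section \<open>Convergence in distribution through Lipschitz functions\<close>

lemma space_borel_of_topology [simp]: "space (borel_of_topology T) = topspace T"
  by (simp add: borel_of_topology_def space_measure_of_conv)

lemma openin_imp_sets_borel_of_topology: "openin T U \<Longrightarrow> U \<in> sets (borel_of_topology T)"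
  unfolding borel_of_topology_def
  by (subst sets_measure_of) (auto dest: openin_subset intro: sigma_sets.Basic)

lemma measurable_continuous_map_borel_of_topology:
  assumes V: "V \<in> P \<rightarrow>\<^sub>M borel_of_topology T" and F: "continuous_map T euclideanreal F"
  shows "(\<lambda>\<omega>. F (V \<omega>)) \<in> borel_measurable P"
proof -
  have "F \<in> borel_measurable (borel_of_topology T)"
  proof (rule borel_measurableI)
    fix U :: "real set" assume "open U"
    then have "openin T {x \<in> topspace T. F x \<in> U}"
      using F by (auto intro: openin_continuous_map_preimage)
    moreover have "F -` U \<inter> space (borel_of_topology T) = {x \<in> topspace T. F x \<in> U}"
      by auto
    ultimately show "F -` U \<inter> space (borel_of_topology T) \<in> sets (borel_of_topology T)"
      by (simp only: openin_imp_sets_borel_of_topology)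
  qed
  from measurable_compose[OF V this] show ?thesis .
qed

context Metric_space
begin

lemma continuous_map_mtopology_Lipschitz:
  assumes "\<And>x y. x \<in> M \<Longrightarrow> y \<in> M \<Longrightarrow> \<bar>F x - F y\<bar> \<le> L * d x y"
  shows "continuous_map mtopology euclideanreal F"
  unfolding continuous_map_def
proof (intro conjI allI impI)
  fix U :: "real set" assume "openin euclideanreal U"
  then have U: "open U" by simp
  show "openin mtopology {x \<in> topspace mtopology. F x \<in> U}"
    unfolding openin_mtopology
  proof (intro conjI allI impI)
    fix x assume "x \<in> {x \<in> topspace mtopology. F x \<in> U}"
    then have x: "x \<in> M" "F x \<in> U" by auto
    then obtain e where e: "e > 0" "\<And>z. \<bar>z - F x\<bar> < e \<Longrightarrow> z \<in> U"
      using U unfolding open_dist dist_real_def by metis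
    define r where "r = e / (\<bar>L\<bar> + 1)"
    have r: "r > 0" using e by (simp add: r_def)
    have "mball x r \<subseteq> {x \<in> topspace mtopology. F x \<in> U}"
    proof
      fix y assume "y \<in> mball x r"
      then have y: "y \<in> M" "d x y < r" by auto
      have "\<bar>F y - F x\<bar> \<le> L * d y x" using assms x y by blast
      also have "\<dots> \<le> \<bar>L\<bar> * d x y" by (subst commute) (intro mult_right_mono, auto)
      also have "\<dots> \<le> (\<bar>L\<bar> + 1) * d x y" by (intro mult_right_mono) auto
      also have "\<dots> < (\<bar>L\<bar> + 1) * r" using y by (intro mult_strict_left_mono) auto
      also have "\<dots> = e" by (simp add: r_def)
      finally show "y \<in> {x \<in> topspace mtopology. F x \<in> U}" using e y by auto
    qed
    then show "\<exists>r>0. mball x r \<subseteq> {x \<in> topspace mtopology. F x \<in> U}" using r by blast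
  qed auto
qed auto

text \<open>
  The largest \<open>m\<close>-Lipschitz minorant of \<open>F\<close>. For bounded continuous \<open>F\<close> these minorants
  increase to \<open>F\<close> pointwise, which is how Lipschitz test functions reach all bounded
  continuous ones.
\<close>

definition inf_conv :: "('a \<Rightarrow> real) \<Rightarrow> nat \<Rightarrow> 'a \<Rightarrow> real" where
  "inf_conv F m x = (INF y\<in>M. F y + real m * d x y)"

context
  fixes F :: "'a \<Rightarrow> real" and B :: real
  assumes B: "\<And>x. x \<in> M \<Longrightarrow> \<bar>F x\<bar> \<le> B"
begin

lemma inf_conv_bdd_below: "bdd_below ((\<lambda>y. F y + real m * d x y) ` M)"
proof (rule bdd_belowI2)
  fix y assume "y \<in> M"
  then show "- B \<le> F y + real m * d x y"
    using B[of y] mult_nonneg_nonneg[OF of_nat_0_le_iff nonneg, of m x y] by linarith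
qed

lemma inf_conv_le: "x \<in> M \<Longrightarrow> inf_conv F m x \<le> F x"
  unfolding inf_conv_def by (rule cINF_lower2[OF inf_conv_bdd_below, of x]) auto

lemma inf_conv_ge: "x \<in> M \<Longrightarrow> - B \<le> inf_conv F m x"
  unfolding inf_conv_def
proof (rule cINF_greatest)
  fix y assume "y \<in> M"
  then show "- B \<le> F y + real m * d x y"
    using B[of y] mult_nonneg_nonneg[OF of_nat_0_le_iff nonneg, of m x y] by linarith
qed auto

lemma abs_inf_conv_le: "x \<in> M \<Longrightarrow> \<bar>inf_conv F m x\<bar> \<le> B"
  using inf_conv_le[of x m] inf_conv_ge[of x m] B[of x] by linarith

lemma inf_conv_Lipschitz:
  assumes xy: "x \<in> M" "y \<in> M"
  shows "\<bar>inf_conv F m x - inf_conv F m y\<bar> \<le> real m * d x y"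
proof -
  have *: "inf_conv F m x \<le> inf_conv F m y + real m * d x y" if xy: "x \<in> M" "y \<in> M" for x y
  proof -
    have "inf_conv F m x - real m * d x y \<le> F z + real m * d y z" if z: "z \<in> M" for z
    proof -
      have "inf_conv F m x \<le> F z + real m * d x z"
        unfolding inf_conv_def by (rule cINF_lower[OF inf_conv_bdd_below z])
      also have "\<dots> \<le> F z + real m * (d x y + d y z)"
        using triangle[OF xy z] by (intro add_left_mono mult_left_mono) auto
      finally show ?thesis by (simp add: algebra_simps)
    qed
    then have "inf_conv F m x - real m * d x y \<le> inf_conv F m y"
      unfolding inf_conv_def[of F m y] using xy by (intro cINF_greatest) auto
    then show ?thesis by simp
  qed
  show ?thesis using *[OF xy] *[OF xy(2,1)] commute[of x y] by auto
qed

lemma inf_conv_tendsto: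
  assumes F: "continuous_map mtopology euclideanreal F" and x: "x \<in> M"
  shows "(\<lambda>m. inf_conv F m x) \<longlonglongrightarrow> F x"
proof (rule LIMSEQ_I)
  fix e :: real assume e: "e > 0"
  have "openin mtopology {y \<in> topspace mtopology. F y \<in> ball (F x) (e / 2)}"
    using F by (rule openin_continuous_map_preimage) simp
  moreover have "x \<in> {y \<in> topspace mtopology. F y \<in> ball (F x) (e / 2)}" using x e by simp
  ultimately obtain r where r: "r > 0" "mball x r \<subseteq> {y \<in> topspace mtopology. F y \<in> ball (F x) (e / 2)}"
    unfolding openin_mtopology by blast
  define m0 where "m0 = nat \<lceil>2 * B / r\<rceil>"
  have "norm (inf_conv F m x - F x) < e" if m: "m \<ge> m0" for m
  proof -
    have mr: "2 * B \<le> real m * r"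
    proof -
      have "2 * B / r \<le> real m" using m unfolding m0_def by linarith
      then show ?thesis using r by (simp add: field_simps)
    qed
    have "F x - e / 2 \<le> inf_conv F m x"
      unfolding inf_conv_def
    proof (rule cINF_greatest)
      fix y assume y: "y \<in> M"
      show "F x - e / 2 \<le> F y + real m * d x y"
      \<comment> \<open>Near \<open>x\<close> continuity bounds \<open>F y\<close> from below, far from \<open>x\<close> the penalty exceeds the oscillation \<open>2 B\<close>.\<close>
      proof (cases "d x y < r")
        case True
        then have "dist (F x) (F y) < e / 2" using r x y by (auto simp: subset_iff)
        moreover have "real m * d x y \<ge> 0" by simp
        ultimately show ?thesis unfolding dist_real_def by linarith
      next
        case False
        then have "real m * r \<le> real m * d x y" by (intro mult_left_mono) auto
        then show ?thesis using mr B[OF x] B[OF y] e by linarith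
      qed
    qed (use x in auto)
    then show ?thesis using inf_conv_le[OF x, of m] e by (simp add: abs_less_iff)
  qed
  then show "\<exists>no. \<forall>n\<ge>no. norm (inf_conv F n x - F x) < e" by blast
qed

end

text \<open>
  Half of the limit: the minorants bound the expectation from below. The other half comes
  from the same lemma for \<open>- F\<close>.
\<close>

lemma converges_in_distribution_Lipschitz_lower:
  assumes P: "prob_space P" and Q: "prob_space Q"
    and V: "\<And>n. V n \<in> P \<rightarrow>\<^sub>M borel_of_topology mtopology"
    and W: "W \<in> Q \<rightarrow>\<^sub>M borel_of_topology mtopology"
    and L: "\<And>F L B. (\<And>x y. x \<in> M \<Longrightarrow> y \<in> M \<Longrightarrow> \<bar>F x - F y\<bar> \<le> L * d x y) \<Longrightarrow>
        (\<And>x. x \<in> M \<Longrightarrow> \<bar>F x\<bar> \<le> B) \<Longrightarrow> L \<ge> 0 \<Longrightarrow>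
        (\<lambda>n. LINT \<omega>|P. F (V n \<omega>)) \<longlonglongrightarrow> (LINT \<omega>|Q. F (W \<omega>))"
    and F: "continuous_map mtopology euclideanreal F" and B: "\<And>x. x \<in> M \<Longrightarrow> \<bar>F x\<bar> \<le> B"
    and e: "e > 0"
  shows "eventually (\<lambda>n. (LINT \<omega>|Q. F (W \<omega>)) - e < (LINT \<omega>|P. F (V n \<omega>))) sequentially"
proof -
  interpret P: prob_space P by fact
  interpret Q: prob_space Q by fact
  have VM: "V n \<omega> \<in> M" if "\<omega> \<in> space P" for n \<omega>
    using measurable_space[OF V that] by simp
  have WM: "W \<omega> \<in> M" if "\<omega> \<in> space Q" for \<omega>
    using measurable_space[OF W that] by simp
  have iP: "integrable P (\<lambda>\<omega>. G (V n \<omega>))"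
    if "continuous_map mtopology euclideanreal G" "\<And>x. x \<in> M \<Longrightarrow> \<bar>G x\<bar> \<le> B" for G n
    using that by (intro P.integrable_const_bound[where B = B])
      (auto intro!: AE_I2 VM measurable_continuous_map_borel_of_topology[OF V])
  note cont = continuous_map_mtopology_Lipschitz[OF inf_conv_Lipschitz[of F B, OF B]]
  have "(\<lambda>m. LINT \<omega>|Q. inf_conv F m (W \<omega>)) \<longlonglongrightarrow> (LINT \<omega>|Q. F (W \<omega>))"
  proof (rule integral_dominated_convergence[where w = "\<lambda>_. B"])
    show "(\<lambda>\<omega>. F (W \<omega>)) \<in> borel_measurable Q"
      by (rule measurable_continuous_map_borel_of_topology[OF W F])
    show "(\<lambda>\<omega>. inf_conv F m (W \<omega>)) \<in> borel_measurable Q" for m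
      by (rule measurable_continuous_map_borel_of_topology[OF W cont])
  qed (auto intro!: AE_I2 inf_conv_tendsto[OF B F] WM abs_inf_conv_le[OF B])
  then have "eventually (\<lambda>m. (LINT \<omega>|Q. F (W \<omega>)) - e / 2 < (LINT \<omega>|Q. inf_conv F m (W \<omega>))) sequentially"
    using e by (intro order_tendstoD) auto
  then obtain m where m: "(LINT \<omega>|Q. F (W \<omega>)) - e / 2 < (LINT \<omega>|Q. inf_conv F m (W \<omega>))"
    using eventually_happens'[OF sequentially_bot] by blast
  have "(\<lambda>n. LINT \<omega>|P. inf_conv F m (V n \<omega>)) \<longlonglongrightarrow> (LINT \<omega>|Q. inf_conv F m (W \<omega>))"
    by (rule L[of _ "real m" B]) (auto intro: inf_conv_Lipschitz[OF B] abs_inf_conv_le[OF B])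
  then have "eventually (\<lambda>n. (LINT \<omega>|Q. inf_conv F m (W \<omega>)) - e / 2 < (LINT \<omega>|P. inf_conv F m (V n \<omega>))) sequentially"
    using e by (intro order_tendstoD) auto
  then show ?thesis
  proof eventually_elim
    case (elim n)
    have "(LINT \<omega>|P. inf_conv F m (V n \<omega>)) \<le> (LINT \<omega>|P. F (V n \<omega>))"
      by (intro integral_mono iP F cont abs_inf_conv_le[of F B, OF B] B inf_conv_le[of F B, OF B] VM) auto
    with elim m show ?case by linarith
  qed
qed

lemma converges_in_distribution_LipschitzI:
  assumes P: "prob_space P" and Q: "prob_space Q"
    and V: "\<And>n. V n \<in> P \<rightarrow>\<^sub>M borel_of_topology mtopology"
    and W: "W \<in> Q \<rightarrow>\<^sub>M borel_of_topology mtopology"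
    and L: "\<And>F L B. (\<And>x y. x \<in> M \<Longrightarrow> y \<in> M \<Longrightarrow> \<bar>F x - F y\<bar> \<le> L * d x y) \<Longrightarrow>
        (\<And>x. x \<in> M \<Longrightarrow> \<bar>F x\<bar> \<le> B) \<Longrightarrow> L \<ge> 0 \<Longrightarrow>
        (\<lambda>n. LINT \<omega>|P. F (V n \<omega>)) \<longlonglongrightarrow> (LINT \<omega>|Q. F (W \<omega>))"
  shows "converges_in_distribution mtopology P V Q W"
  unfolding converges_in_distribution_def
proof (intro conjI allI impI V W, elim conjE)
  fix F :: "'a \<Rightarrow> real"
  assume F: "continuous_map mtopology euclideanreal F" and "bounded (F ` topspace mtopology)"
  then obtain B where B: "\<And>x. x \<in> M \<Longrightarrow> \<bar>F x\<bar> \<le> B" unfolding bounded_iff by auto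
  have F': "continuous_map mtopology euclideanreal (\<lambda>x. - F x)"
    using F by (intro continuous_map_minus) auto
  have low: "eventually (\<lambda>n. (LINT \<omega>|Q. G (W \<omega>)) - e < (LINT \<omega>|P. G (V n \<omega>))) sequentially"
    if "continuous_map mtopology euclideanreal G" "\<And>x. x \<in> M \<Longrightarrow> \<bar>G x\<bar> \<le> B" "e > 0" for G e
    using that
  proof (intro converges_in_distribution_Lipschitz_lower[OF P Q V W _ that(1), where B = B], goal_cases)
    case (1 F L B)
    show ?case by (rule L[OF 1(4-6)])
  qed
  show "(\<lambda>n. LINT \<omega>|P. F (V n \<omega>)) \<longlonglongrightarrow> (LINT \<omega>|Q. F (W \<omega>))"
  proof (rule LIMSEQ_I)
    fix e :: real assume e: "e > 0"
    have "eventually (\<lambda>n. (LINT \<omega>|Q. F (W \<omega>)) - e < (LINT \<omega>|P. F (V n \<omega>))) sequentially"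
      by (rule low[OF F B e])
    moreover have "eventually (\<lambda>n. (LINT \<omega>|Q. - F (W \<omega>)) - e < (LINT \<omega>|P. - F (V n \<omega>))) sequentially"
      by (rule low[OF F' _ e]) (auto intro: B)
    ultimately have "eventually (\<lambda>n. norm ((LINT \<omega>|P. F (V n \<omega>)) - (LINT \<omega>|Q. F (W \<omega>))) < e) sequentially"
      by eventually_elim (auto simp: abs_less_iff)
    then show "\<exists>no. \<forall>n\<ge>no. norm ((LINT \<omega>|P. F (V n \<omega>)) - (LINT \<omega>|Q. F (W \<omega>))) < e"
      by (simp add: eventually_sequentially)
  qed
qed

end

section \<open>Trigonometric test functions\<close>

text \<open>
  Trigonometric polynomials in finitely many coordinates of a sequence. The arbitrary phases
  \<open>c\<close> make sines and constants special cases. Expectations of these functions are determined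
  by characteristic functions of linear combinations.
\<close>

inductive_set trig :: "((nat \<Rightarrow> real) \<Rightarrow> real) set" where
  cos: "(\<lambda>x. cos ((\<Sum>k<m. u k * x k) + c)) \<in> trig"
| scale: "f \<in> trig \<Longrightarrow> (\<lambda>x. a * f x) \<in> trig"
| add: "f \<in> trig \<Longrightarrow> g \<in> trig \<Longrightarrow> (\<lambda>x. f x + g x) \<in> trig"

lemma sum_pad:
  fixes u :: "nat \<Rightarrow> real" assumes "m \<le> p"
  shows "(\<Sum>k<m. u k * x k) = (\<Sum>k<p. (if k < m then u k else 0) * x k)"
proof -
  have "(\<Sum>k<p. (if k < m then u k else 0) * x k) = (\<Sum>k<m. (if k < m then u k else 0) * x k)"
    using assms by (intro sum.mono_neutral_right) auto
  also have "\<dots> = (\<Sum>k<m. u k * x k)" by (intro sum.cong) auto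
  finally show ?thesis by simp
qed

lemma trig_mult_cos:
  assumes "g \<in> trig"
  shows "(\<lambda>x. cos ((\<Sum>k<m. u k * x k) + c) * g x) \<in> trig"
  using assms
proof induction
  case (cos u' m' c')
  \<comment> \<open>Both frequency vectors are padded with zeros to a common length before the product formula is used.\<close>
  define p where "p = max m m'"
  define v where "v k = (if k < m then u k else 0)" for k
  define v' where "v' k = (if k < m' then u' k else 0)" for k
  have e: "(\<Sum>k<m. u k * x k) = (\<Sum>k<p. v k * x k)" "(\<Sum>k<m'. u' k * x k) = (\<Sum>k<p. v' k * x k)" for x
    unfolding v_def v'_def p_def by (rule sum_pad, simp)+
  have "cos ((\<Sum>k<m. u k * x k) + c) * cos ((\<Sum>k<m'. u' k * x k) + c')
    = (1 / 2) * (cos ((\<Sum>k<p. (v k - v' k) * x k) + (c - c')) + cos ((\<Sum>k<p. (v k + v' k) * x k) + (c + c')))" for x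
  proof -
    have 1: "(\<Sum>k<p. (v k - v' k) * x k) + (c - c') = ((\<Sum>k<p. v k * x k) + c) - ((\<Sum>k<p. v' k * x k) + c')"
      by (simp add: left_diff_distrib sum_subtractf)
    have 2: "(\<Sum>k<p. (v k + v' k) * x k) + (c + c') = ((\<Sum>k<p. v k * x k) + c) + ((\<Sum>k<p. v' k * x k) + c')"
      by (simp add: distrib_right sum.distrib)
    show ?thesis unfolding e 1 2 cos_times_cos by simp
  qed
  then show ?case by (simp only:) (intro trig.intros)
next
  case (scale g a)
  have "(\<lambda>x. a * (cos ((\<Sum>k<m. u k * x k) + c) * g x)) \<in> trig" by (rule trig.scale[OF scale.IH])
  then show ?case by (simp add: mult.left_commute)
next
  case (add g h)
  have "(\<lambda>x. cos ((\<Sum>k<m. u k * x k) + c) * g x + cos ((\<Sum>k<m. u k * x k) + c) * h x) \<in> trig"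
    by (rule trig.add[OF add.IH])
  then show ?case by (simp add: distrib_left)
qed

lemma trig_mult:
  assumes "f \<in> trig" "g \<in> trig"
  shows "(\<lambda>x. f x * g x) \<in> trig"
  using assms(1)
proof induction
  case (cos u m c)
  then show ?case by (rule trig_mult_cos[OF assms(2)])
next
  case (scale f a)
  have "(\<lambda>x. a * (f x * g x)) \<in> trig" by (rule trig.scale[OF scale.IH])
  then show ?case by (simp add: mult.assoc)
next
  case (add f h)
  have "(\<lambda>x. f x * g x + h x * g x) \<in> trig" by (rule trig.add[OF add.IH])
  then show ?case by (simp add: distrib_right)
qed

lemma trig_const: "(\<lambda>_. c) \<in> trig"
  using trig.scale[OF trig.cos[of "\<lambda>_. 0" 0 0], of c] by simp

lemma trig_sin_coordinate: "(\<lambda>x. sin (a * x k)) \<in> trig"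
proof -
  have "(\<Sum>j<Suc k. (if j = k then a else 0) * x j) = a * x k" for x :: "nat \<Rightarrow> real"
    by (simp add: sum.neutral)
  then have "(\<lambda>x. sin (a * x k)) = (\<lambda>x. cos ((\<Sum>j<Suc k. (if j = k then a else 0) * x j) + (- (pi / 2))))"
    by (simp add: cos_diff del: sum.lessThan_Suc)
  then show ?thesis by (simp only:) (rule trig.cos)
qed

text \<open>
  By Stone and Weierstrass, polynomials in the coordinates approximate \<open>f\<close> on the compact
  cube \<open>[-R, R]\<^sup>\<nat>\<close>. Substituting \<open>R sin (x\<^sub>k / R)\<close> maps the whole space into the cube and
  turns polynomials into trigonometric polynomials, so the approximation is uniform on the
  whole space.
\<close>

lemma trig_approximation:
  fixes f :: "(nat \<Rightarrow> real) \<Rightarrow> real"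
  assumes f: "continuous_on UNIV f" and R: "R > 0" and e: "e > 0"
  shows "\<exists>h\<in>trig. \<forall>x. \<bar>f (\<lambda>k. R * sin (x k / R)) - h x\<bar> < e"
proof -
  define S where "S = (PiE UNIV (\<lambda>_. {-R..R}) :: (nat \<Rightarrow> real) set)"
  define \<tau> where "\<tau> x = (\<lambda>k. R * sin (x k / R))" for x :: "nat \<Rightarrow> real"
  define p where "p g \<longleftrightarrow> continuous_on UNIV g \<and> (\<lambda>x. g (\<tau> x)) \<in> trig" for g :: "(nat \<Rightarrow> real) \<Rightarrow> real"
  have "compactin (product_topology (\<lambda>_::nat. euclideanreal) UNIV) S"
    unfolding S_def by (subst compactin_PiE) auto
  then have S: "compact S" by (simp add: euclidean_product_topology)
  \<comment> \<open>The algebra consists of the continuous \<open>g\<close> that become trigonometric after the substitution.\<close>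
  have "\<exists>g. p g \<and> (\<forall>x\<in>S. \<bar>f x - g x\<bar> < e)"
  proof (rule Stone_Weierstrass_HOL[OF S])
    show "p (\<lambda>x. c)" for c by (simp add: p_def trig_const)
    show "continuous_on S g" if "p g" for g using that continuous_on_subset unfolding p_def by blast
    show "p (\<lambda>x. g x + h x)" if "p g \<and> p h" for g h
      using that by (auto simp: p_def intro!: continuous_intros trig.add)
    show "p (\<lambda>x. g x * h x)" if "p g \<and> p h" for g h
      using that by (auto simp: p_def intro!: continuous_intros trig_mult)
    show "\<exists>g. p g \<and> g x \<noteq> g y" if "x \<in> S \<and> y \<in> S \<and> x \<noteq> y" for x y
    proof -
      have "x \<noteq> y" using that by blast
      then obtain k where k: "x k \<noteq> y k" by (metis ext)
      have "p (\<lambda>x. x k)"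
        using trig.scale[OF trig_sin_coordinate[of "1 / R" k], of R] by (simp add: p_def \<tau>_def)
      then show ?thesis using k by blast
    qed
    show "continuous_on S f" using f continuous_on_subset by blast
  qed (rule e)
  then obtain g where g: "p g" "\<And>x. x \<in> S \<Longrightarrow> \<bar>f x - g x\<bar> < e" by blast
  have "\<tau> x \<in> S" for x
  proof -
    have "- R \<le> R * sin y \<and> R * sin y \<le> R" for y
      using mult_left_mono[of "sin y" 1 R] mult_left_mono[of "- 1" "sin y" R] R by simp
    then show ?thesis by (auto simp: S_def \<tau>_def)
  qed
  then have "\<bar>f (\<tau> x) - g (\<tau> x)\<bar> < e" for x by (rule g(2))
  then show ?thesis using g(1) unfolding p_def \<tau>_def by (intro bexI[of _ "\<lambda>x. g (\<lambda>k. R * sin (x k / R))"]) auto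
qed

lemma trig_measurable_bounded:
  assumes "f \<in> trig"
  shows "continuous_on UNIV f" "\<exists>B. \<forall>x. \<bar>f x\<bar> \<le> B"
proof -
  show "continuous_on UNIV f"
    using assms by induction (auto intro!: continuous_intros)
  show "\<exists>B. \<forall>x. \<bar>f x\<bar> \<le> B"
    using assms
  proof induction
    case (cos u m c)
    show ?case by (intro exI[of _ 1]) auto
  next
    case (scale f a)
    then obtain B where "\<forall>x. \<bar>f x\<bar> \<le> B" by blast
    then show ?case by (intro exI[of _ "\<bar>a\<bar> * B"]) (auto simp: abs_mult intro!: mult_left_mono)
  next
    case (add f g)
    then obtain B C where BC: "\<And>x. \<bar>f x\<bar> \<le> B" "\<And>x. \<bar>g x\<bar> \<le> C" by blast
    have "\<bar>f x + g x\<bar> \<le> B + C" for x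
      using BC[of x] by linarith
    then show ?case by (intro exI[of _ "B + C"]) auto
  qed
qed

lemma measurable_coordinatewise_borel:
  fixes S :: "'a \<Rightarrow> nat \<Rightarrow> real"
  assumes "\<And>k. (\<lambda>\<omega>. S \<omega> k) \<in> borel_measurable P"
  shows "S \<in> borel_measurable P"
proof -
  have "S \<in> P \<rightarrow>\<^sub>M Pi\<^sub>M UNIV (\<lambda>_::nat. borel)"
    by (rule measurable_PiM_single') (use assms in auto)
  then show ?thesis
    using measurable_cong_sets[OF refl sets_PiM_equal_borel[where 'a=nat and 'b=real], of P] by simp
qed

lemma abs_sin_scaled_diff_le:
  assumes R: "R > (0::real)"
  shows "\<bar>x - R * sin (x / R)\<bar> \<le> x\<^sup>2 / (2 * R)"
proof -
  have "\<bar>sin (x / R) - x / R\<bar> \<le> (x / R)\<^sup>2 / 2"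
    using Maclaurin_sin_bound[of "x / R" 2] by (simp add: numeral_2_eq_2 sin_coeff_def)
  then have "R * \<bar>sin (x / R) - x / R\<bar> \<le> R * ((x / R)\<^sup>2 / 2)" using R by (intro mult_left_mono) auto
  also have "R * \<bar>sin (x / R) - x / R\<bar> = \<bar>R * sin (x / R) - x\<bar>"
    using R by (subst abs_of_pos[OF R, symmetric], subst abs_mult[symmetric]) (simp add: right_diff_distrib)
  also have "R * ((x / R)\<^sup>2 / 2) = x\<^sup>2 / (2 * R)" using R by (simp add: power2_eq_square)
  finally show ?thesis by (simp add: abs_minus_commute)
qed

lemma Lipschitz_coordinates_continuous:
  fixes f :: "(nat \<Rightarrow> real) \<Rightarrow> real"
  assumes f: "\<And>x y. \<bar>f x - f y\<bar> \<le> L * (\<Sum>k<K. \<bar>x k - y k\<bar>)"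
  shows "continuous_on UNIV f"
proof -
  have "(f \<longlongrightarrow> f x) (at x)" for x
  proof -
    have "((\<lambda>y. y k) \<longlongrightarrow> x k) (at x)" for k
    proof -
      have "continuous_on UNIV (\<lambda>y::nat \<Rightarrow> real. y k)" by (rule continuous_on_product_coordinates)
      then show ?thesis unfolding continuous_on_def by simp
    qed
    then have "((\<lambda>y. L * (\<Sum>k<K. \<bar>y k - x k\<bar>)) \<longlongrightarrow> L * (\<Sum>k<K. \<bar>x k - x k\<bar>)) (at x)"
      by (intro tendsto_intros)
    then have "((\<lambda>y. L * (\<Sum>k<K. \<bar>y k - x k\<bar>)) \<longlongrightarrow> 0) (at x)" by simp
    then have "((\<lambda>y. f y - f x) \<longlongrightarrow> 0) (at x)"
      by (rule Lim_null_comparison[rotated]) (auto simp: f)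
    then show ?thesis by (simp add: LIM_zero_iff)
  qed
  then show ?thesis by (simp add: continuous_on_def)
qed

lemma expectation_sin_truncation:
  fixes f :: "(nat \<Rightarrow> real) \<Rightarrow> real" and S :: "'a \<Rightarrow> nat \<Rightarrow> real"
  assumes P: "prob_space P"
    and f: "\<And>x y. \<bar>f x - f y\<bar> \<le> L * (\<Sum>k<K. \<bar>x k - y k\<bar>)" and L: "L \<ge> 0" and B: "\<And>x. \<bar>f x\<bar> \<le> B"
    and S: "\<And>k. (\<lambda>\<omega>. S \<omega> k) \<in> borel_measurable P"
    and S2: "\<And>k. integrable P (\<lambda>\<omega>. (S \<omega> k)\<^sup>2)" "\<And>k. (LINT \<omega>|P. (S \<omega> k)\<^sup>2) \<le> 1"
    and R: "R > 0" and h: "h \<in> trig" "\<And>x. \<bar>f (\<lambda>k. R * sin (x k / R)) - h x\<bar> \<le> e"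
  shows "\<bar>(LINT \<omega>|P. f (S \<omega>)) - (LINT \<omega>|P. h (S \<omega>))\<bar> \<le> L * K / (2 * R) + e"
proof -
  interpret prob_space P by fact
  have [measurable]: "S \<in> borel_measurable P" using S by (rule measurable_coordinatewise_borel)
  have [measurable]: "f \<in> borel_measurable borel" "h \<in> borel_measurable borel"
    using Lipschitz_coordinates_continuous[OF f] trig_measurable_bounded(1)[OF h(1)]
    by (auto intro: borel_measurable_continuous_onI)
  obtain C where C: "\<And>x. \<bar>h x\<bar> \<le> C" using trig_measurable_bounded(2)[OF h(1)] by blast
  have i: "integrable P (\<lambda>\<omega>. f (S \<omega>))" "integrable P (\<lambda>\<omega>. h (S \<omega>))"
    by (rule integrable_const_bound[where B = B], use B in auto)
       (rule integrable_const_bound[where B = C], use C in auto)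
  have pt: "\<bar>f x - h x\<bar> \<le> L / (2 * R) * (\<Sum>k<K. (x k)\<^sup>2) + e" for x
  proof -
    have "\<bar>f x - f (\<lambda>k. R * sin (x k / R))\<bar> \<le> L * (\<Sum>k<K. \<bar>x k - R * sin (x k / R)\<bar>)" by (rule f)
    also have "\<dots> \<le> L * (\<Sum>k<K. (x k)\<^sup>2 / (2 * R))"
      using L R by (intro mult_left_mono sum_mono abs_sin_scaled_diff_le) auto
    also have "\<dots> = L / (2 * R) * (\<Sum>k<K. (x k)\<^sup>2)" by (simp flip: sum_divide_distrib)
    finally show ?thesis using h(2)[of x] by linarith
  qed
  have "\<bar>(LINT \<omega>|P. f (S \<omega>)) - (LINT \<omega>|P. h (S \<omega>))\<bar> = \<bar>LINT \<omega>|P. f (S \<omega>) - h (S \<omega>)\<bar>"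
    using i by simp
  also have "\<dots> \<le> (LINT \<omega>|P. \<bar>f (S \<omega>) - h (S \<omega>)\<bar>)" by (rule integral_abs_bound)
  also have "\<dots> \<le> (LINT \<omega>|P. L / (2 * R) * (\<Sum>k<K. (S \<omega> k)\<^sup>2) + e)"
    using i S2 by (intro integral_mono pt) auto
  also have "\<dots> = L / (2 * R) * (\<Sum>k<K. LINT \<omega>|P. (S \<omega> k)\<^sup>2) + e"
    using S2(1) by (simp add: Bochner_Integration.integral_sum prob_space)
  also have "\<dots> \<le> L / (2 * R) * (\<Sum>k<K. 1) + e"
    using S2(2) L R by (intro add_right_mono mult_left_mono sum_mono) auto
  finally show ?thesis by simp
qed

text \<open>
  The multivariate step from characteristic functions to Lipschitz functions. The
  substitution \<open>x\<^sub>k \<mapsto> R sin (x\<^sub>k / R)\<close> moves a coordinate by at most \<open>x\<^sub>k\<^sup>2 / (2 R)\<close>, which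
  is small in expectation, uniformly in \<open>n\<close>, thanks to the second moments.
\<close>

lemma Lipschitz_expectation_limit:
  fixes f :: "(nat \<Rightarrow> real) \<Rightarrow> real" and S :: "nat \<Rightarrow> 'a \<Rightarrow> nat \<Rightarrow> real" and \<xi> :: "'b \<Rightarrow> nat \<Rightarrow> real"
  assumes P: "prob_space P" and Q: "prob_space Q"
    and S: "\<And>n k. (\<lambda>\<omega>. S n \<omega> k) \<in> borel_measurable P"
    and S2: "\<And>n k. integrable P (\<lambda>\<omega>. (S n \<omega> k)\<^sup>2)" "\<And>n k. (LINT \<omega>|P. (S n \<omega> k)\<^sup>2) \<le> 1"
    and X: "\<And>k. (\<lambda>\<omega>. \<xi> \<omega> k) \<in> borel_measurable Q"
    and X2: "\<And>k. integrable Q (\<lambda>\<omega>. (\<xi> \<omega> k)\<^sup>2)" "\<And>k. (LINT \<omega>|Q. (\<xi> \<omega> k)\<^sup>2) \<le> 1"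
    and cf: "\<And>m u c. (\<lambda>n. LINT \<omega>|P. cos ((\<Sum>k<m. u k * S n \<omega> k) + c)) \<longlonglongrightarrow> (LINT \<omega>|Q. cos ((\<Sum>k<m. u k * \<xi> \<omega> k) + c))"
    and f: "\<And>x y. \<bar>f x - f y\<bar> \<le> L * (\<Sum>k<K. \<bar>x k - y k\<bar>)" and L: "L \<ge> 0" and B: "\<And>x. \<bar>f x\<bar> \<le> B"
  shows "(\<lambda>n. LINT \<omega>|P. f (S n \<omega>)) \<longlonglongrightarrow> (LINT \<omega>|Q. f (\<xi> \<omega>))"
proof (rule LIMSEQ_I)
  fix e :: real assume e: "e > 0"
  interpret P: prob_space P by fact
  interpret Q: prob_space Q by fact
  have [measurable]: "S n \<in> borel_measurable P" for n using S by (rule measurable_coordinatewise_borel)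
  have [measurable]: "\<xi> \<in> borel_measurable Q" using X by (rule measurable_coordinatewise_borel)
  have trig: "(\<lambda>n. LINT \<omega>|P. h (S n \<omega>)) \<longlonglongrightarrow> (LINT \<omega>|Q. h (\<xi> \<omega>))" if "h \<in> trig" for h
    using that
  proof induction
    case (cos u m c)
    then show ?case by (rule cf)
  next
    case (scale h a)
    then show ?case by (simp add: tendsto_mult_left)
  next
    case (add g h)
    have i: "integrable P (\<lambda>\<omega>. g (S n \<omega>))" "integrable Q (\<lambda>\<omega>. g (\<xi> \<omega>))" if "g \<in> trig" for n g
    proof -
      obtain C where C: "\<And>x. \<bar>g x\<bar> \<le> C" using trig_measurable_bounded(2)[OF \<open>g \<in> trig\<close>] by blast
      have [measurable]: "g \<in> borel_measurable borel"
        using trig_measurable_bounded(1)[OF \<open>g \<in> trig\<close>] by (rule borel_measurable_continuous_onI)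
      show "integrable P (\<lambda>\<omega>. g (S n \<omega>))" "integrable Q (\<lambda>\<omega>. g (\<xi> \<omega>))"
        using C by (auto intro!: P.integrable_const_bound[where B = C] Q.integrable_const_bound[where B = C])
    qed
    show ?case using add i by (simp add: tendsto_add)
  qed
  \<comment> \<open>Chosen so that \<open>L K / (2 R) \<le> e / 4\<close>. The summand 1 keeps \<open>R\<close> positive.\<close>
  define R where "R = 2 * L * K / e + 1"
  have R: "R > 0" using L e by (simp add: R_def add_nonneg_pos)
  have "L * K / (2 * R) \<le> e / 4"
  proof -
    have "4 * (L * K) \<le> e * (2 * R)" using e by (simp add: R_def field_simps)
    then show ?thesis using R by (simp add: field_simps)
  qed
  moreover obtain h where h: "h \<in> trig" "\<And>x. \<bar>f (\<lambda>k. R * sin (x k / R)) - h x\<bar> < e / 16"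
    using trig_approximation[OF Lipschitz_coordinates_continuous[OF f] R, of "e / 16"] e by auto
  note h' = h(1) less_imp_le[OF h(2)]
  have a: "\<bar>(LINT \<omega>|P. f (S n \<omega>)) - (LINT \<omega>|P. h (S n \<omega>))\<bar> \<le> L * K / (2 * R) + e / 16" for n
    by (rule expectation_sin_truncation[OF P f L B S S2 R h'])
  have b: "\<bar>(LINT \<omega>|Q. f (\<xi> \<omega>)) - (LINT \<omega>|Q. h (\<xi> \<omega>))\<bar> \<le> L * K / (2 * R) + e / 16"
    by (rule expectation_sin_truncation[OF Q f L B X X2 R h'])
  have "eventually (\<lambda>n. \<bar>(LINT \<omega>|P. h (S n \<omega>)) - (LINT \<omega>|Q. h (\<xi> \<omega>))\<bar> < e / 4) sequentially"
    using tendstoD[OF trig[OF h(1)], of "e / 4"] e by (simp add: dist_real_def)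
  then have "eventually (\<lambda>n. norm ((LINT \<omega>|P. f (S n \<omega>)) - (LINT \<omega>|Q. f (\<xi> \<omega>))) < e) sequentially"
  proof eventually_elim
    case (elim n)
    then show ?case using a[of n] b \<open>L * K / (2 * R) \<le> e / 4\<close> e unfolding real_norm_def by linarith
  qed
  then show "\<exists>no. \<forall>n\<ge>no. norm ((LINT \<omega>|P. f (S n \<omega>)) - (LINT \<omega>|Q. f (\<xi> \<omega>))) < e"
    by (simp add: eventually_sequentially)
qed

section \<open>Real functions in \<open>L\<^sup>2\<close>\<close>

definition square_integrable :: "'t measure \<Rightarrow> ('t \<Rightarrow> real) \<Rightarrow> bool" where
  "square_integrable T f \<longleftrightarrow> f \<in> borel_measurable T \<and> integrable T (\<lambda>t. (f t)\<^sup>2)"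

definition L2_real :: "'t measure \<Rightarrow> ('t \<Rightarrow> real) \<Rightarrow> ('t \<Rightarrow> complex) set" where
  "L2_real T f = L2_class T (\<lambda>t. complex_of_real (f t))"

definition L2_norm :: "'t measure \<Rightarrow> ('t \<Rightarrow> real) \<Rightarrow> real" where
  "L2_norm T f = sqrt (LINT t|T. (f t)\<^sup>2)"

lemma square_integrable_L2_fun_iff: "square_integrable T f \<longleftrightarrow> (\<lambda>t. complex_of_real (f t)) \<in> L2_fun T"
proof -
  have "f \<in> borel_measurable T \<longleftrightarrow> (\<lambda>t. complex_of_real (f t)) \<in> borel_measurable T"
  proof
    assume "(\<lambda>t. complex_of_real (f t)) \<in> borel_measurable T"
    then have "(\<lambda>t. Re (complex_of_real (f t))) \<in> borel_measurable T" by (rule borel_measurable_Re[THEN measurable_compose[rotated]])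
    then show "f \<in> borel_measurable T" by simp
  qed measurable
  then show ?thesis by (simp add: square_integrable_def L2_fun_def)
qed

lemma L2_real_in_L2: "square_integrable T f \<Longrightarrow> L2_real T f \<in> L2 T"
  by (auto simp: square_integrable_L2_fun_iff L2_real_def L2_def)

lemma L2_dist_real:
  assumes "square_integrable T f" "square_integrable T g"
  shows "L2_dist T (L2_real T f) (L2_real T g) = L2_norm T (\<lambda>t. f t - g t)"
proof -
  have "(cmod (complex_of_real x - complex_of_real y))\<^sup>2 = (x - y)\<^sup>2" for x y
    by (simp flip: of_real_diff)
  then show ?thesis
    using assms by (simp add: square_integrable_L2_fun_iff L2_real_def L2_dist_class L2_norm_def)
qed

lemma square_integrable_zero [simp]: "square_integrable T (\<lambda>_. 0)"
  by (simp add: square_integrable_def)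

lemma square_integrable_add:
  assumes "square_integrable T f" "square_integrable T g"
  shows "square_integrable T (\<lambda>t. f t + g t)"
  using L2_fun_add[of "\<lambda>t. complex_of_real (f t)" T "\<lambda>t. complex_of_real (g t)"] assms
  by (simp add: square_integrable_L2_fun_iff)

lemma square_integrable_cmult:
  "square_integrable T f \<Longrightarrow> square_integrable T (\<lambda>t. c * f t)"
  by (auto simp: square_integrable_def power_mult_distrib)

lemma square_integrable_diff:
  assumes "square_integrable T f" "square_integrable T g"
  shows "square_integrable T (\<lambda>t. f t - g t)"
  using square_integrable_add[OF assms(1) square_integrable_cmult[OF assms(2), of "-1"]] by simp

lemma square_integrable_sum:
  "(\<And>k. k \<in> I \<Longrightarrow> square_integrable T (f k)) \<Longrightarrow> square_integrable T (\<lambda>t. \<Sum>k\<in>I. f k t)"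
  by (induction I rule: infinite_finite_induct) (auto intro: square_integrable_add)

lemma square_integrable_bound:
  assumes "square_integrable T g" "f \<in> borel_measurable T" "AE t in T. \<bar>f t\<bar> \<le> \<bar>g t\<bar>"
  shows "square_integrable T f"
  unfolding square_integrable_def
proof (intro conjI)
  show "integrable T (\<lambda>t. (f t)\<^sup>2)"
  proof (rule Bochner_Integration.integrable_bound)
    show "integrable T (\<lambda>t. (g t)\<^sup>2)" using assms(1) by (simp add: square_integrable_def)
    show "AE t in T. norm ((f t)\<^sup>2) \<le> norm ((g t)\<^sup>2)"
      using assms(3) by eventually_elim (simp add: abs_le_square_iff)
  qed (use assms in auto)
qed fact

lemma L2_norm_nonneg [simp]: "L2_norm T f \<ge> 0"
  by (simp add: L2_norm_def)

lemma L2_norm_cmult: "L2_norm T (\<lambda>t. c * f t) = \<bar>c\<bar> * L2_norm T f"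
  by (simp add: L2_norm_def power_mult_distrib real_sqrt_mult)

lemma L2_norm_triangle:
  assumes "square_integrable T f" "square_integrable T g"
  shows "L2_norm T (\<lambda>t. f t + g t) \<le> L2_norm T f + L2_norm T g"
  using L2_Minkowski[of "\<lambda>t. complex_of_real (f t)" T "\<lambda>t. complex_of_real (g t)"] assms
  by (simp add: square_integrable_L2_fun_iff L2_norm_def flip: of_real_add)

lemma L2_norm_sum_le:
  assumes "\<And>k. k \<in> I \<Longrightarrow> square_integrable T (f k)"
  shows "L2_norm T (\<lambda>t. \<Sum>k\<in>I. f k t) \<le> (\<Sum>k\<in>I. L2_norm T (f k))"
  using assms
proof (induction I rule: infinite_finite_induct)
  case (insert k I)
  have "L2_norm T (\<lambda>t. f k t + (\<Sum>k\<in>I. f k t)) \<le> L2_norm T (f k) + L2_norm T (\<lambda>t. \<Sum>k\<in>I. f k t)"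
    using insert.prems by (intro L2_norm_triangle square_integrable_sum) auto
  then show ?case using insert by (fastforce simp: insert.hyps)
qed (simp_all add: L2_norm_def)

lemma square_integrable_combination:
  assumes "\<And>k. square_integrable T (\<phi> k)"
  shows "square_integrable T (\<lambda>t. \<Sum>k<K::nat. \<phi> k t * x k)"
proof -
  have e: "(\<lambda>t. \<Sum>k<K. \<phi> k t * x k) = (\<lambda>t. \<Sum>k<K. x k * \<phi> k t)"
    by (intro ext sum.cong refl mult.commute)
  show ?thesis
    unfolding e by (intro square_integrable_sum square_integrable_cmult assms)
qed

lemma Lipschitz_of_combination:
  fixes \<phi> :: "nat \<Rightarrow> 't \<Rightarrow> real"
  assumes \<phi>: "\<And>k. square_integrable T (\<phi> k)"
    and F: "\<And>x y. x \<in> L2 T \<Longrightarrow> y \<in> L2 T \<Longrightarrow> \<bar>F x - F y\<bar> \<le> L * L2_dist T x y" and L: "L \<ge> 0"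
  shows "\<bar>F (L2_real T (\<lambda>t. \<Sum>k<K. \<phi> k t * x k)) - F (L2_real T (\<lambda>t. \<Sum>k<K. \<phi> k t * y k))\<bar>
    \<le> L * (\<Sum>k<K. L2_norm T (\<phi> k)) * (\<Sum>k<K. \<bar>x k - y k\<bar>)"
proof -
  have si: "square_integrable T (\<lambda>t. \<Sum>k<K. \<phi> k t * x k)" for x
    by (rule square_integrable_combination[OF \<phi>])
  have "\<bar>F (L2_real T (\<lambda>t. \<Sum>k<K. \<phi> k t * x k)) - F (L2_real T (\<lambda>t. \<Sum>k<K. \<phi> k t * y k))\<bar>
    \<le> L * L2_norm T (\<lambda>t. (\<Sum>k<K. \<phi> k t * x k) - (\<Sum>k<K. \<phi> k t * y k))"
    using F[OF L2_real_in_L2[OF si] L2_real_in_L2[OF si]] by (simp add: L2_dist_real si)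
  also have "(\<lambda>t. (\<Sum>k<K. \<phi> k t * x k) - (\<Sum>k<K. \<phi> k t * y k)) = (\<lambda>t. \<Sum>k<K. (x k - y k) * \<phi> k t)"
    by (simp add: sum_subtractf [symmetric] algebra_simps)
  also have "L2_norm T (\<lambda>t. \<Sum>k<K. (x k - y k) * \<phi> k t) \<le> (\<Sum>k<K. L2_norm T (\<lambda>t. (x k - y k) * \<phi> k t))"
    by (intro L2_norm_sum_le square_integrable_cmult \<phi>)
  also have "\<dots> = (\<Sum>k<K. \<bar>x k - y k\<bar> * L2_norm T (\<phi> k))" by (simp add: L2_norm_cmult)
  also have "\<dots> \<le> (\<Sum>k<K. \<bar>x k - y k\<bar> * (\<Sum>k<K. L2_norm T (\<phi> k)))"
    by (intro sum_mono mult_left_mono member_le_sum) auto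
  also have "\<dots> = (\<Sum>k<K. L2_norm T (\<phi> k)) * (\<Sum>k<K. \<bar>x k - y k\<bar>)"
    by (simp add: sum_distrib_right [symmetric] mult.commute)
  finally show ?thesis using L by (simp add: mult_left_mono mult.assoc)
qed

section \<open>Measurability of maps into \<open>L\<^sup>2\<close>\<close>

lemma L2_norm_tendsto_zero:
  assumes f: "\<And>m. f m \<in> borel_measurable T" "g \<in> borel_measurable T"
    and b: "square_integrable T b"
    and le: "\<And>m. AE t in T. \<bar>f m t\<bar> \<le> b t" "AE t in T. \<bar>g t\<bar> \<le> b t"
    and lim: "AE t in T. (\<lambda>m. f m t) \<longlonglongrightarrow> g t"
  shows "(\<lambda>m. L2_norm T (\<lambda>t. f m t - g t)) \<longlonglongrightarrow> 0"
proof -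
  have "(\<lambda>m. LINT t|T. (f m t - g t)\<^sup>2) \<longlonglongrightarrow> (LINT t|T. 0)"
  proof (rule integral_dominated_convergence[where w = "\<lambda>t. 4 * (b t)\<^sup>2"])
    show "integrable T (\<lambda>t. 4 * (b t)\<^sup>2)" using b by (simp add: square_integrable_def)
    show "AE t in T. (\<lambda>m. (f m t - g t)\<^sup>2) \<longlonglongrightarrow> 0"
      using lim
    proof eventually_elim
      case (elim t)
      have "(\<lambda>m. (f m t - g t)\<^sup>2) \<longlonglongrightarrow> (g t - g t)\<^sup>2" by (intro tendsto_intros elim)
      then show ?case by simp
    qed
    show "AE t in T. norm ((f m t - g t)\<^sup>2) \<le> 4 * (b t)\<^sup>2" for m
      using le(1)[of m] le(2)
    proof eventually_elim
      case (elim t)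
      then have "\<bar>f m t - g t\<bar> \<le> \<bar>2 * b t\<bar>" by linarith
      then show ?case using abs_le_square_iff[of "f m t - g t" "2 * b t"] by (simp add: power_mult_distrib)
    qed
  qed (use f in auto)
  then show ?thesis unfolding L2_norm_def using tendsto_real_sqrt by fastforce
qed

text \<open>
  On each closed set \<open>A i\<close> dominated convergence makes the map continuous into \<open>L\<^sup>2\<close>, so
  preimages of open sets are relatively open there, and countably many pieces together with
  the constant rest cover the domain.
\<close>

lemma measurable_L2_real_of_continuous:
  fixes \<Psi> :: "(nat \<Rightarrow> real) \<Rightarrow> 't \<Rightarrow> real" and A :: "nat \<Rightarrow> (nat \<Rightarrow> real) set"
  assumes A: "\<And>i. closed (A i)"
    and meas: "\<And>x. \<Psi> x \<in> borel_measurable T"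
    and cont: "\<And>i t. continuous_on (A i) (\<lambda>x. \<Psi> x t)"
    and bound: "\<And>i x. x \<in> A i \<Longrightarrow> AE t in T. \<bar>\<Psi> x t\<bar> \<le> b i t"
    and b: "\<And>i. square_integrable T (b i)"
    and out: "\<And>x. x \<notin> (\<Union>i. A i) \<Longrightarrow> \<Psi> x = (\<lambda>_. 0)"
  shows "square_integrable T (\<Psi> x)"
    and "(\<lambda>x. L2_real T (\<Psi> x)) \<in> borel \<rightarrow>\<^sub>M borel_of_topology (L2_topology T)"
proof -
  interpret Metric_space "L2 T" "L2_dist T" by (rule Metric_space_L2)
  show si: "square_integrable T (\<Psi> x)" for x
  proof (cases "x \<in> (\<Union>i. A i)")
    case True
    then obtain i where "x \<in> A i" by blast
    then have "AE t in T. \<bar>\<Psi> x t\<bar> \<le> \<bar>b i t\<bar>" using bound[of x i] by (auto elim!: eventually_mono)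
    then show ?thesis by (rule square_integrable_bound[OF b meas])
  next
    case False
    then show ?thesis using out by simp
  qed
  have closed': "closed {x \<in> A i. L2_real T (\<Psi> x) \<notin> U}" if U: "openin mtopology U" for i U
    unfolding closed_sequential_limits
  proof (intro allI impI, elim conjE)
    fix xs :: "nat \<Rightarrow> nat \<Rightarrow> real" and x
    assume xs: "\<forall>n. xs n \<in> {x \<in> A i. L2_real T (\<Psi> x) \<notin> U}" and lim: "xs \<longlonglongrightarrow> x"
    have xA: "x \<in> A i" using A[of i] xs lim unfolding closed_sequential_limits by blast
    have "(\<lambda>m. \<Psi> (xs m) t) \<longlonglongrightarrow> \<Psi> x t" for t
      by (rule continuous_on_tendsto_compose[OF cont[of i t] lim xA]) (use xs in auto)
    then have "(\<lambda>m. L2_norm T (\<lambda>t. \<Psi> (xs m) t - \<Psi> x t)) \<longlonglongrightarrow> 0"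
      using xs xA by (intro L2_norm_tendsto_zero[OF meas meas b[of i]] bound) auto
    then have d: "(\<lambda>m. L2_dist T (L2_real T (\<Psi> x)) (L2_real T (\<Psi> (xs m)))) \<longlonglongrightarrow> 0"
      by (subst commute) (simp add: L2_dist_real si)
    have "L2_real T (\<Psi> x) \<notin> U"
    proof
      assume "L2_real T (\<Psi> x) \<in> U"
      then obtain r where r: "r > 0" "mball (L2_real T (\<Psi> x)) r \<subseteq> U"
        using U unfolding openin_mtopology by blast
      have "eventually (\<lambda>m. L2_dist T (L2_real T (\<Psi> x)) (L2_real T (\<Psi> (xs m))) < r) sequentially"
        using order_tendstoD(2)[OF d r(1)] .
      then obtain m where "L2_dist T (L2_real T (\<Psi> x)) (L2_real T (\<Psi> (xs m))) < r"
        using eventually_happens'[OF sequentially_bot] by blast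
      then have "L2_real T (\<Psi> (xs m)) \<in> U"
        using r(2) by (auto simp: L2_real_in_L2[OF si] subset_iff)
      then show False using xs by blast
    qed
    then show "x \<in> {x \<in> A i. L2_real T (\<Psi> x) \<notin> U}" using xA by simp
  qed
  show "(\<lambda>x. L2_real T (\<Psi> x)) \<in> borel \<rightarrow>\<^sub>M borel_of_topology (L2_topology T)"
    unfolding borel_of_topology_def L2_topology_def
  proof (rule measurable_measure_of)
    show "{U. openin mtopology U} \<subseteq> Pow (topspace mtopology)" using openin_subset by blast
    show "(\<lambda>x. L2_real T (\<Psi> x)) \<in> space borel \<rightarrow> topspace mtopology"
      by (auto intro: L2_real_in_L2 si)
    fix U assume "U \<in> {U. openin mtopology U}"
    then have U: "openin mtopology U" by simp
    have e: "(\<lambda>x. L2_real T (\<Psi> x)) -` U \<inter> space borel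
      = (\<Union>i. A i - {x \<in> A i. L2_real T (\<Psi> x) \<notin> U}) \<union> (if L2_real T (\<lambda>_. 0) \<in> U then - (\<Union>i. A i) else {})"
    proof (intro set_eqI)
      fix x
      show "x \<in> (\<lambda>x. L2_real T (\<Psi> x)) -` U \<inter> space borel \<longleftrightarrow>
        x \<in> (\<Union>i. A i - {x \<in> A i. L2_real T (\<Psi> x) \<notin> U}) \<union> (if L2_real T (\<lambda>_. 0) \<in> U then - (\<Union>i. A i) else {})"
        using out[of x] by (cases "x \<in> (\<Union>i. A i)") auto
    qed
    have "(if L2_real T (\<lambda>_. 0) \<in> U then - (\<Union>i. A i) else {}) \<in> sets borel"
      using A by (auto intro!: borel_comp sets.countable_UN borel_closed)
    moreover have "(\<Union>i. A i - {x \<in> A i. L2_real T (\<Psi> x) \<notin> U}) \<in> sets borel"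
      by (intro sets.countable_UN image_subsetI sets.Diff borel_closed A closed'[OF U])
    ultimately show "(\<lambda>x. L2_real T (\<Psi> x)) -` U \<inter> space borel \<in> sets borel"
      unfolding e by (rule sets.Un[rotated])
  qed
qed

section \<open>A limit criterion for random series in \<open>L\<^sup>2\<close>\<close>

text \<open>
  On \<open>G\<close> the Lipschitz bound \<open>L \<surd>D\<close> is replaced by \<open>L (\<eta> + D / \<eta>)\<close>, which is linear in the
  squared distance \<open>D\<close> and so can be integrated. Off \<open>G\<close> the trivial bound \<open>2 B\<close> is used.
\<close>

lemma expectation_Lipschitz_close:
  fixes V U :: "'a \<Rightarrow> 't \<Rightarrow> real"
  assumes P: "prob_space P" and T: "sigma_finite_measure T"
    and V: "\<And>\<omega>. \<omega> \<in> space P \<Longrightarrow> square_integrable T (V \<omega>)" and U: "\<And>\<omega>. \<omega> \<in> space P \<Longrightarrow> square_integrable T (U \<omega>)"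
    and VU [measurable]: "(\<lambda>(\<omega>, t). V \<omega> t) \<in> borel_measurable (P \<Otimes>\<^sub>M T)" "(\<lambda>(\<omega>, t). U \<omega> t) \<in> borel_measurable (P \<Otimes>\<^sub>M T)"
    and F: "\<And>x y. x \<in> L2 T \<Longrightarrow> y \<in> L2 T \<Longrightarrow> \<bar>F x - F y\<bar> \<le> L * L2_dist T x y" and L: "L \<ge> 0"
    and B: "\<And>x. x \<in> L2 T \<Longrightarrow> \<bar>F x\<bar> \<le> B"
    and Fm [measurable]: "(\<lambda>\<omega>. F (L2_real T (V \<omega>))) \<in> borel_measurable P" "(\<lambda>\<omega>. F (L2_real T (U \<omega>))) \<in> borel_measurable P"
    and G [measurable]: "G \<in> sets P" and \<eta>: "\<eta> > 0" and e: "e \<ge> 0"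
    and nn: "(\<integral>\<^sup>+\<omega>. indicator G \<omega> * (\<integral>\<^sup>+t. ennreal ((V \<omega> t - U \<omega> t)\<^sup>2) \<partial>T) \<partial>P) \<le> ennreal e"
  shows "\<bar>(LINT \<omega>|P. F (L2_real T (V \<omega>))) - (LINT \<omega>|P. F (L2_real T (U \<omega>)))\<bar>
    \<le> 2 * B * (1 - measure P G) + L * (\<eta> + e / \<eta>)"
proof -
  interpret P: prob_space P by fact
  interpret T: sigma_finite_measure T by fact
  define D where "D \<omega> = (LINT t|T. (V \<omega> t - U \<omega> t)\<^sup>2)" for \<omega>
  have [measurable]: "D \<in> borel_measurable P"
    unfolding D_def by measurable
  have D0: "D \<omega> \<ge> 0" for \<omega> by (simp add: D_def)
  have Dnn: "(\<integral>\<^sup>+t. ennreal ((V \<omega> t - U \<omega> t)\<^sup>2) \<partial>T) = ennreal (D \<omega>)" if "\<omega> \<in> space P" for \<omega>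
    using square_integrable_diff[OF V[OF that] U[OF that]]
    unfolding D_def by (intro nn_integral_eq_integral) (auto simp: square_integrable_def)
  have nn': "(\<integral>\<^sup>+\<omega>. ennreal (indicator G \<omega> * D \<omega>) \<partial>P) \<le> ennreal e"
  proof -
    have "(\<integral>\<^sup>+\<omega>. ennreal (indicator G \<omega> * D \<omega>) \<partial>P)
      = (\<integral>\<^sup>+\<omega>. indicator G \<omega> * (\<integral>\<^sup>+t. ennreal ((V \<omega> t - U \<omega> t)\<^sup>2) \<partial>T) \<partial>P)"
      by (intro nn_integral_cong) (auto simp: Dnn indicator_def)
    then show ?thesis using nn by simp
  qed
  have iD: "integrable P (\<lambda>\<omega>. indicator G \<omega> * D \<omega>)"
    using nn' D0 by (intro integrableI_nonneg) (auto intro: le_less_trans)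
  have ED: "(LINT \<omega>|P. indicator G \<omega> * D \<omega>) \<le> e"
    using nn' D0 e by (subst (asm) nn_integral_eq_integral[OF iD]) auto
  have iG: "integrable P (indicator G :: 'a \<Rightarrow> real)" by (simp add: P.emeasure_eq_measure)
  have BM: "B \<ge> 0" 
  proof -
    obtain \<omega> where "\<omega> \<in> space P" using P.not_empty by blast
    then show ?thesis using B[OF L2_real_in_L2[OF V]] by force
  qed
  have i: "integrable P (\<lambda>\<omega>. F (L2_real T (V \<omega>)))" "integrable P (\<lambda>\<omega>. F (L2_real T (U \<omega>)))"
    by (auto intro!: P.integrable_const_bound[where B = B] AE_I2 B L2_real_in_L2 V U)
  have pt: "\<bar>F (L2_real T (V \<omega>)) - F (L2_real T (U \<omega>))\<bar> \<le> 2 * B * (1 - indicator G \<omega>) + L * (\<eta> + indicator G \<omega> * D \<omega> / \<eta>)"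
    if \<omega>: "\<omega> \<in> space P" for \<omega>
  proof (cases "\<omega> \<in> G")
    case True
    have "\<bar>F (L2_real T (V \<omega>)) - F (L2_real T (U \<omega>))\<bar> \<le> L * sqrt (D \<omega>)"
      using F[OF L2_real_in_L2[OF V[OF \<omega>]] L2_real_in_L2[OF U[OF \<omega>]]]
      by (simp add: L2_dist_real V U \<omega> L2_norm_def D_def)
    also have "sqrt (D \<omega>) \<le> \<eta> + D \<omega> / \<eta>"
    proof -
      have "0 \<le> (sqrt (D \<omega>) - \<eta>)\<^sup>2" by simp
      also have "\<dots> = D \<omega> + \<eta>\<^sup>2 - 2 * sqrt (D \<omega>) * \<eta>" using D0 by (simp add: power2_diff)
      finally have "sqrt (D \<omega>) * \<eta> \<le> D \<omega> + \<eta>\<^sup>2" using mult_nonneg_nonneg[OF real_sqrt_ge_zero[OF D0[of \<omega>]] less_imp_le[OF \<eta>]] by linarith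
      then show ?thesis using \<eta> by (simp add: field_simps power2_eq_square)
    qed
    finally show ?thesis using True L by (simp add: mult_left_mono)
  next
    case False
    have "\<bar>F (L2_real T (V \<omega>)) - F (L2_real T (U \<omega>))\<bar> \<le> 2 * B"
      using B[OF L2_real_in_L2[OF V[OF \<omega>]]] B[OF L2_real_in_L2[OF U[OF \<omega>]]] by linarith
    moreover have "L * \<eta> \<ge> 0" using L \<eta> by simp
    ultimately show ?thesis using False by simp
  qed
  have "\<bar>(LINT \<omega>|P. F (L2_real T (V \<omega>))) - (LINT \<omega>|P. F (L2_real T (U \<omega>)))\<bar>
    = \<bar>LINT \<omega>|P. F (L2_real T (V \<omega>)) - F (L2_real T (U \<omega>))\<bar>" using i by simp
  also have "\<dots> \<le> (LINT \<omega>|P. \<bar>F (L2_real T (V \<omega>)) - F (L2_real T (U \<omega>))\<bar>)" by (rule integral_abs_bound)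
  also have "\<dots> \<le> (LINT \<omega>|P. 2 * B * (1 - indicator G \<omega>) + L * (\<eta> + indicator G \<omega> * D \<omega> / \<eta>))"
  proof (intro integral_mono pt)
    show "integrable P (\<lambda>\<omega>. 2 * B * (1 - indicator G \<omega>) + L * (\<eta> + indicator G \<omega> * D \<omega> / \<eta>))"
      using iD iG by (intro Bochner_Integration.integrable_add integrable_mult_right Bochner_Integration.integrable_diff integrable_divide) auto
  qed (use i in auto)
  also have "\<dots> = 2 * B * (1 - measure P G) + L * (\<eta> + (LINT \<omega>|P. indicator G \<omega> * D \<omega>) / \<eta>)"
    using iD iG by (simp add: P.prob_space)
  also have "\<dots> \<le> 2 * B * (1 - measure P G) + L * (\<eta> + e / \<eta>)"
    using ED L \<eta> by (intro add_left_mono mult_left_mono divide_right_mono) auto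
  finally show ?thesis .
qed

text \<open>
  Truncation at \<open>K\<close> replaces a Lipschitz function of the process by a Lipschitz function of
  finitely many random coefficients, to which \<open>Lipschitz_expectation_limit\<close> applies. The
  index \<open>K\<close> is fixed before \<open>n\<close> tends to infinity. For the processes \<open>V n\<close> the mean square
  error of the truncation is controlled on the events \<open>G n\<close> only, whose probability tends to
  1.
\<close>

theorem L2_random_series_limit:
  fixes V :: "nat \<Rightarrow> 'a \<Rightarrow> 't \<Rightarrow> real" and W :: "'b \<Rightarrow> 't \<Rightarrow> real"
    and S :: "nat \<Rightarrow> 'a \<Rightarrow> nat \<Rightarrow> real" and \<xi> :: "'b \<Rightarrow> nat \<Rightarrow> real"
  assumes P: "prob_space P" and Q: "prob_space Q" and T: "sigma_finite_measure T"
    and \<phi>: "\<And>k. square_integrable T (\<phi> k)"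
    and S: "\<And>n k. (\<lambda>\<omega>. S n \<omega> k) \<in> borel_measurable P"
    and S2: "\<And>n k. integrable P (\<lambda>\<omega>. (S n \<omega> k)\<^sup>2)" "\<And>n k. (LINT \<omega>|P. (S n \<omega> k)\<^sup>2) \<le> 1"
    and X: "\<And>k. (\<lambda>\<omega>. \<xi> \<omega> k) \<in> borel_measurable Q"
    and X2: "\<And>k. integrable Q (\<lambda>\<omega>. (\<xi> \<omega> k)\<^sup>2)" "\<And>k. (LINT \<omega>|Q. (\<xi> \<omega> k)\<^sup>2) \<le> 1"
    and cf: "\<And>m u c. (\<lambda>n. LINT \<omega>|P. cos ((\<Sum>k<m. u k * S n \<omega> k) + c)) \<longlonglongrightarrow> (LINT \<omega>|Q. cos ((\<Sum>k<m. u k * \<xi> \<omega> k) + c))"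
    and V: "\<And>n \<omega>. \<omega> \<in> space P \<Longrightarrow> square_integrable T (V n \<omega>)"
    and W: "\<And>\<omega>. \<omega> \<in> space Q \<Longrightarrow> square_integrable T (W \<omega>)"
    and Vm: "\<And>n. (\<lambda>(\<omega>, t). V n \<omega> t) \<in> borel_measurable (P \<Otimes>\<^sub>M T)"
    and Wm: "(\<lambda>(\<omega>, t). W \<omega> t) \<in> borel_measurable (Q \<Otimes>\<^sub>M T)"
    and VL: "\<And>n. (\<lambda>\<omega>. L2_real T (V n \<omega>)) \<in> P \<rightarrow>\<^sub>M borel_of_topology (L2_topology T)"
    and WL: "(\<lambda>\<omega>. L2_real T (W \<omega>)) \<in> Q \<rightarrow>\<^sub>M borel_of_topology (L2_topology T)"
    and G: "\<And>n. G n \<in> sets P" "(\<lambda>n. measure P (G n)) \<longlonglongrightarrow> 1"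
    and approx: "\<And>e. e > 0 \<Longrightarrow> \<exists>K.
      eventually (\<lambda>n. (\<integral>\<^sup>+\<omega>. indicator (G n) \<omega> * (\<integral>\<^sup>+t. ennreal ((V n \<omega> t - (\<Sum>k<K. \<phi> k t * S n \<omega> k))\<^sup>2) \<partial>T) \<partial>P) \<le> ennreal e) sequentially \<and>
      (\<integral>\<^sup>+\<omega>. (\<integral>\<^sup>+t. ennreal ((W \<omega> t - (\<Sum>k<K. \<phi> k t * \<xi> \<omega> k))\<^sup>2) \<partial>T) \<partial>Q) \<le> ennreal e"
  shows "converges_in_distribution (L2_topology T) P (\<lambda>n \<omega>. L2_real T (V n \<omega>)) Q (\<lambda>\<omega>. L2_real T (W \<omega>))"
proof -
  interpret Metric_space "L2 T" "L2_dist T" by (rule Metric_space_L2)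
  interpret P: prob_space P by fact
  interpret Q: prob_space Q by fact
  have [measurable]: "\<phi> k \<in> borel_measurable T" for k using \<phi> by (simp add: square_integrable_def)
  note [measurable] = S X
  show ?thesis
    unfolding L2_topology_def
  proof (rule converges_in_distribution_LipschitzI[OF P Q VL[unfolded L2_topology_def] WL[unfolded L2_topology_def]])
    fix F :: "('t \<Rightarrow> complex) set \<Rightarrow> real" and L B :: real
    assume F: "\<And>x y. x \<in> L2 T \<Longrightarrow> y \<in> L2 T \<Longrightarrow> \<bar>F x - F y\<bar> \<le> L * L2_dist T x y"
      and B: "\<And>x. x \<in> L2 T \<Longrightarrow> \<bar>F x\<bar> \<le> B" and L: "L \<ge> 0"
    note Fc = continuous_map_mtopology_Lipschitz[OF F]
    have FV: "(\<lambda>\<omega>. F (L2_real T (V n \<omega>))) \<in> borel_measurable P" for n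
      by (rule measurable_continuous_map_borel_of_topology[OF VL[unfolded L2_topology_def] Fc])
    have FW: "(\<lambda>\<omega>. F (L2_real T (W \<omega>))) \<in> borel_measurable Q"
      by (rule measurable_continuous_map_borel_of_topology[OF WL[unfolded L2_topology_def] Fc])
    define f where "f K x = F (L2_real T (\<lambda>t. \<Sum>k<K. \<phi> k t * x k))" for K and x :: "nat \<Rightarrow> real"
    define C where "C K = L * (\<Sum>k<K. L2_norm T (\<phi> k))" for K :: nat
    have f: "\<bar>f K x - f K y\<bar> \<le> C K * (\<Sum>k<K. \<bar>x k - y k\<bar>)" for K x y
      unfolding f_def C_def by (rule Lipschitz_of_combination[OF \<phi> F L])
    have C: "C K \<ge> 0" for K unfolding C_def using L by (intro mult_nonneg_nonneg sum_nonneg) auto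
    have fB: "\<bar>f K x\<bar> \<le> B" for K x
      unfolding f_def by (intro B L2_real_in_L2 square_integrable_combination \<phi>)
    have [measurable]: "f K \<in> borel_measurable borel" for K
      using Lipschitz_coordinates_continuous[OF f] by (rule borel_measurable_continuous_onI)
    have [measurable]: "S n \<in> borel_measurable P" for n using S by (rule measurable_coordinatewise_borel)
    have [measurable]: "\<xi> \<in> borel_measurable Q" using X by (rule measurable_coordinatewise_borel)
    show "(\<lambda>n. LINT \<omega>|P. F (L2_real T (V n \<omega>))) \<longlonglongrightarrow> (LINT \<omega>|Q. F (L2_real T (W \<omega>)))"
    proof (rule LIMSEQ_I)
      fix e :: real assume e: "e > 0"
      \<comment> \<open>With the truncation error \<open>\<eta>\<^sup>2\<close> the bound \<open>L (\<eta> + \<eta>\<^sup>2 / \<eta>)\<close> of the preceding lemma is at most \<open>e / 4\<close>.\<close>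
      define \<eta> where "\<eta> = e / (8 * (L + 1))"
      have \<eta>: "\<eta> > 0" using e L by (simp add: \<eta>_def)
      have L\<eta>: "L * (\<eta> + \<eta>\<^sup>2 / \<eta>) \<le> e / 4"
      proof -
        have l: "L + 1 \<noteq> 0" using L by simp
        have "L * \<eta> \<le> (L + 1) * \<eta>" using \<eta> by (intro mult_right_mono) auto
        also have "\<dots> = e / 8" unfolding \<eta>_def using l by (metis nonzero_mult_divide_mult_cancel_left2 times_divide_eq_right)
        finally show ?thesis using \<eta> by (simp add: power2_eq_square distrib_left)
      qed
      obtain K where K:
        "eventually (\<lambda>n. (\<integral>\<^sup>+\<omega>. indicator (G n) \<omega> * (\<integral>\<^sup>+t. ennreal ((V n \<omega> t - (\<Sum>k<K. \<phi> k t * S n \<omega> k))\<^sup>2) \<partial>T) \<partial>P) \<le> ennreal (\<eta>\<^sup>2)) sequentially"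
        "(\<integral>\<^sup>+\<omega>. (\<integral>\<^sup>+t. ennreal ((W \<omega> t - (\<Sum>k<K. \<phi> k t * \<xi> \<omega> k))\<^sup>2) \<partial>T) \<partial>Q) \<le> ennreal (\<eta>\<^sup>2)"
        using approx[of "\<eta>\<^sup>2"] \<eta> by auto
      have cW: "\<bar>(LINT \<omega>|Q. F (L2_real T (W \<omega>))) - (LINT \<omega>|Q. F (L2_real T (\<lambda>t. \<Sum>k<K. \<phi> k t * \<xi> \<omega> k)))\<bar>
        \<le> 2 * B * (1 - measure Q (space Q)) + L * (\<eta> + \<eta>\<^sup>2 / \<eta>)"
      proof (rule expectation_Lipschitz_close[OF Q T W _ Wm _ F L B FW _ _ \<eta>])
        show "square_integrable T (\<lambda>t. \<Sum>k<K. \<phi> k t * \<xi> \<omega> k)" for \<omega>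
          by (rule square_integrable_combination[OF \<phi>])
        show "(\<lambda>\<omega>. F (L2_real T (\<lambda>t. \<Sum>k<K. \<phi> k t * \<xi> \<omega> k))) \<in> borel_measurable Q"
          unfolding f_def[symmetric] by measurable
        have "(\<integral>\<^sup>+\<omega>. indicator (space Q) \<omega> * (\<integral>\<^sup>+t. ennreal ((W \<omega> t - (\<Sum>k<K. \<phi> k t * \<xi> \<omega> k))\<^sup>2) \<partial>T) \<partial>Q)
          = (\<integral>\<^sup>+\<omega>. (\<integral>\<^sup>+t. ennreal ((W \<omega> t - (\<Sum>k<K. \<phi> k t * \<xi> \<omega> k))\<^sup>2) \<partial>T) \<partial>Q)"
          by (intro nn_integral_cong) auto
        then show "(\<integral>\<^sup>+\<omega>. indicator (space Q) \<omega> * (\<integral>\<^sup>+t. ennreal ((W \<omega> t - (\<Sum>k<K. \<phi> k t * \<xi> \<omega> k))\<^sup>2) \<partial>T) \<partial>Q) \<le> ennreal (\<eta>\<^sup>2)"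
          using K(2) by simp
      qed auto
      have cW': "\<bar>(LINT \<omega>|Q. F (L2_real T (W \<omega>))) - (LINT \<omega>|Q. F (L2_real T (\<lambda>t. \<Sum>k<K. \<phi> k t * \<xi> \<omega> k)))\<bar> \<le> e / 4"
      proof -
        have "2 * B * (1 - measure Q (space Q)) = 0" by (simp add: Q.prob_space)
        then show ?thesis using cW L\<eta> by linarith
      qed
      have cV: "\<bar>(LINT \<omega>|P. F (L2_real T (V n \<omega>))) - (LINT \<omega>|P. F (L2_real T (\<lambda>t. \<Sum>k<K. \<phi> k t * S n \<omega> k)))\<bar>
        \<le> 2 * B * (1 - measure P (G n)) + L * (\<eta> + \<eta>\<^sup>2 / \<eta>)"
        if n: "(\<integral>\<^sup>+\<omega>. indicator (G n) \<omega> * (\<integral>\<^sup>+t. ennreal ((V n \<omega> t - (\<Sum>k<K. \<phi> k t * S n \<omega> k))\<^sup>2) \<partial>T) \<partial>P) \<le> ennreal (\<eta>\<^sup>2)" for n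
      proof (rule expectation_Lipschitz_close[OF P T V _ Vm _ F L B FV _ G(1) \<eta> _ n])
        show "square_integrable T (\<lambda>t. \<Sum>k<K. \<phi> k t * S n \<omega> k)" for \<omega>
          by (rule square_integrable_combination[OF \<phi>])
        show "(\<lambda>\<omega>. F (L2_real T (\<lambda>t. \<Sum>k<K. \<phi> k t * S n \<omega> k))) \<in> borel_measurable P"
          unfolding f_def[symmetric] by measurable
      qed auto
      have "(\<lambda>n. LINT \<omega>|P. f K (S n \<omega>)) \<longlonglongrightarrow> (LINT \<omega>|Q. f K (\<xi> \<omega>))"
        by (rule Lipschitz_expectation_limit[OF P Q S S2 X X2 cf f C fB])
      then have "eventually (\<lambda>n. \<bar>(LINT \<omega>|P. f K (S n \<omega>)) - (LINT \<omega>|Q. f K (\<xi> \<omega>))\<bar> < e / 4) sequentially"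
        using tendstoD[of _ _ _ "e / 4"] e by (fastforce simp: dist_real_def)
      moreover have "(\<lambda>n. 2 * B * (1 - measure P (G n))) \<longlonglongrightarrow> 2 * B * (1 - 1)"
        by (intro tendsto_intros G)
      then have "eventually (\<lambda>n. 2 * B * (1 - measure P (G n)) < e / 4) sequentially"
        using e by (intro order_tendstoD(2)) auto
      ultimately have "eventually (\<lambda>n. norm ((LINT \<omega>|P. F (L2_real T (V n \<omega>))) - (LINT \<omega>|Q. F (L2_real T (W \<omega>)))) < e) sequentially"
        using K(1)
      proof eventually_elim
        case (elim n)
        show ?case
          using cW' cV[OF elim(3)] elim(1,2) L\<eta> unfolding f_def real_norm_def by linarith
      qed
      then show "\<exists>no. \<forall>n\<ge>no. norm ((LINT \<omega>|P. F (L2_real T (V n \<omega>))) - (LINT \<omega>|Q. F (L2_real T (W \<omega>)))) < e"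
        by (simp add: eventually_sequentially)
    qed
  qed
qed

lemma weak_conv_L2_norm_square:
  assumes P: "prob_space P" and Q: "prob_space Q"
    and V: "\<And>n \<omega>. \<omega> \<in> space P \<Longrightarrow> square_integrable T (V n \<omega>)"
    and W: "\<And>\<omega>. \<omega> \<in> space Q \<Longrightarrow> square_integrable T (W \<omega>)"
    and conv: "converges_in_distribution (L2_topology T) P (\<lambda>n \<omega>. L2_real T (V n \<omega>)) Q (\<lambda>\<omega>. L2_real T (W \<omega>))"
  shows "weak_conv_m (\<lambda>n. distr P borel (\<lambda>\<omega>. LINT t|T. (V n \<omega> t)\<^sup>2)) (distr Q borel (\<lambda>\<omega>. LINT t|T. (W \<omega> t)\<^sup>2))"
proof -
  interpret Metric_space "L2 T" "L2_dist T" by (rule Metric_space_L2)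
  interpret P: prob_space P by fact
  interpret Q: prob_space Q by fact
  define g where "g x = (L2_dist T x (L2_real T (\<lambda>_. 0)))\<^sup>2" for x
  have "continuous_map mtopology euclideanreal (\<lambda>x. L2_dist T x (L2_real T (\<lambda>_. 0)))"
  proof (rule continuous_map_mtopology_Lipschitz[where L = 1])
    fix x y assume "x \<in> L2 T" "y \<in> L2 T"
    then show "\<bar>L2_dist T x (L2_real T (\<lambda>_. 0)) - L2_dist T y (L2_real T (\<lambda>_. 0))\<bar> \<le> 1 * L2_dist T x y"
      using triangle[of x y "L2_real T (\<lambda>_. 0)"] triangle[of y x "L2_real T (\<lambda>_. 0)"] commute[of x y]
        L2_real_in_L2[of T "\<lambda>_. 0"] by auto
  qed
  then have g: "continuous_map (L2_topology T) euclideanreal g"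
    unfolding g_def L2_topology_def by (intro continuous_map_real_pow)
  have gi: "g (L2_real T f) = (LINT t|T. (f t)\<^sup>2)" if "square_integrable T f" for f
    using that by (simp add: g_def L2_dist_real L2_norm_def)
  have VL: "(\<lambda>\<omega>. L2_real T (V n \<omega>)) \<in> P \<rightarrow>\<^sub>M borel_of_topology (L2_topology T)"
    and WL: "(\<lambda>\<omega>. L2_real T (W \<omega>)) \<in> Q \<rightarrow>\<^sub>M borel_of_topology (L2_topology T)" for n
    using conv by (auto simp: converges_in_distribution_def)
  have mV [measurable]: "(\<lambda>\<omega>. LINT t|T. (V n \<omega> t)\<^sup>2) \<in> borel_measurable P" for n
    using measurable_continuous_map_borel_of_topology[OF VL g, of n]
    by (rule measurable_cong[THEN iffD1, rotated]) (simp add: gi V)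
  have mW [measurable]: "(\<lambda>\<omega>. LINT t|T. (W \<omega> t)\<^sup>2) \<in> borel_measurable Q"
    using measurable_continuous_map_borel_of_topology[OF WL g]
    by (rule measurable_cong[THEN iffD1, rotated]) (simp add: gi W)
  show ?thesis
  proof (rule integral_bdd_continuous_conv_imp_weak_conv)
    show "real_distribution (distr P borel (\<lambda>\<omega>. LINT t|T. (V n \<omega> t)\<^sup>2))" for n
      by (rule P.real_distribution_distr) measurable
    show "real_distribution (distr Q borel (\<lambda>\<omega>. LINT t|T. (W \<omega> t)\<^sup>2))"
      by (rule Q.real_distribution_distr) measurable
    fix h :: "real \<Rightarrow> real" assume h: "\<And>x. isCont h x" "\<And>x. \<bar>h x\<bar> \<le> 1"
    have hc: "continuous_on UNIV h" using h(1) by (simp add: continuous_at_imp_continuous_on)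
    then have [measurable]: "h \<in> borel_measurable borel" by (rule borel_measurable_continuous_onI)
    have "continuous_map (L2_topology T) euclideanreal (\<lambda>x. h (g x))"
      using continuous_map_compose[OF g, of euclideanreal h] hc by (simp add: o_def)
    moreover have "bounded ((\<lambda>x. h (g x)) ` topspace (L2_topology T))"
      using h(2) by (auto simp: bounded_iff)
    ultimately have "(\<lambda>n. LINT \<omega>|P. h (g (L2_real T (V n \<omega>)))) \<longlonglongrightarrow> (LINT \<omega>|Q. h (g (L2_real T (W \<omega>))))"
      using conv by (auto simp: converges_in_distribution_def)
    also have "(LINT \<omega>|Q. h (g (L2_real T (W \<omega>)))) = (LINT \<omega>|Q. h (LINT t|T. (W \<omega> t)\<^sup>2))"
      by (intro Bochner_Integration.integral_cong) (simp_all add: gi W)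
    also have "(\<lambda>n. LINT \<omega>|P. h (g (L2_real T (V n \<omega>)))) = (\<lambda>n. LINT \<omega>|P. h (LINT t|T. (V n \<omega> t)\<^sup>2))"
      by (intro ext Bochner_Integration.integral_cong) (simp_all add: gi V)
    finally show "(\<lambda>n. integral\<^sup>L (distr P borel (\<lambda>\<omega>. LINT t|T. (V n \<omega> t)\<^sup>2)) h)
       \<longlonglongrightarrow> integral\<^sup>L (distr Q borel (\<lambda>\<omega>. LINT t|T. (W \<omega> t)\<^sup>2)) h"
      by (simp add: integral_distr)
  qed
qed

section \<open>Orthonormal random series\<close>

lemma (in prob_space) indep_vars_product_of_functions:
  fixes X :: "'i \<Rightarrow> 'a \<Rightarrow> real" and f g :: "real \<Rightarrow> real"
  assumes X: "indep_vars (\<lambda>_. borel) X I" and ij: "i \<in> I" "j \<in> I" "i \<noteq> j"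
    and [measurable]: "f \<in> borel_measurable borel" "g \<in> borel_measurable borel"
    and int: "integrable M (\<lambda>\<omega>. f (X i \<omega>))" "integrable M (\<lambda>\<omega>. g (X j \<omega>))"
  shows "integrable M (\<lambda>\<omega>. f (X i \<omega>) * g (X j \<omega>))"
    and "expectation (\<lambda>\<omega>. f (X i \<omega>) * g (X j \<omega>)) = expectation (\<lambda>\<omega>. f (X i \<omega>)) * expectation (\<lambda>\<omega>. g (X j \<omega>))"
proof -
  define Y where "Y k = (if k = i then f else g)" for k
  have "indep_vars (\<lambda>_. borel) (\<lambda>k \<omega>. Y k (X k \<omega>)) {i, j}"
    using ij by (intro indep_vars_compose2[OF indep_vars_subset[OF X]]) (auto simp: Y_def)
  moreover have "integrable M (\<lambda>\<omega>. Y k (X k \<omega>))" if "k \<in> {i, j}" for k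
    using that int ij by (auto simp: Y_def)
  ultimately have "integrable M (\<lambda>\<omega>. \<Prod>k\<in>{i, j}. Y k (X k \<omega>))"
    "expectation (\<lambda>\<omega>. \<Prod>k\<in>{i, j}. Y k (X k \<omega>)) = (\<Prod>k\<in>{i, j}. expectation (\<lambda>\<omega>. Y k (X k \<omega>)))"
    by (auto intro: indep_vars_integrable indep_vars_lebesgue_integral)
  then show "integrable M (\<lambda>\<omega>. f (X i \<omega>) * g (X j \<omega>))"
    "expectation (\<lambda>\<omega>. f (X i \<omega>) * g (X j \<omega>)) = expectation (\<lambda>\<omega>. f (X i \<omega>)) * expectation (\<lambda>\<omega>. g (X j \<omega>))"
    using ij by (auto simp: Y_def)
qed

text \<open>
  Parseval's identity gives the second moments of the partial sums, and Fatou's lemma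
  carries the bound over to the pointwise limit.
\<close>

lemma orthonormal_series_tail:
  fixes S :: "'a \<Rightarrow> nat \<Rightarrow> real" and a :: "nat \<Rightarrow> real"
  assumes [measurable]: "\<And>k. (\<lambda>\<omega>. S \<omega> k) \<in> borel_measurable P" "Y \<in> borel_measurable P"
    and int: "\<And>j k. integrable P (\<lambda>\<omega>. S \<omega> j * S \<omega> k)"
    and orth: "\<And>j k. (LINT \<omega>|P. S \<omega> j * S \<omega> k) = (if j = k then 1 else 0)"
    and a: "summable (\<lambda>k. (a k)\<^sup>2)"
    and Y: "AE \<omega> in P. (\<lambda>k. a k * S \<omega> k) sums Y \<omega>"
  shows "(\<integral>\<^sup>+\<omega>. ennreal ((Y \<omega> - (\<Sum>k<K. a k * S \<omega> k))\<^sup>2) \<partial>P) \<le> ennreal (\<Sum>k. (a (k + K))\<^sup>2)"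
proof -
  define D where "D m \<omega> = (\<Sum>k\<in>{K..<K + m}. a k * S \<omega> k)" for m \<omega>
  have [measurable]: "D m \<in> borel_measurable P" for m unfolding D_def by measurable
  have D2: "(D m \<omega>)\<^sup>2 = (\<Sum>j\<in>{K..<K + m}. \<Sum>k\<in>{K..<K + m}. a j * a k * (S \<omega> j * S \<omega> k))" for m \<omega>
    unfolding D_def power2_eq_square sum_product by (intro sum.cong refl) (simp add: mult_ac)
  have Di: "integrable P (\<lambda>\<omega>. (D m \<omega>)\<^sup>2)" for m
    unfolding D2 by (intro Bochner_Integration.integrable_sum integrable_mult_right int)
  have DE: "(LINT \<omega>|P. (D m \<omega>)\<^sup>2) = (\<Sum>k<m. (a (k + K))\<^sup>2)" for m
  proof -
    have "(LINT \<omega>|P. (D m \<omega>)\<^sup>2) = (\<Sum>j\<in>{K..<K + m}. \<Sum>k\<in>{K..<K + m}. a j * a k * (if j = k then 1 else 0))"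
      unfolding D2 by (simp add: Bochner_Integration.integral_sum int orth integrable_mult_right)
    also have "\<dots> = (\<Sum>j\<in>{K..<K + m}. (a j)\<^sup>2)"
      by (intro sum.cong refl) (simp add: power2_eq_square sum.delta if_distrib cong: if_cong)
    also have "\<dots> = (\<Sum>k<m. (a (k + K))\<^sup>2)"
      using sum.shift_bounds_nat_ivl[of "\<lambda>j. (a j)\<^sup>2" 0 K m] by (simp add: atLeast0LessThan add.commute)
    finally show ?thesis .
  qed
  have sa: "summable (\<lambda>k. (a (k + K))\<^sup>2)" using a by (rule summable_ignore_initial_segment)
  have "(\<integral>\<^sup>+\<omega>. ennreal ((Y \<omega> - (\<Sum>k<K. a k * S \<omega> k))\<^sup>2) \<partial>P) = (\<integral>\<^sup>+\<omega>. liminf (\<lambda>m. ennreal ((D m \<omega>)\<^sup>2)) \<partial>P)"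
  proof (rule nn_integral_cong_AE, use Y in eventually_elim)
    fix \<omega> assume "(\<lambda>k. a k * S \<omega> k) sums Y \<omega>"
    then have "(\<lambda>k. a (k + K) * S \<omega> (k + K)) sums (Y \<omega> - (\<Sum>k<K. a k * S \<omega> k))"
      by (rule sums_split_initial_segment)
    moreover have "(\<Sum>k<m. a (k + K) * S \<omega> (k + K)) = D m \<omega>" for m
      unfolding D_def using sum.shift_bounds_nat_ivl[of "\<lambda>j. a j * S \<omega> j" 0 K m]
      by (simp add: atLeast0LessThan add.commute)
    ultimately have "(\<lambda>m. D m \<omega>) \<longlonglongrightarrow> Y \<omega> - (\<Sum>k<K. a k * S \<omega> k)" by (simp add: sums_def)
    then have "(\<lambda>m. ennreal ((D m \<omega>)\<^sup>2)) \<longlonglongrightarrow> ennreal ((Y \<omega> - (\<Sum>k<K. a k * S \<omega> k))\<^sup>2)"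
      by (intro tendsto_ennrealI tendsto_intros)
    then show "ennreal ((Y \<omega> - (\<Sum>k<K. a k * S \<omega> k))\<^sup>2) = liminf (\<lambda>m. ennreal ((D m \<omega>)\<^sup>2))"
      by (intro lim_imp_Liminf[symmetric]) auto
  qed
  also have "\<dots> \<le> liminf (\<lambda>m. \<integral>\<^sup>+\<omega>. ennreal ((D m \<omega>)\<^sup>2) \<partial>P)"
    by (rule nn_integral_liminf) measurable
  also have "\<dots> = liminf (\<lambda>m. ennreal (\<Sum>k<m. (a (k + K))\<^sup>2))"
    by (simp add: nn_integral_eq_integral[OF Di] DE)
  also have "\<dots> = ennreal (\<Sum>k. (a (k + K))\<^sup>2)"
    by (intro lim_imp_Liminf tendsto_ennrealI summable_LIMSEQ sa) auto
  finally show ?thesis .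
qed

section \<open>Series of independent normal variables\<close>

definition gauss_seq :: "(nat \<Rightarrow> real) measure" where
  "gauss_seq = PiM UNIV (\<lambda>_. std_normal_distribution)"

lemma sets_gauss_seq [simp, measurable_cong]: "sets gauss_seq = sets borel"
proof -
  have "sets gauss_seq = sets (Pi\<^sub>M UNIV (\<lambda>_::nat. borel :: real measure))"
    unfolding gauss_seq_def by (rule sets_PiM_cong) auto
  then show ?thesis by (simp add: sets_PiM_equal_borel)
qed

lemma space_gauss_seq [simp]: "space gauss_seq = UNIV"
  using sets_eq_imp_space_eq[OF sets_gauss_seq] by simp

interpretation std_normal: real_distribution std_normal_distribution
  by (rule real_dist_normal_dist)

interpretation gauss_seq: prob_space gauss_seq
  unfolding gauss_seq_def by (rule prob_space_PiM) (rule std_normal.prob_space_axioms)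

lemma measurable_coordinate [measurable]: "(\<lambda>\<omega>::nat \<Rightarrow> real. \<omega> k) \<in> borel_measurable borel"
  by (rule borel_measurable_continuous_onI) (rule continuous_on_product_coordinates)

lemma distr_gauss_seq_coordinate: "distr gauss_seq borel (\<lambda>\<omega>. \<omega> k) = std_normal_distribution"
proof -
  have "distr gauss_seq borel (\<lambda>\<omega>. \<omega> k) = distr gauss_seq std_normal_distribution (\<lambda>\<omega>. \<omega> k)"
    by (rule distr_cong) auto
  also have "\<dots> = std_normal_distribution"
    unfolding gauss_seq_def by (rule distr_PiM_component) (auto intro: std_normal.prob_space_axioms)
  finally show ?thesis .
qed

lemma indep_vars_gauss_seq: "gauss_seq.indep_vars (\<lambda>_. borel) (\<lambda>k \<omega>. \<omega> k) UNIV"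
proof (subst gauss_seq.indep_vars_iff_distr_eq_PiM')
  have "distr gauss_seq (Pi\<^sub>M UNIV (\<lambda>i. borel)) (\<lambda>x. \<lambda>i\<in>UNIV. x i) = distr gauss_seq gauss_seq (\<lambda>x. x)"
    by (rule distr_cong) (auto simp: sets_PiM_equal_borel)
  also have "\<dots> = gauss_seq" by (rule distr_id2) simp
  also have "\<dots> = Pi\<^sub>M UNIV (\<lambda>i. distr gauss_seq borel (\<lambda>\<omega>. \<omega> i))"
    unfolding distr_gauss_seq_coordinate by (simp add: gauss_seq_def)
  finally show "distr gauss_seq (Pi\<^sub>M UNIV (\<lambda>i. borel)) (\<lambda>x. \<lambda>i\<in>UNIV. x i) = Pi\<^sub>M UNIV (\<lambda>i. distr gauss_seq borel (\<lambda>\<omega>. \<omega> i))" .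
qed auto

lemma integral_gauss_seq_coordinate:
  fixes f :: "real \<Rightarrow> 'b :: {banach, second_countable_topology}"
  assumes [measurable]: "f \<in> borel_measurable borel"
  shows "(LINT \<omega>|gauss_seq. f (\<omega> k)) = integral\<^sup>L std_normal_distribution f"
    and "integrable gauss_seq (\<lambda>\<omega>. f (\<omega> k)) \<longleftrightarrow> integrable std_normal_distribution f"
proof -
  show "(LINT \<omega>|gauss_seq. f (\<omega> k)) = integral\<^sup>L std_normal_distribution f"
    by (subst distr_gauss_seq_coordinate[of k, symmetric], subst integral_distr) auto
  show "integrable gauss_seq (\<lambda>\<omega>. f (\<omega> k)) \<longleftrightarrow> integrable std_normal_distribution f"
    by (subst distr_gauss_seq_coordinate[of k, symmetric], subst integrable_distr_eq) auto
qed

lemma std_normal_moments: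
  "integrable std_normal_distribution (\<lambda>x. x)" "(LINT x|std_normal_distribution. x) = 0"
  "integrable std_normal_distribution (\<lambda>x. x\<^sup>2)" "(LINT x|std_normal_distribution. x\<^sup>2) = 1"
proof -
  show "integrable std_normal_distribution (\<lambda>x. x)"
    using integrable_std_normal_distribution_moment[of 1] unfolding power_one_right .
  show "(LINT x|std_normal_distribution. x) = 0"
    using integral_std_normal_distribution_moment_odd[of 1, OF odd_one] unfolding power_one_right .
  show "integrable std_normal_distribution (\<lambda>x. x\<^sup>2)"
    using std_normal_distribution_even_moments(2)[of 1] unfolding mult_1_right .
  have "fact 2 / (2 ^ 1 * fact 1) = (1::real)" by (simp add: fact_2)
  then show "(LINT x|std_normal_distribution. x\<^sup>2) = 1"
    using std_normal_distribution_even_moments(1)[of 1] unfolding mult_1_right by (rule trans[rotated])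
qed

lemma gauss_seq_moments:
  shows "integrable gauss_seq (\<lambda>\<omega>. \<omega> k)" "(LINT \<omega>|gauss_seq. \<omega> k) = 0"
    "integrable gauss_seq (\<lambda>\<omega>. \<omega> j * \<omega> k)" "(LINT \<omega>|gauss_seq. \<omega> j * \<omega> k) = (if j = k then 1 else 0)"
proof -
  have id: "(\<lambda>x. x) \<in> borel_measurable borel" "(\<lambda>x. x\<^sup>2) \<in> borel_measurable (borel :: real measure)"
    by measurable
  show 1: "integrable gauss_seq (\<lambda>\<omega>. \<omega> k)" for k
    using integral_gauss_seq_coordinate(2)[OF id(1), of k] std_normal_moments(1) by blast
  show 2: "(LINT \<omega>|gauss_seq. \<omega> k) = 0" for k
    using integral_gauss_seq_coordinate(1)[OF id(1), of k] std_normal_moments(2) by (rule trans)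
  have 3: "integrable gauss_seq (\<lambda>\<omega>. (\<omega> k)\<^sup>2)" for k
    using integral_gauss_seq_coordinate(2)[OF id(2), of k] std_normal_moments(3) by blast
  have 4: "(LINT \<omega>|gauss_seq. (\<omega> k)\<^sup>2) = 1" for k
    using integral_gauss_seq_coordinate(1)[OF id(2), of k] std_normal_moments(4) by (rule trans)
  have "integrable gauss_seq (\<lambda>\<omega>. \<omega> j * \<omega> k) \<and> (LINT \<omega>|gauss_seq. \<omega> j * \<omega> k) = (if j = k then 1 else 0)"
  proof (cases "j = k")
    case True
    then show ?thesis using 3[of k] 4[of k] by (simp add: power2_eq_square)
  next
    case False
    then show ?thesis
      using gauss_seq.indep_vars_product_of_functions[OF indep_vars_gauss_seq UNIV_I UNIV_I False, of "\<lambda>x. x" "\<lambda>x. x"] False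
      by (simp add: 1 2)
  qed
  then show "integrable gauss_seq (\<lambda>\<omega>. \<omega> j * \<omega> k)" "(LINT \<omega>|gauss_seq. \<omega> j * \<omega> k) = (if j = k then 1 else 0)"
    by auto
qed

lemma gauss_seq_char:
  "(CLINT \<omega>|gauss_seq. iexp (\<Sum>k<m. u k * \<omega> k)) = complex_of_real (exp (- (\<Sum>k<m. (u k)\<^sup>2) / 2))"
proof -
  have "(CLINT \<omega>|gauss_seq. iexp (\<Sum>k<m. u k * \<omega> k)) = (CLINT \<omega>|gauss_seq. (\<Prod>k<m. iexp (u k * \<omega> k)))"
    by (simp add: exp_sum sum_distrib_left)
  also have "\<dots> = (\<Prod>k<m. CLINT \<omega>|gauss_seq. iexp (u k * \<omega> k))"
  proof (rule gauss_seq.indep_vars_lebesgue_integral)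
    show "gauss_seq.indep_vars (\<lambda>_. borel) (\<lambda>k \<omega>. iexp (u k * \<omega> k)) {..<m}"
      by (rule gauss_seq.indep_vars_compose2[OF gauss_seq.indep_vars_subset[OF indep_vars_gauss_seq]]) auto
    show "integrable gauss_seq (\<lambda>\<omega>. iexp (u k * \<omega> k))" for k
      by (rule gauss_seq.integrable_const_bound[where B = 1]) auto
  qed auto
  also have "\<dots> = (\<Prod>k<m. char std_normal_distribution (u k))"
    unfolding char_def
    by (intro prod.cong refl integral_gauss_seq_coordinate(1)[where f = "\<lambda>x. iexp (u k * x)" and k = k for k]) measurable
  also have "\<dots> = complex_of_real (exp (\<Sum>k<m. - (u k)\<^sup>2 / 2))"
    by (simp add: char_std_normal_distribution exp_sum)
  also have "(\<Sum>k<m. - (u k)\<^sup>2 / 2) = - (\<Sum>k<m. (u k)\<^sup>2) / 2"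
    by (simp add: sum_divide_distrib sum_negf)
  finally show ?thesis .
qed

text \<open>
  Sequences of at most exponential growth. On each of these closed sets the series
  considered below converge uniformly, and almost every sequence of independent normal
  variables lies in one of them.
\<close>

definition slow :: "real \<Rightarrow> nat \<Rightarrow> (nat \<Rightarrow> real) set" where
  "slow q C = {\<omega>. \<forall>k. \<bar>\<omega> k\<bar> * q ^ k \<le> real C}"

lemma closed_slow: "closed (slow q C)"
proof -
  have "closed {\<omega>::nat \<Rightarrow> real. \<bar>\<omega> k\<bar> * q ^ k \<le> real C}" for k
    by (intro closed_Collect_le continuous_intros continuous_on_product_coordinates)
  moreover have "slow q C = (\<Inter>k. {\<omega>. \<bar>\<omega> k\<bar> * q ^ k \<le> real C})" by (auto simp: slow_def)
  ultimately show ?thesis by auto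
qed

lemma sets_slow [measurable]: "(\<Union>C. slow q C) \<in> sets borel"
  using closed_slow by (intro sets.countable_UN) auto

text \<open>
  The sum of all \<open>(\<omega>\<^sub>k q\<^sup>k)\<^sup>2\<close> has finite expectation, hence is almost surely finite, and it
  bounds each of its terms.
\<close>

lemma AE_gauss_seq_slow:
  assumes q: "0 < q" "q < 1"
  shows "AE \<omega> in gauss_seq. \<omega> \<in> (\<Union>C. slow q C)"
proof -
  have s: "summable (\<lambda>k. (q\<^sup>2) ^ k)" using q by (intro summable_geometric) (simp add: abs_square_less_1)
  have "(\<integral>\<^sup>+\<omega>. (\<Sum>k. ennreal ((\<omega> k * q ^ k)\<^sup>2)) \<partial>gauss_seq) = (\<Sum>k. \<integral>\<^sup>+\<omega>. ennreal ((\<omega> k * q ^ k)\<^sup>2) \<partial>gauss_seq)"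
    by (rule nn_integral_suminf) measurable
  also have "\<dots> = (\<Sum>k. ennreal ((q\<^sup>2) ^ k))"
  proof (rule suminf_cong)
    fix k
    have e: "(\<omega> k * q ^ k)\<^sup>2 = (q\<^sup>2) ^ k * (\<omega> k * \<omega> k)" for \<omega> :: "nat \<Rightarrow> real"
      by (simp add: power_mult_distrib power2_eq_square mult_ac)
    have "(\<integral>\<^sup>+\<omega>. ennreal ((\<omega> k * q ^ k)\<^sup>2) \<partial>gauss_seq) = ennreal (LINT \<omega>|gauss_seq. (\<omega> k * q ^ k)\<^sup>2)"
      unfolding e by (intro nn_integral_eq_integral) (auto intro: gauss_seq_moments)
    also have "(LINT \<omega>|gauss_seq. (\<omega> k * q ^ k)\<^sup>2) = (q\<^sup>2) ^ k"
      unfolding e by (simp add: gauss_seq_moments)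
    finally show "(\<integral>\<^sup>+\<omega>. ennreal ((\<omega> k * q ^ k)\<^sup>2) \<partial>gauss_seq) = ennreal ((q\<^sup>2) ^ k)" .
  qed
  also have "\<dots> = ennreal (\<Sum>k. (q\<^sup>2) ^ k)" by (intro suminf_ennreal2 s) auto
  finally have "(\<integral>\<^sup>+\<omega>. (\<Sum>k. ennreal ((\<omega> k * q ^ k)\<^sup>2)) \<partial>gauss_seq) \<noteq> \<infinity>" by simp
  then have "AE \<omega> in gauss_seq. (\<Sum>k. ennreal ((\<omega> k * q ^ k)\<^sup>2)) \<noteq> \<infinity>"
    by (intro nn_integral_PInf_AE) measurable
  then show ?thesis
  proof eventually_elim
    case (elim \<omega>)
    then obtain r where r: "r \<ge> 0" "(\<Sum>k. ennreal ((\<omega> k * q ^ k)\<^sup>2)) = ennreal r"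
      by (metis ennreal_cases infinity_ennreal_def)
    have "\<bar>\<omega> k\<bar> * q ^ k \<le> real (nat \<lceil>sqrt r\<rceil>)" for k
    proof -
      have "ennreal ((\<omega> k * q ^ k)\<^sup>2) = (\<Sum>j\<in>{k}. ennreal ((\<omega> j * q ^ j)\<^sup>2))" by simp
      also have "\<dots> \<le> (\<Sum>k. ennreal ((\<omega> k * q ^ k)\<^sup>2))" by (rule sum_le_suminf) auto
      finally have "(\<omega> k * q ^ k)\<^sup>2 \<le> r" using r by simp
      then have "\<bar>\<omega> k * q ^ k\<bar> \<le> sqrt r" using real_sqrt_le_mono by fastforce
      then have "\<bar>\<omega> k\<bar> * q ^ k \<le> sqrt r" using q by (simp add: abs_mult)
      also have "\<dots> \<le> real (nat \<lceil>sqrt r\<rceil>)" by linarith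
      finally show ?thesis .
    qed
    then show ?case by (auto simp: slow_def)
  qed
qed

text \<open>
  Every path of the limit process has to lie in \<open>L\<^sup>2\<close>, so the series is set to 0 on the null
  set where it might diverge.
\<close>

definition slow_sum :: "real \<Rightarrow> (nat \<Rightarrow> real) \<Rightarrow> (nat \<Rightarrow> real) \<Rightarrow> real" where
  "slow_sum q b \<omega> = (if \<omega> \<in> (\<Union>C. slow q C) then \<Sum>k. b k * \<omega> k else 0)"

lemma slow_term_bound:
  assumes q: "0 < q" and b: "\<And>k. \<bar>b k\<bar> \<le> B * (q\<^sup>2) ^ k" and \<omega>: "\<omega> \<in> slow q C"
  shows "\<bar>b k * \<omega> k\<bar> \<le> B * real C * q ^ k"
proof -
  have B: "B \<ge> 0" using b[of 0] abs_ge_zero[of "b 0"] by (simp del: abs_ge_zero)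
  have "\<bar>b k * \<omega> k\<bar> \<le> (B * (q\<^sup>2) ^ k) * \<bar>\<omega> k\<bar>"
    unfolding abs_mult by (intro mult_right_mono b) auto
  also have "\<dots> = B * q ^ k * (\<bar>\<omega> k\<bar> * q ^ k)" by (simp add: power2_eq_square power_mult_distrib)
  also have "\<dots> \<le> B * q ^ k * real C"
    using \<omega> B q by (intro mult_left_mono) (auto simp: slow_def)
  finally show ?thesis by (simp add: mult_ac)
qed

lemma slow_summable:
  assumes q: "0 < q" "q < 1" and b: "\<And>k. \<bar>b k\<bar> \<le> B * (q\<^sup>2) ^ k" and \<omega>: "\<omega> \<in> slow q C"
  shows "summable (\<lambda>k. \<bar>b k * \<omega> k\<bar>)"
    and "\<bar>\<Sum>k. b k * \<omega> k\<bar> \<le> B * real C / (1 - q)"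
proof -
  have g: "(\<lambda>k. B * real C * q ^ k) sums (B * real C * (1 / (1 - q)))"
    using q by (intro sums_mult geometric_sums) auto
  show s: "summable (\<lambda>k. \<bar>b k * \<omega> k\<bar>)"
    by (rule summable_comparison_test'[OF sums_summable[OF g], of 0])
      (use slow_term_bound[OF q(1) b \<omega>] in auto)
  have "\<bar>\<Sum>k. b k * \<omega> k\<bar> \<le> (\<Sum>k. \<bar>b k * \<omega> k\<bar>)" by (rule summable_rabs[OF s])
  also have "\<dots> \<le> (\<Sum>k. B * real C * q ^ k)"
    by (intro suminf_le slow_term_bound[OF q(1) b \<omega>] s sums_summable[OF g])
  also have "\<dots> = B * real C / (1 - q)" using sums_unique[OF g] by simp
  finally show "\<bar>\<Sum>k. b k * \<omega> k\<bar> \<le> B * real C / (1 - q)" .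
qed

lemma slow_sum_sums:
  assumes q: "0 < q" "q < 1" and b: "\<And>k. \<bar>b k\<bar> \<le> B * (q\<^sup>2) ^ k" and \<omega>: "\<omega> \<in> (\<Union>C. slow q C)"
  shows "(\<lambda>k. b k * \<omega> k) sums slow_sum q b \<omega>"
proof -
  obtain C where "\<omega> \<in> slow q C" using \<omega> by blast
  from slow_summable(1)[OF q b this] have "summable (\<lambda>k. b k * \<omega> k)" by (rule summable_rabs_cancel)
  then show ?thesis using \<omega> by (simp add: slow_sum_def summable_sums)
qed

lemma summable_square_geometric:
  assumes q: "0 < q" "q < (1::real)" and b: "\<And>k. \<bar>b k\<bar> \<le> B * (q\<^sup>2) ^ k"
  shows "summable (\<lambda>k. (b k)\<^sup>2)"
proof (rule summable_comparison_test'[where N = 0])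
  show "summable (\<lambda>k. B\<^sup>2 * (q ^ 4) ^ k)"
    using q by (intro summable_mult summable_geometric) (simp add: power_less_one_iff)
  show "norm ((b k)\<^sup>2) \<le> B\<^sup>2 * (q ^ 4) ^ k" for k
  proof -
    have "\<bar>b k\<bar>\<^sup>2 \<le> (B * (q\<^sup>2) ^ k)\<^sup>2" by (intro power_mono b) auto
    also have "\<dots> = B\<^sup>2 * (q ^ 4) ^ k"
      by (simp add: power_mult_distrib power_mult [symmetric] mult.commute)
    finally show ?thesis by simp
  qed
qed

lemma measurable_slow_sum [measurable]: "slow_sum q b \<in> borel_measurable borel"
  unfolding slow_sum_def[abs_def] by measurable

text \<open>
  The characteristic functions of the partial sums converge to that of a multiple of a
  single normal variable. Writing the limit law in this form covers the degenerate case of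
  variance 0.
\<close>

lemma distr_slow_sum:
  assumes q: "0 < q" "q < 1" and b: "\<And>k. \<bar>b k\<bar> \<le> B * (q\<^sup>2) ^ k"
  shows "distr gauss_seq borel (slow_sum q b) = distr gauss_seq borel (\<lambda>\<omega>. sqrt (\<Sum>k. (b k)\<^sup>2) * \<omega> 0)"
proof (rule Levy_uniqueness)
  show "real_distribution (distr gauss_seq borel (slow_sum q b))"
    "real_distribution (distr gauss_seq borel (\<lambda>\<omega>. sqrt (\<Sum>k. (b k)\<^sup>2) * \<omega> 0))"
    by (rule gauss_seq.real_distribution_distr, measurable)+
  define s2 where "s2 = (\<Sum>k. (b k)\<^sup>2)"
  have sb: "summable (\<lambda>k. (b k)\<^sup>2)" by (rule summable_square_geometric[OF q b])
  have s2: "s2 \<ge> 0" unfolding s2_def by (intro suminf_nonneg sb) auto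
  show "char (distr gauss_seq borel (slow_sum q b)) = char (distr gauss_seq borel (\<lambda>\<omega>. sqrt (\<Sum>k. (b k)\<^sup>2) * \<omega> 0))"
  proof
    fix t
    have "(\<lambda>m. CLINT \<omega>|gauss_seq. iexp (\<Sum>k<m. (t * b k) * \<omega> k)) \<longlonglongrightarrow> (CLINT \<omega>|gauss_seq. iexp (t * slow_sum q b \<omega>))"
    proof (rule integral_dominated_convergence[where w = "\<lambda>_. 1"])
      show "AE \<omega> in gauss_seq. (\<lambda>m. iexp (\<Sum>k<m. (t * b k) * \<omega> k)) \<longlonglongrightarrow> iexp (t * slow_sum q b \<omega>)"
        using AE_gauss_seq_slow[OF q]
      proof eventually_elim
        case (elim \<omega>)
        have "(\<lambda>m. t * (\<Sum>k<m. b k * \<omega> k)) \<longlonglongrightarrow> t * slow_sum q b \<omega>"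
          using slow_sum_sums[OF q b elim] by (intro tendsto_intros) (simp add: sums_def)
        then have "(\<lambda>m. \<Sum>k<m. (t * b k) * \<omega> k) \<longlonglongrightarrow> t * slow_sum q b \<omega>"
          by (simp add: sum_distrib_left mult.assoc)
        then show ?case by (intro tendsto_intros)
      qed
    qed auto
    then have "(\<lambda>m. complex_of_real (exp (- (\<Sum>k<m. (t * b k)\<^sup>2) / 2))) \<longlonglongrightarrow> (CLINT \<omega>|gauss_seq. iexp (t * slow_sum q b \<omega>))"
      unfolding gauss_seq_char .
    moreover have "(\<lambda>m. complex_of_real (exp (- (\<Sum>k<m. (t * b k)\<^sup>2) / 2))) \<longlonglongrightarrow> complex_of_real (exp (- (t\<^sup>2 * s2) / 2))"
    proof -
      have "(\<lambda>m. t\<^sup>2 * (\<Sum>k<m. (b k)\<^sup>2)) \<longlonglongrightarrow> t\<^sup>2 * s2"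
        unfolding s2_def by (intro tendsto_intros summable_LIMSEQ sb)
      then have "(\<lambda>m. \<Sum>k<m. (t * b k)\<^sup>2) \<longlonglongrightarrow> t\<^sup>2 * s2"
        by (simp add: sum_distrib_left power_mult_distrib)
      then show ?thesis by (intro tendsto_intros) auto
    qed
    ultimately have 1: "(CLINT \<omega>|gauss_seq. iexp (t * slow_sum q b \<omega>)) = complex_of_real (exp (- (t\<^sup>2 * s2) / 2))"
      by (rule LIMSEQ_unique)
    have 2: "(CLINT \<omega>|gauss_seq. iexp (t * (sqrt s2 * \<omega> 0))) = complex_of_real (exp (- (t\<^sup>2 * s2) / 2))"
      using gauss_seq_char[where m = 1 and u = "\<lambda>_. t * sqrt s2"] s2
      by (simp add: power_mult_distrib mult.assoc)
    show "char (distr gauss_seq borel (slow_sum q b)) t = char (distr gauss_seq borel (\<lambda>\<omega>. sqrt (\<Sum>k. (b k)\<^sup>2) * \<omega> 0)) t"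
      unfolding char_def using 1 2 by (simp add: integral_distr s2_def)
  qed
qed

lemma gaussian_rv_slow_sum:
  assumes q: "0 < q" "q < 1" and b: "\<And>k. \<bar>b k\<bar> \<le> B * (q\<^sup>2) ^ k"
  shows "gaussian_rv gauss_seq (slow_sum q b)"
proof -
  define \<sigma> where "\<sigma> = sqrt (\<Sum>k. (b k)\<^sup>2)"
  have \<sigma>: "\<sigma> \<ge> 0" unfolding \<sigma>_def by (intro real_sqrt_ge_zero suminf_nonneg summable_square_geometric[OF q b]) auto
  have d: "distr gauss_seq borel (slow_sum q b) = distr gauss_seq borel (\<lambda>\<omega>. \<sigma> * \<omega> 0)"
    unfolding \<sigma>_def by (rule distr_slow_sum[OF q b])
  have "distr gauss_seq borel (\<lambda>\<omega>. \<sigma> * \<omega> 0)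
    = (if \<sigma> = 0 then return borel 0 else density lborel (\<lambda>x. ennreal (normal_density 0 \<sigma> x)))"
  proof (cases "\<sigma> = 0")
    case True
    then show ?thesis by (simp add: gauss_seq.distr_const)
  next
    case False
    have "distributed gauss_seq lborel (\<lambda>\<omega>. \<omega> 0) (\<lambda>x. ennreal (std_normal_density x))"
    proof -
      have "distr gauss_seq lborel (\<lambda>\<omega>. \<omega> 0) = distr gauss_seq borel (\<lambda>\<omega>. \<omega> 0)"
        by (rule distr_cong) auto
      then show ?thesis unfolding distributed_def distr_gauss_seq_coordinate by simp
    qed
    then have "distributed gauss_seq lborel (\<lambda>\<omega>. 0 + \<sigma> * \<omega> 0) (normal_density (0 + \<sigma> * 0) (\<bar>\<sigma>\<bar> * 1))"
      using False by (intro gauss_seq.normal_density_affine) auto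
    then have "distr gauss_seq lborel (\<lambda>\<omega>. \<sigma> * \<omega> 0) = density lborel (\<lambda>x. ennreal (normal_density 0 \<sigma> x))"
      using \<sigma> by (simp add: distributed_def)
    moreover have "distr gauss_seq lborel (\<lambda>\<omega>. \<sigma> * \<omega> 0) = distr gauss_seq borel (\<lambda>\<omega>. \<sigma> * \<omega> 0)"
      by (rule distr_cong) auto
    ultimately show ?thesis using False by simp
  qed
  then show ?thesis
    unfolding gaussian_rv_def d using \<sigma> by (intro conjI exI[of _ 0] exI[of _ \<sigma>]) auto
qed

lemma slow_sum_moments:
  assumes q: "0 < q" "q < 1" and b: "\<And>k. \<bar>b k\<bar> \<le> B * (q\<^sup>2) ^ k"
  shows "(LINT \<omega>|gauss_seq. slow_sum q b \<omega>) = 0"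
    and "integrable gauss_seq (\<lambda>\<omega>. (slow_sum q b \<omega>)\<^sup>2)"
    and "(LINT \<omega>|gauss_seq. (slow_sum q b \<omega>)\<^sup>2) = (\<Sum>k. (b k)\<^sup>2)"
proof -
  have sb: "0 \<le> (\<Sum>k. (b k)\<^sup>2)" by (intro suminf_nonneg summable_square_geometric[OF q b]) auto
  have i: "(LINT \<omega>|gauss_seq. f (slow_sum q b \<omega>)) = (LINT \<omega>|gauss_seq. f (sqrt (\<Sum>k. (b k)\<^sup>2) * \<omega> 0))"
    "integrable gauss_seq (\<lambda>\<omega>. f (slow_sum q b \<omega>)) \<longleftrightarrow> integrable gauss_seq (\<lambda>\<omega>. f (sqrt (\<Sum>k. (b k)\<^sup>2) * \<omega> 0))"
    if [measurable]: "f \<in> borel_measurable borel" for f :: "real \<Rightarrow> real"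
    using integral_distr[of "slow_sum q b" gauss_seq borel f] integral_distr[of "\<lambda>\<omega>. sqrt (\<Sum>k. (b k)\<^sup>2) * \<omega> 0" gauss_seq borel f]
      integrable_distr_eq[of "slow_sum q b" gauss_seq borel f] integrable_distr_eq[of "\<lambda>\<omega>. sqrt (\<Sum>k. (b k)\<^sup>2) * \<omega> 0" gauss_seq borel f]
    by (simp_all add: distr_slow_sum[OF q b])
  show "(LINT \<omega>|gauss_seq. slow_sum q b \<omega>) = 0"
    using i(1)[of "\<lambda>x. x"] by (simp add: gauss_seq_moments)
  show "integrable gauss_seq (\<lambda>\<omega>. (slow_sum q b \<omega>)\<^sup>2)" "(LINT \<omega>|gauss_seq. (slow_sum q b \<omega>)\<^sup>2) = (\<Sum>k. (b k)\<^sup>2)"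
    using i[of "\<lambda>x. x\<^sup>2"] gauss_seq_moments(3,4)[of 0 0] sb by (simp_all add: power_mult_distrib power2_eq_square[of "_ 0"])
qed

lemma slow_sum_linear:
  assumes q: "0 < q" "q < 1" and S: "finite S" and b: "\<And>s k. s \<in> S \<Longrightarrow> \<bar>b s k\<bar> \<le> B s * (q\<^sup>2) ^ k"
  shows "(\<Sum>s\<in>S. c s * slow_sum q (b s) \<omega>) = slow_sum q (\<lambda>k. \<Sum>s\<in>S. c s * b s k) \<omega>"
proof (cases "\<omega> \<in> (\<Union>C. slow q C)")
  case True
  have "(\<lambda>k. \<Sum>s\<in>S. c s * (b s k * \<omega> k)) sums (\<Sum>s\<in>S. c s * slow_sum q (b s) \<omega>)"
    by (intro sums_sum sums_mult slow_sum_sums[OF q b True])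
  then have "(\<lambda>k. (\<Sum>s\<in>S. c s * b s k) * \<omega> k) sums (\<Sum>s\<in>S. c s * slow_sum q (b s) \<omega>)"
    by (simp add: sum_distrib_right mult.assoc)
  then show ?thesis using True sums_unique by (simp add: slow_sum_def)
qed (auto simp: slow_sum_def)

lemma geometric_bound_linear:
  assumes b: "\<And>s k. s \<in> S \<Longrightarrow> \<bar>b s k\<bar> \<le> B s * (q\<^sup>2) ^ k"
  shows "\<bar>\<Sum>s\<in>S. c s * b s k\<bar> \<le> (\<Sum>s\<in>S. \<bar>c s\<bar> * B s) * ((q::real)\<^sup>2) ^ k"
proof -
  have "\<bar>\<Sum>s\<in>S. c s * b s k\<bar> \<le> (\<Sum>s\<in>S. \<bar>c s * b s k\<bar>)" by (rule sum_abs)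
  also have "\<dots> \<le> (\<Sum>s\<in>S. \<bar>c s\<bar> * (B s * (q\<^sup>2) ^ k))"
    unfolding abs_mult by (intro sum_mono mult_left_mono b) auto
  finally show ?thesis by (simp add: sum_distrib_right mult.assoc)
qed

text \<open>
  By polarization from the second moments of the two sums and of their sum.
\<close>

lemma slow_sum_covariance:
  assumes q: "0 < q" "q < 1" and b: "\<And>k. \<bar>b k\<bar> \<le> B * (q\<^sup>2) ^ k" and b': "\<And>k. \<bar>b' k\<bar> \<le> B' * (q\<^sup>2) ^ k"
  shows "(LINT \<omega>|gauss_seq. slow_sum q b \<omega> * slow_sum q b' \<omega>) = (\<Sum>k. b k * b' k)"
proof -
  have bb: "\<bar>b k + b' k\<bar> \<le> (B + B') * (q\<^sup>2) ^ k" for k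
    using b[of k] b'[of k] by (simp add: distrib_right)
  have add: "slow_sum q (\<lambda>k. b k + b' k) \<omega> = slow_sum q b \<omega> + slow_sum q b' \<omega>" for \<omega>
  proof (cases "\<omega> \<in> (\<Union>C. slow q C)")
    case True
    have "(\<lambda>k. (b k + b' k) * \<omega> k) sums (slow_sum q b \<omega> + slow_sum q b' \<omega>)"
      unfolding distrib_right by (intro sums_add slow_sum_sums[OF q b True] slow_sum_sums[OF q b' True])
    then show ?thesis using slow_sum_sums[OF q bb True] sums_unique2 by blast
  qed (auto simp: slow_sum_def)
  note m = slow_sum_moments[OF q b] and m' = slow_sum_moments[OF q b'] and mm = slow_sum_moments[OF q bb]
  have e: "x * y = ((x + y)\<^sup>2 - x\<^sup>2 - y\<^sup>2) / 2" for x y :: real by (simp add: power2_sum)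
  have "(LINT \<omega>|gauss_seq. slow_sum q b \<omega> * slow_sum q b' \<omega>)
    = (LINT \<omega>|gauss_seq. ((slow_sum q (\<lambda>k. b k + b' k) \<omega>)\<^sup>2 - (slow_sum q b \<omega>)\<^sup>2 - (slow_sum q b' \<omega>)\<^sup>2) / 2)"
    by (intro Bochner_Integration.integral_cong refl) (simp add: add e[of "slow_sum q b _"])
  also have "\<dots> = ((\<Sum>k. (b k + b' k)\<^sup>2) - (\<Sum>k. (b k)\<^sup>2) - (\<Sum>k. (b' k)\<^sup>2)) / 2"
    using m m' mm by simp
  also have "\<dots> = (\<Sum>k. ((b k + b' k)\<^sup>2 - (b k)\<^sup>2 - (b' k)\<^sup>2) / 2)"
  proof -
    note s = summable_square_geometric[OF q bb] summable_square_geometric[OF q b] summable_square_geometric[OF q b']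
    have "(\<lambda>k. ((b k + b' k)\<^sup>2 - (b k)\<^sup>2 - (b' k)\<^sup>2) / 2) sums (((\<Sum>k. (b k + b' k)\<^sup>2) - (\<Sum>k. (b k)\<^sup>2) - (\<Sum>k. (b' k)\<^sup>2)) / 2)"
      by (intro sums_divide sums_diff summable_sums s)
    then show ?thesis by (rule sums_unique)
  qed
  also have "\<dots> = (\<Sum>k. b k * b' k)" by (simp only: e[symmetric])
  finally show ?thesis .
qed

section \<open>The limit process\<close>

text \<open>
  The square of this number is \<open>1 / R\<close> for \<open>R = 1 + \<alpha> / 4\<close>. For this \<open>R\<close> the modes are
  bounded by \<open>exp (\<bar>t\<bar> / 4) / R\<^sup>k\<close>, and \<open>exp (\<bar>t\<bar> / 4)\<close> is still square integrable for the
  Gamma distribution. Half of the decay absorbs the growth allowed to the coefficients, the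
  other half makes the series converge.
\<close>

definition damping :: "real \<Rightarrow> real" where
  "damping \<alpha> = 1 / sqrt (1 + \<alpha> / 4)"

lemma damping_bounds:
  assumes "\<alpha> > 0"
  shows "0 < damping \<alpha>" "damping \<alpha> < 1" "(damping \<alpha>)\<^sup>2 = 1 / (1 + \<alpha> / 4)"
  using assms by (simp_all add: damping_def power_divide)

lemma abs_mode_damping:
  assumes a: "\<alpha> \<ge> 1 / 2"
  shows "\<bar>mode \<alpha> k t\<bar> \<le> exp (\<bar>t\<bar> / 4) * ((damping \<alpha>)\<^sup>2) ^ k"
proof -
  have e: "(1 + \<alpha> / 4 - 1) * \<bar>t\<bar> / \<alpha> = \<bar>t\<bar> / 4" using a by simp
  have "\<bar>mode \<alpha> k t\<bar> \<le> exp ((1 + \<alpha> / 4 - 1) * \<bar>t\<bar> / \<alpha>) / (1 + \<alpha> / 4) ^ k"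
    using a by (intro abs_mode_le) auto
  then show ?thesis using a damping_bounds(3)[of \<alpha>] by (simp only: e) (simp add: power_one_over power_divide)
qed

lemma abs_mode_shift_damping:
  assumes a: "\<alpha> \<ge> 1 / 2"
  shows "\<bar>mode \<alpha> (k + 2) t\<bar> \<le> exp (\<bar>t\<bar> / 4) * ((damping \<alpha>)\<^sup>2) ^ k"
proof -
  have "((damping \<alpha>)\<^sup>2) ^ (k + 2) \<le> ((damping \<alpha>)\<^sup>2) ^ k"
    using a damping_bounds(3)[of \<alpha>] by (intro power_decreasing) auto
  then have "exp (\<bar>t\<bar> / 4) * ((damping \<alpha>)\<^sup>2) ^ (k + 2) \<le> exp (\<bar>t\<bar> / 4) * ((damping \<alpha>)\<^sup>2) ^ k"
    by (intro mult_left_mono) auto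
  then show ?thesis using abs_mode_damping[OF a, of "k + 2" t] by linarith
qed

text \<open>
  The tail of the geometric series that dominates the squares of the modes.
\<close>

definition mode_tail :: "real \<Rightarrow> nat \<Rightarrow> real" where
  "mode_tail \<alpha> K = ((damping \<alpha>) ^ 4) ^ K / (1 - (damping \<alpha>) ^ 4)"

lemma mode_tail_nonneg: "\<alpha> > 0 \<Longrightarrow> mode_tail \<alpha> K \<ge> 0"
  using damping_bounds[of \<alpha>] by (auto simp: mode_tail_def intro!: divide_nonneg_nonneg power_le_one)

lemma mode_tail_tendsto: 
  assumes "\<alpha> > 0" shows "mode_tail \<alpha> \<longlonglongrightarrow> 0"
proof -
  have "damping \<alpha> ^ 4 < 1" using damping_bounds[OF assms] by (simp add: power_less_one_iff)
  then have "(\<lambda>K. ((damping \<alpha>) ^ 4) ^ K / (1 - (damping \<alpha>) ^ 4)) \<longlonglongrightarrow> 0 / (1 - (damping \<alpha>) ^ 4)"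
    using damping_bounds[OF assms] by (intro tendsto_intros LIMSEQ_power_zero) auto
  then show ?thesis by (simp add: mode_tail_def[abs_def])
qed

lemma summable_mode_square:
  assumes a: "\<alpha> \<ge> 1 / 2"
  shows "summable (\<lambda>k. (mode \<alpha> (k + 2) t)\<^sup>2)"
  using damping_bounds[of \<alpha>] a by (intro summable_square_geometric[OF _ _ abs_mode_shift_damping[OF a]]) auto

lemma mode_square_tail_le:
  assumes a: "\<alpha> \<ge> 1 / 2"
  shows "(\<Sum>k. (mode \<alpha> (k + K + 2) t)\<^sup>2) \<le> exp (\<bar>t\<bar> / 2) * mode_tail \<alpha> K"
proof -
  define p where "p = (damping \<alpha>) ^ 4"
  have p: "0 < p" "p < 1" using damping_bounds[of \<alpha>] a by (auto simp: p_def power_less_one_iff)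
  have b: "(mode \<alpha> (k + K + 2) t)\<^sup>2 \<le> exp (\<bar>t\<bar> / 2) * p ^ K * p ^ k" for k
  proof -
    have "\<bar>mode \<alpha> (k + K + 2) t\<bar>\<^sup>2 \<le> (exp (\<bar>t\<bar> / 4) * ((damping \<alpha>)\<^sup>2) ^ (k + K))\<^sup>2"
      by (intro power_mono abs_mode_shift_damping a) auto
    also have "\<dots> = (exp (\<bar>t\<bar> / 4))\<^sup>2 * (p ^ K * p ^ k)"
      by (simp add: power_mult_distrib p_def power_mult [symmetric] power_add [symmetric] mult_ac add_ac distrib_left)
    also have "(exp (\<bar>t\<bar> / 4))\<^sup>2 = exp (\<bar>t\<bar> / 2)" by (simp add: power2_eq_square exp_add [symmetric])
    finally show ?thesis by simp
  qed
  have g: "(\<lambda>k. exp (\<bar>t\<bar> / 2) * p ^ K * p ^ k) sums (exp (\<bar>t\<bar> / 2) * p ^ K * (1 / (1 - p)))"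
    using p by (intro sums_mult geometric_sums) auto
  have "summable (\<lambda>k. (mode \<alpha> (k + K + 2) t)\<^sup>2)"
    using summable_ignore_initial_segment[OF summable_mode_square[OF a], of K] by simp
  then have "(\<Sum>k. (mode \<alpha> (k + K + 2) t)\<^sup>2) \<le> (\<Sum>k. exp (\<bar>t\<bar> / 2) * p ^ K * p ^ k)"
    by (intro suminf_le b sums_summable[OF g])
  also have "\<dots> = exp (\<bar>t\<bar> / 2) * mode_tail \<alpha> K" using sums_unique[OF g] by (simp add: mode_tail_def p_def)
  finally show ?thesis .
qed

lemma square_integrable_exp_quarter:
  assumes "\<alpha> > 0" shows "square_integrable (gamma_distr \<alpha> 1) (\<lambda>t. exp (\<bar>t\<bar> / 4))"
proof -
  have "integrable (gamma_distr \<alpha> 1) (\<lambda>t. exp (t / 2))"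
    using integrable_gamma_exp_tilt[of \<alpha> "1 / 2" 0] assms by simp
  moreover have "(\<lambda>t. exp (\<bar>t\<bar> / 4)) \<in> borel_measurable (gamma_distr \<alpha> 1)"
    "(\<lambda>t. (exp (\<bar>t\<bar> / 4))\<^sup>2) \<in> borel_measurable (gamma_distr \<alpha> 1)" "(\<lambda>t. exp (t / 2)) \<in> borel_measurable (gamma_distr \<alpha> 1)"
    unfolding borel_measurable_gamma_distr_iff by measurable
  moreover have "AE t in gamma_distr \<alpha> 1. (exp (\<bar>t\<bar> / 4))\<^sup>2 = exp (t / 2)"
    using AE_gamma_distr_pos[of \<alpha> 1]
    by eventually_elim (simp add: power2_eq_square exp_add [symmetric])
  ultimately have "integrable (gamma_distr \<alpha> 1) (\<lambda>t. (exp (\<bar>t\<bar> / 4))\<^sup>2)"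
    by (subst integrable_cong_AE[where g = "\<lambda>t. exp (t / 2)"]) simp_all
  then show ?thesis by (simp add: square_integrable_def borel_measurable_gamma_distr_iff)
qed

lemma square_integrable_mode:
  assumes a: "\<alpha> \<ge> 1 / 2" shows "square_integrable (gamma_distr \<alpha> 1) (mode \<alpha> (k + 2))"
proof (rule square_integrable_bound)
  show "square_integrable (gamma_distr \<alpha> 1) (\<lambda>t. ((damping \<alpha>)\<^sup>2) ^ k * exp (\<bar>t\<bar> / 4))"
    using a by (intro square_integrable_cmult square_integrable_exp_quarter) auto
  show "AE t in gamma_distr \<alpha> 1. \<bar>mode \<alpha> (k + 2) t\<bar> \<le> \<bar>((damping \<alpha>)\<^sup>2) ^ k * exp (\<bar>t\<bar> / 4)\<bar>"
    using abs_mode_shift_damping[OF a, of k] by (auto simp: mult.commute abs_mult)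
qed (simp add: borel_measurable_gamma_distr_iff borel_measurable_mode)

text \<open>
  The index shift by 2 drops the modes that are removed by centering and by scaling with the
  sample mean.
\<close>

definition limit_process :: "real \<Rightarrow> real \<Rightarrow> (nat \<Rightarrow> real) \<Rightarrow> real" where
  "limit_process \<alpha> t = slow_sum (damping \<alpha>) (\<lambda>k. mode \<alpha> (k + 2) t)"

context
  fixes \<alpha> :: real assumes a: "\<alpha> \<ge> 1 / 2"
begin

private lemma q: "0 < damping \<alpha>" "damping \<alpha> < 1"
  using damping_bounds[of \<alpha>] a by auto

lemma limit_process_gaussian: "gaussian_process gauss_seq {0..} (limit_process \<alpha>)"
  unfolding gaussian_process_def
proof (intro conjI ballI allI impI)
  show "limit_process \<alpha> t \<in> borel_measurable gauss_seq" for t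
    unfolding limit_process_def by simp
  fix S :: "real set" and c :: "real \<Rightarrow> real" assume "finite S \<and> S \<subseteq> {0..}"
  then have S: "finite S" by simp
  have e: "(\<lambda>\<omega>. \<Sum>t\<in>S. c t * limit_process \<alpha> t \<omega>) = slow_sum (damping \<alpha>) (\<lambda>k. \<Sum>t\<in>S. c t * mode \<alpha> (k + 2) t)"
    unfolding limit_process_def
    by (intro ext slow_sum_linear[OF q S, of _ "\<lambda>t. exp (\<bar>t\<bar> / 4)"] abs_mode_shift_damping a)
  show "gaussian_rv gauss_seq (\<lambda>\<omega>. \<Sum>t\<in>S. c t * limit_process \<alpha> t \<omega>)"
    unfolding e by (rule gaussian_rv_slow_sum[OF q geometric_bound_linear]) (rule abs_mode_shift_damping[OF a])
qed

lemma limit_process_mean: "(LINT \<omega>|gauss_seq. limit_process \<alpha> t \<omega>) = 0"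
  unfolding limit_process_def by (rule slow_sum_moments(1)[OF q abs_mode_shift_damping[OF a]])

lemma limit_process_covariance:
  assumes "s \<ge> 0" "t \<ge> 0"
  shows "covariance gauss_seq (limit_process \<alpha> s) (limit_process \<alpha> t) = limit_covariance \<alpha> s t"
proof -
  have "covariance gauss_seq (limit_process \<alpha> s) (limit_process \<alpha> t) = (\<Sum>k. mode \<alpha> (k + 2) s * mode \<alpha> (k + 2) t)"
    unfolding covariance_def limit_process_mean using slow_sum_covariance[OF q abs_mode_shift_damping[OF a] abs_mode_shift_damping[OF a]]
    by (simp add: limit_process_def)
  also have "\<dots> = limit_covariance \<alpha> s t"
    using limit_covariance_sums[of \<alpha> s t] a assms by (simp add: sums_iff)
  finally show ?thesis .
qed

lemma limit_process_path_measurable: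
  "(\<lambda>t. limit_process \<alpha> t \<omega>) \<in> borel_measurable borel"
  unfolding limit_process_def slow_sum_def by measurable

lemma limit_process_jointly_measurable:
  "(\<lambda>(\<omega>, t). limit_process \<alpha> t \<omega>) \<in> borel_measurable (gauss_seq \<Otimes>\<^sub>M gamma_distr \<alpha> 1)"
  unfolding limit_process_def slow_sum_def by measurable

lemma limit_process_continuous_on_slow:
  "continuous_on (slow (damping \<alpha>) C) (limit_process \<alpha> t)"
proof -
  have s: "summable (\<lambda>k. exp (\<bar>t\<bar> / 4) * real C * damping \<alpha> ^ k)"
    using q by (intro summable_mult summable_geometric) auto
  have u: "uniform_limit (slow (damping \<alpha>) C) (\<lambda>n \<omega>. \<Sum>k<n. mode \<alpha> (k + 2) t * \<omega> k) (\<lambda>\<omega>. \<Sum>k. mode \<alpha> (k + 2) t * \<omega> k) sequentially"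
    by (rule Weierstrass_m_test[OF _ s]) (use slow_term_bound[OF q(1) abs_mode_shift_damping[OF a]] in auto)
  have "continuous_on (slow (damping \<alpha>) C) (\<lambda>\<omega>. \<Sum>k. mode \<alpha> (k + 2) t * \<omega> k)"
  proof (rule uniform_limit_theorem[OF _ u])
    show "\<forall>\<^sub>F n in sequentially. continuous_on (slow (damping \<alpha>) C) (\<lambda>\<omega>. \<Sum>k<n. mode \<alpha> (k + 2) t * \<omega> k)"
      by (intro always_eventually allI continuous_intros continuous_on_subset[OF continuous_on_product_coordinates]) auto
  qed auto
  then show ?thesis
    by (rule continuous_on_cong[THEN iffD1, rotated 2]) (auto simp: limit_process_def slow_sum_def)
qed

lemma limit_process_L2:
  shows "square_integrable (gamma_distr \<alpha> 1) (\<lambda>t. limit_process \<alpha> t \<omega>)"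
    and "(\<lambda>\<omega>. L2_real (gamma_distr \<alpha> 1) (\<lambda>t. limit_process \<alpha> t \<omega>)) \<in> gauss_seq \<rightarrow>\<^sub>M borel_of_topology (L2_topology (gamma_distr \<alpha> 1))"
proof -
  define b where "b C t = (real C / (1 - damping \<alpha>)) * exp (\<bar>t\<bar> / 4)" for C :: nat and t :: real
  have b: "square_integrable (gamma_distr \<alpha> 1) (b C)" for C
    unfolding b_def[abs_def] using a by (intro square_integrable_cmult square_integrable_exp_quarter) auto
  have bound: "\<bar>limit_process \<alpha> t \<omega>\<bar> \<le> b C t" if "\<omega> \<in> slow (damping \<alpha>) C" for \<omega> C t
    using slow_summable(2)[OF q abs_mode_shift_damping[OF a] that, of t] that
    by (auto simp: limit_process_def slow_sum_def b_def mult.commute)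
  have meas: "(\<lambda>t. limit_process \<alpha> t \<omega>) \<in> borel_measurable (gamma_distr \<alpha> 1)" for \<omega>
    unfolding borel_measurable_gamma_distr_iff by (rule limit_process_path_measurable)
  have AE_bound: "AE t in gamma_distr \<alpha> 1. \<bar>limit_process \<alpha> t \<omega>\<bar> \<le> b C t" if "\<omega> \<in> slow (damping \<alpha>) C" for \<omega> C
    using bound[OF that] by simp
  have out: "(\<lambda>t. limit_process \<alpha> t \<omega>) = (\<lambda>_. 0)" if "\<omega> \<notin> (\<Union>C. slow (damping \<alpha>) C)" for \<omega>
    using that by (simp add: limit_process_def slow_sum_def)
  show "square_integrable (gamma_distr \<alpha> 1) (\<lambda>t. limit_process \<alpha> t \<omega>)"
    by (rule measurable_L2_real_of_continuous(1)[OF closed_slow meas limit_process_continuous_on_slow AE_bound b out])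
  have "(\<lambda>\<omega>. L2_real (gamma_distr \<alpha> 1) (\<lambda>t. limit_process \<alpha> t \<omega>)) \<in> borel \<rightarrow>\<^sub>M borel_of_topology (L2_topology (gamma_distr \<alpha> 1))"
    by (rule measurable_L2_real_of_continuous(2)[OF closed_slow meas limit_process_continuous_on_slow AE_bound b out])
  then show "(\<lambda>\<omega>. L2_real (gamma_distr \<alpha> 1) (\<lambda>t. limit_process \<alpha> t \<omega>)) \<in> gauss_seq \<rightarrow>\<^sub>M borel_of_topology (L2_topology (gamma_distr \<alpha> 1))"
    by (simp add: measurable_cong_sets[OF sets_gauss_seq refl])
qed

text \<open>
  Applied both to the scores of the sample and to their normal limits.
\<close>

lemma mode_series_tail:
  fixes S :: "'a \<Rightarrow> nat \<Rightarrow> real"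
  assumes "\<And>k. (\<lambda>\<omega>. S \<omega> k) \<in> borel_measurable P" "Y \<in> borel_measurable P"
    and "\<And>j k. integrable P (\<lambda>\<omega>. S \<omega> j * S \<omega> k)"
    and "\<And>j k. (LINT \<omega>|P. S \<omega> j * S \<omega> k) = (if j = k then 1 else 0)"
    and "AE \<omega> in P. (\<lambda>k. mode \<alpha> (k + 2) t * S \<omega> k) sums Y \<omega>"
  shows "(\<integral>\<^sup>+\<omega>. ennreal ((Y \<omega> - (\<Sum>k<K. mode \<alpha> (k + 2) t * S \<omega> k))\<^sup>2) \<partial>P) \<le> ennreal (exp (\<bar>t\<bar> / 2) * mode_tail \<alpha> K)"
proof -
  have "(\<integral>\<^sup>+\<omega>. ennreal ((Y \<omega> - (\<Sum>k<K. mode \<alpha> (k + 2) t * S \<omega> k))\<^sup>2) \<partial>P) \<le> ennreal (\<Sum>k. (mode \<alpha> (k + K + 2) t)\<^sup>2)"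
    by (rule orthonormal_series_tail[OF assms(1-4) summable_mode_square[OF a] assms(5)])
  also have "\<dots> \<le> ennreal (exp (\<bar>t\<bar> / 2) * mode_tail \<alpha> K)"
    by (intro ennreal_leI mode_square_tail_le a)
  finally show ?thesis .
qed

lemma limit_process_tail:
  "(\<integral>\<^sup>+\<omega>. ennreal ((limit_process \<alpha> t \<omega> - (\<Sum>k<K. mode \<alpha> (k + 2) t * \<omega> k))\<^sup>2) \<partial>gauss_seq) \<le> ennreal (exp (\<bar>t\<bar> / 2) * mode_tail \<alpha> K)"
proof (rule mode_series_tail)
  show "limit_process \<alpha> t \<in> borel_measurable gauss_seq" unfolding limit_process_def by simp
  show "AE \<omega> in gauss_seq. (\<lambda>k. mode \<alpha> (k + 2) t * \<omega> k) sums limit_process \<alpha> t \<omega>"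
    using AE_gauss_seq_slow[OF q]
    by eventually_elim (unfold limit_process_def, rule slow_sum_sums[OF q abs_mode_shift_damping[OF a]])
qed (simp_all add: gauss_seq_moments)

end

section \<open>Linearization in the sample mean\<close>

lemma gamma_size_bias:
  assumes a: "\<alpha> > 0" and [measurable]: "f \<in> borel_measurable borel"
  shows "(LINT x|gamma_distr \<alpha> 1. x * f x) = \<alpha> * (LINT x|gamma_distr (\<alpha> + 1) 1. f x)"
proof -
  have d: "gamma_density \<alpha> 1 x * (x * f x) = \<alpha> * (gamma_density (\<alpha> + 1) 1 x * f x)" for x
  proof (cases "x > 0")
    case True
    then have "x powr \<alpha> = x * x powr (\<alpha> - 1)" by (simp add: powr_diff)
    moreover have "Gamma (\<alpha> + 1) = \<alpha> * Gamma \<alpha>" using a by (intro Gamma_plus1) auto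
    ultimately show ?thesis using True a by (simp add: gamma_density_def)
  qed (simp add: gamma_density_def)
  have "(LINT x|gamma_distr \<alpha> 1. x * f x) = (LINT x|lborel. gamma_density \<alpha> 1 x * (x * f x))"
    unfolding gamma_distr_def using gamma_density_nonneg[OF a] by (subst integral_density) auto
  also have "\<dots> = \<alpha> * (LINT x|lborel. gamma_density (\<alpha> + 1) 1 x * f x)"
    unfolding d by simp
  also have "(LINT x|lborel. gamma_density (\<alpha> + 1) 1 x * f x) = (LINT x|gamma_distr (\<alpha> + 1) 1. f x)"
    unfolding gamma_distr_def using gamma_density_nonneg[of "\<alpha> + 1"] a by (subst integral_density) auto
  finally show ?thesis .
qed

lemma borel_measurable_hyp01 [measurable]: "\<alpha> > 0 \<Longrightarrow> hyp01 \<alpha> \<in> borel_measurable borel"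
  by (intro borel_measurable_continuous_onI continuous_on_hyp01)

text \<open>
  Integrating the series term by term, the moment \<open>(\<alpha>)\<^sub>m\<close> cancels against the coefficient
  and leaves the exponential series.
\<close>

lemma gamma_integral_hyp01:
  assumes a: "\<alpha> > 0" and u: "u \<ge> 0"
  shows "(LINT x|gamma_distr \<alpha> 1. hyp01 \<alpha> (u * x)) = exp (- u)"
proof -
  define c where "c m = (- u) ^ m / (fact m * pochhammer \<alpha> m)" for m
  have e: "(- (u * x)) ^ m / (fact m * pochhammer \<alpha> m) = c m * x ^ m" for m x
    by (simp add: c_def power_mult_distrib [symmetric])
  have p: "pochhammer \<alpha> m > 0" for m using a by (rule pochhammer_pos)
  have n: "norm (c m * x ^ m) = u ^ m / (fact m * pochhammer \<alpha> m) * \<bar>x\<bar> ^ m" for m x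
    using u p[of m] by (simp add: c_def abs_mult power_abs)
  have "(\<lambda>m. LINT x|gamma_distr \<alpha> 1. c m * x ^ m) sums (LINT x|gamma_distr \<alpha> 1. (\<Sum>m. c m * x ^ m))"
  proof (rule sums_integral)
    show "integrable (gamma_distr \<alpha> 1) (\<lambda>x. c m * x ^ m)" for m
      by (intro integrable_mult_right gamma_moment a)
    show "AE x in gamma_distr \<alpha> 1. summable (\<lambda>m. norm (c m * x ^ m))"
    proof (rule AE_I2)
      fix x
      show "summable (\<lambda>m. norm (c m * x ^ m))"
        unfolding n using summable_hyp01_abs[OF a, of "u * \<bar>x\<bar>"] by (simp add: power_mult_distrib)
    qed
    have "(LINT x|gamma_distr \<alpha> 1. norm (c m * x ^ m)) = u ^ m / fact m" for m
      unfolding n using p[of m] by (simp add: gamma_moment(3)[OF a])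
    then show "summable (\<lambda>m. LINT x|gamma_distr \<alpha> 1. norm (c m * x ^ m))"
      using summable_exp_generic[of u] by (simp add: divide_inverse mult.commute)
  qed
  moreover have "(\<Sum>m. c m * x ^ m) = hyp01 \<alpha> (u * x)" for x
    unfolding hyp01_def e ..
  moreover have "(LINT x|gamma_distr \<alpha> 1. c m * x ^ m) = (- u) ^ m / fact m" for m
    using p[of m] by (simp add: gamma_moment(2)[OF a] c_def)
  moreover have "(\<lambda>m. (- u) ^ m / fact m) sums exp (- u)"
    using exp_converges[of "- u"] by (simp add: divide_inverse mult.commute)
  ultimately show ?thesis by (simp add: sums_unique2)
qed

lemma hyp01_Taylor:
  assumes a: "\<alpha> \<ge> 1 / 2" and yz: "y \<ge> 0" "z \<ge> 0"
  shows "\<bar>hyp01 \<alpha> y - hyp01 \<alpha> z + (y - z) * hyp01 (\<alpha> + 1) z / \<alpha>\<bar> \<le> (y - z)\<^sup>2 / (2 * \<alpha> * (\<alpha> + 1))"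
proof (cases "y = z")
  case False
  define D where "D m = (if m = 0 then hyp01 \<alpha> else if m = 1 then (\<lambda>x. - hyp01 (\<alpha> + 1) x / \<alpha>)
    else (\<lambda>x. hyp01 (\<alpha> + 2) x / (\<alpha> * (\<alpha> + 1))))" for m :: nat
  have a0: "\<alpha> > 0" using a by simp
  have d0: "(hyp01 \<alpha> has_real_derivative - hyp01 (\<alpha> + 1) x / \<alpha>) (at x)" for x
    by (rule hyp01_deriv[OF a0])
  have d1: "((\<lambda>x. - hyp01 (\<alpha> + 1) x / \<alpha>) has_real_derivative hyp01 (\<alpha> + 2) x / (\<alpha> * (\<alpha> + 1))) (at x)" for x
    using DERIV_cdivide[OF DERIV_minus[OF hyp01_deriv[of "\<alpha> + 1" x]], of \<alpha>] a0
    by (simp add: add.assoc mult.commute)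
  have "\<exists>t. (if y < z then y < t \<and> t < z else z < t \<and> t < y) \<and>
     hyp01 \<alpha> y = (\<Sum>m<2. D m z / fact m * (y - z) ^ m) + D 2 t / fact 2 * (y - z) ^ 2"
  proof (rule Taylor[where a = 0 and b = "max y z"])
    show "\<forall>m t. m < 2 \<and> 0 \<le> t \<and> t \<le> max y z \<longrightarrow> (D m has_real_derivative D (Suc m) t) (at t)"
    proof (intro allI impI)
      fix m :: nat and t assume "m < 2 \<and> 0 \<le> t \<and> t \<le> max y z"
      then have "m = 0 \<or> m = 1" by auto
      then show "(D m has_real_derivative D (Suc m) t) (at t)" using d0 d1 by (auto simp: D_def)
    qed
  qed (use yz False in \<open>auto simp: D_def\<close>)
  then obtain t where t': "if y < z then y < t \<and> t < z else z < t \<and> t < y"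
    and e: "hyp01 \<alpha> y = (\<Sum>m<2. D m z / fact m * (y - z) ^ m) + D 2 t / fact 2 * (y - z) ^ 2"
    by blast
  have t: "t \<ge> 0" using t' yz by (auto split: if_splits)
  have "hyp01 \<alpha> y - hyp01 \<alpha> z + (y - z) * hyp01 (\<alpha> + 1) z / \<alpha> = hyp01 (\<alpha> + 2) t * ((y - z)\<^sup>2 / (2 * \<alpha> * (\<alpha> + 1)))"
    unfolding e by (simp add: D_def numeral_2_eq_2 mult_ac)
  also have "\<bar>\<dots>\<bar> = \<bar>hyp01 (\<alpha> + 2) t\<bar> * ((y - z)\<^sup>2 / (2 * \<alpha> * (\<alpha> + 1)))"
    using a0 by (simp add: abs_mult)
  also have "\<dots> \<le> 1 * ((y - z)\<^sup>2 / (2 * \<alpha> * (\<alpha> + 1)))"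
    using abs_hyp01_le_1[of "\<alpha> + 2" t] a t by (intro mult_right_mono) auto
  finally show ?thesis by simp
qed simp

text \<open>
  What one observation contributes to first order: the centered kernel at \<open>x / \<alpha>\<close>, plus the
  effect of replacing \<open>\<alpha>\<close> by the sample mean. The factor of \<open>x - \<alpha>\<close> is the derivative of
  \<open>exp (- t / m)\<close> with respect to \<open>m\<close> at \<open>m = \<alpha>\<close>.
\<close>

definition linearized :: "real \<Rightarrow> real \<Rightarrow> real \<Rightarrow> real" where
  "linearized \<alpha> t x = hyp01 \<alpha> (t * x / \<alpha>) - exp (- t / \<alpha>) + t / \<alpha>\<^sup>2 * exp (- t / \<alpha>) * (x - \<alpha>)"

text \<open>
  The derivative in \<open>t\<close> of \<open>H (t x / \<alpha>) - exp (- t / \<alpha>)\<close>. It has mean 0, because the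
  function itself has mean 0 for every \<open>t\<close>.
\<close>

definition slope :: "real \<Rightarrow> real \<Rightarrow> real \<Rightarrow> real" where
  "slope \<alpha> t x = - (x * hyp01 (\<alpha> + 1) (t * x / \<alpha>) / \<alpha>\<^sup>2) + exp (- t / \<alpha>) / \<alpha>"

text \<open>
  The terms \<open>k = 0\<close> and \<open>k = 1\<close> of the Laguerre expansion are exactly what is subtracted in
  \<open>linearized\<close>.
\<close>

lemma linearized_sums:
  assumes a: "\<alpha> > 0" and t: "t \<ge> 0"
  shows "(\<lambda>k. mode \<alpha> (k + 2) t * laguerre_n \<alpha> (k + 2) x) sums linearized \<alpha> t x"
proof -
  have "(\<lambda>k. mode \<alpha> (k + 2) t * laguerre_n \<alpha> (k + 2) x) sums (hyp01 \<alpha> (t * x / \<alpha>) - (\<Sum>k<2. mode \<alpha> k t * laguerre_n \<alpha> k x))"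
    by (rule sums_split_initial_segment[OF laguerre_expansion[OF assms]])
  also have "(\<Sum>k<2. mode \<alpha> k t * laguerre_n \<alpha> k x) = exp (- t / \<alpha>) + exp (- t / \<alpha>) * (t / \<alpha>) * (1 - x / \<alpha>)"
    using a t by (simp add: numeral_2_eq_2 mode_def laguerre_n_1)
  also have "hyp01 \<alpha> (t * x / \<alpha>) - (exp (- t / \<alpha>) + exp (- t / \<alpha>) * (t / \<alpha>) * (1 - x / \<alpha>)) = linearized \<alpha> t x"
  proof -
    have "- ((t / \<alpha>) * (1 - x / \<alpha>)) = t / \<alpha>\<^sup>2 * (x - \<alpha>)"
      using a by (simp add: field_simps power2_eq_square)
    then have "exp (- t / \<alpha>) * - ((t / \<alpha>) * (1 - x / \<alpha>)) = exp (- t / \<alpha>) * (t / \<alpha>\<^sup>2 * (x - \<alpha>))"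
      by (simp only:)
    then have "- (exp (- t / \<alpha>) * (t / \<alpha>) * (1 - x / \<alpha>)) = t / \<alpha>\<^sup>2 * exp (- t / \<alpha>) * (x - \<alpha>)"
      by (simp only: mult_minus_right mult_ac)
    then show ?thesis unfolding linearized_def by linarith
  qed
  finally show ?thesis .
qed

definition remainder_const :: "real \<Rightarrow> real" where
  "remainder_const \<alpha> = (4 / \<alpha>\<^sup>2 / (\<alpha>\<^sup>2 * (2 * \<alpha> * (\<alpha> + 1))))\<^sup>2"

text \<open>
  Dividing by \<open>m\<close> instead of \<open>\<alpha>\<close> amounts to moving the time from \<open>t\<close> to \<open>s = t \<alpha> / m\<close>.
  Taylor's formula in time leaves three errors: the quadratic remainder, the increment
  \<open>s - t\<close> times the normalized sum of slopes, and the difference between \<open>s - t\<close> and its own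
  linearization in \<open>m\<close>. The slopes have mean 0, so their normalized sum is bounded in mean
  square, and every error is small once \<open>\<delta>\<close> and \<open>n \<delta>\<^sup>4\<close> are.
\<close>

lemma linearization_error:
  fixes x :: "nat \<Rightarrow> real"
  assumes a: "\<alpha> \<ge> 1 / 2" and n: "n \<ge> 1" and x: "\<And>j. j \<in> {1..n} \<Longrightarrow> x j > 0"
    and m: "m = (\<Sum>j=1..n. x j) / n" and \<delta>: "\<bar>m - \<alpha>\<bar> \<le> \<delta>" "\<delta> \<le> \<alpha> / 2" and t: "t \<ge> 0"
  shows "((\<Sum>j=1..n. hyp01 \<alpha> (t * (x j / m)) - exp (- t / \<alpha>)) / sqrt n - (\<Sum>j=1..n. linearized \<alpha> t (x j)) / sqrt n)\<^sup>2
    \<le> 3 * (4 * t\<^sup>2 * \<delta>\<^sup>2 / \<alpha>\<^sup>2 * ((\<Sum>j=1..n. slope \<alpha> t (x j)) / sqrt n)\<^sup>2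
      + remainder_const \<alpha> * t ^ 4 * \<delta> ^ 4 * (\<Sum>j=1..n. (x j) ^ 4)
      + 4 * real n * t\<^sup>2 * \<delta> ^ 4 / \<alpha> ^ 6)"
proof -
  have a0: "\<alpha> > 0" using a by simp
  have m0: "m \<ge> \<alpha> / 2" using \<delta> by linarith
  then have mp: "m > 0" using a0 by linarith
  have d0: "\<delta> \<ge> 0" using \<delta> by linarith
  have sn: "sqrt n > 0" using n by simp
  define s where "s = t * \<alpha> / m"
  define h where "h = s - t"
  define E where "E = exp (- t / \<alpha>)"
  define r where "r j = hyp01 \<alpha> (s * x j / \<alpha>) - hyp01 \<alpha> (t * x j / \<alpha>) + h * x j / \<alpha> * hyp01 (\<alpha> + 1) (t * x j / \<alpha>) / \<alpha>" for j
  have s0: "s \<ge> 0" using t mp a0 by (simp add: s_def)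
  have sx: "t * (x j / m) = s * x j / \<alpha>" for j using a0 by (simp add: s_def)
  have nm: "(\<Sum>j=1..n. x j) = n * m" using n by (simp add: m)
  have hid: "h / \<alpha> + t * (m - \<alpha>) / \<alpha>\<^sup>2 = t * (m - \<alpha>)\<^sup>2 / (\<alpha>\<^sup>2 * m)"
    using a0 mp by (simp add: h_def s_def field_simps power2_eq_square)
  have habs: "\<bar>h\<bar> \<le> 2 * t * \<delta> / \<alpha>"
  proof -
    have "h = t * (\<alpha> - m) / m" using mp by (simp add: h_def s_def field_simps)
    then have "\<bar>h\<bar> = t * \<bar>m - \<alpha>\<bar> / m" using t mp by (simp add: abs_mult abs_minus_commute)
    also have "\<dots> \<le> t * \<delta> / (\<alpha> / 2)"
      using t m0 mp a0 \<delta> by (intro frac_le mult_left_mono mult_nonneg_nonneg d0) auto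
    finally show ?thesis by (simp add: mult_ac)
  qed
  \<comment> \<open>After summation the last two terms cancel to first order in \<open>m - \<alpha>\<close>. By \<open>hid\<close> a quadratic error remains.\<close>
  have summand: "(hyp01 \<alpha> (t * (x j / m)) - E) - linearized \<alpha> t (x j) = r j + h * slope \<alpha> t (x j) - h / \<alpha> * E - t / \<alpha>\<^sup>2 * E * (x j - \<alpha>)" for j
    unfolding sx r_def slope_def linearized_def E_def[symmetric] using a0
    by (simp add: algebra_simps power2_eq_square)
  have "(\<Sum>j=1..n. hyp01 \<alpha> (t * (x j / m)) - E) - (\<Sum>j=1..n. linearized \<alpha> t (x j))
    = (\<Sum>j=1..n. r j) + h * (\<Sum>j=1..n. slope \<alpha> t (x j)) - real n * (h / \<alpha> * E) - t / \<alpha>\<^sup>2 * E * ((\<Sum>j=1..n. x j) - real n * \<alpha>)"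
    unfolding sum_subtractf[symmetric] summand
    by (simp only: sum.distrib sum_subtractf sum_distrib_left[symmetric]) simp
  also have "\<dots> = (\<Sum>j=1..n. r j) + h * (\<Sum>j=1..n. slope \<alpha> t (x j)) - real n * E * (h / \<alpha> + t * (m - \<alpha>) / \<alpha>\<^sup>2)"
    unfolding nm by (simp add: algebra_simps)
  finally have main: "(\<Sum>j=1..n. hyp01 \<alpha> (t * (x j / m)) - E) - (\<Sum>j=1..n. linearized \<alpha> t (x j))
    = (\<Sum>j=1..n. r j) + h * (\<Sum>j=1..n. slope \<alpha> t (x j)) - real n * E * (t * (m - \<alpha>)\<^sup>2 / (\<alpha>\<^sup>2 * m))"
    unfolding hid .
  define A1 where "A1 = (\<Sum>j=1..n. r j) / sqrt n"
  define A2 where "A2 = h * ((\<Sum>j=1..n. slope \<alpha> t (x j)) / sqrt n)"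
  define A3 where "A3 = sqrt n * E * (t * (m - \<alpha>)\<^sup>2 / (\<alpha>\<^sup>2 * m))"
  have nq: "real n / sqrt n = sqrt n" by (simp add: real_div_sqrt)
  have split_quotient: "(p + h * c - N * E * d) / z = p / z + h * (c / z) - N / z * E * d" for p c N d z :: real
    by (simp add: add_divide_distrib diff_divide_distrib)
  have "(\<Sum>j=1..n. hyp01 \<alpha> (t * (x j / m)) - E) / sqrt n - (\<Sum>j=1..n. linearized \<alpha> t (x j)) / sqrt n = A1 + A2 - A3"
    unfolding diff_divide_distrib[symmetric] main A1_def A2_def A3_def split_quotient nq ..
  moreover have sq: "(A1 + A2 - A3)\<^sup>2 \<le> 3 * (A2\<^sup>2 + A1\<^sup>2 + A3\<^sup>2)"
  proof -
    have "0 \<le> (A1 - A2)\<^sup>2 + (A1 + A3)\<^sup>2 + (A2 + A3)\<^sup>2" by simp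
    then show ?thesis by (simp add: power2_eq_square algebra_simps)
  qed
  moreover have b2: "A2\<^sup>2 \<le> 4 * t\<^sup>2 * \<delta>\<^sup>2 / \<alpha>\<^sup>2 * ((\<Sum>j=1..n. slope \<alpha> t (x j)) / sqrt n)\<^sup>2"
  proof -
    have "\<bar>h\<bar>\<^sup>2 \<le> (2 * t * \<delta> / \<alpha>)\<^sup>2" using habs by (intro power_mono) auto
    then have "h\<^sup>2 \<le> 4 * t\<^sup>2 * \<delta>\<^sup>2 / \<alpha>\<^sup>2" by (simp add: power_mult_distrib power_divide)
    then show ?thesis unfolding A2_def power_mult_distrib by (intro mult_right_mono) auto
  qed
  moreover have b1: "A1\<^sup>2 \<le> remainder_const \<alpha> * t ^ 4 * \<delta> ^ 4 * (\<Sum>j=1..n. (x j) ^ 4)"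
  proof -
    have r: "(r j)\<^sup>2 \<le> remainder_const \<alpha> * t ^ 4 * \<delta> ^ 4 * (x j) ^ 4" if j: "j \<in> {1..n}" for j
    proof -
      have "(s * x j / \<alpha> - t * x j / \<alpha>) = h * x j / \<alpha>" by (simp add: h_def left_diff_distrib diff_divide_distrib)
      then have "\<bar>r j\<bar> \<le> (h * x j / \<alpha>)\<^sup>2 / (2 * \<alpha> * (\<alpha> + 1))"
        using hyp01_Taylor[OF a, of "s * x j / \<alpha>" "t * x j / \<alpha>"] s0 t x[OF j] a0 by (simp add: r_def)
      also have "\<dots> = \<bar>h\<bar>\<^sup>2 * ((x j)\<^sup>2 / (\<alpha>\<^sup>2 * (2 * \<alpha> * (\<alpha> + 1))))" by (simp add: power_mult_distrib power_divide)
      also have "\<dots> \<le> (2 * t * \<delta> / \<alpha>)\<^sup>2 * ((x j)\<^sup>2 / (\<alpha>\<^sup>2 * (2 * \<alpha> * (\<alpha> + 1))))"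
        using habs a0 by (intro mult_right_mono power_mono) auto
      also have "\<dots> = (4 / \<alpha>\<^sup>2 / (\<alpha>\<^sup>2 * (2 * \<alpha> * (\<alpha> + 1)))) * (t\<^sup>2 * \<delta>\<^sup>2 * (x j)\<^sup>2)"
        by (simp add: power_mult_distrib power_divide)
      finally have "\<bar>r j\<bar>\<^sup>2 \<le> ((4 / \<alpha>\<^sup>2 / (\<alpha>\<^sup>2 * (2 * \<alpha> * (\<alpha> + 1)))) * (t\<^sup>2 * \<delta>\<^sup>2 * (x j)\<^sup>2))\<^sup>2"
        by (intro power_mono) auto
      also have "\<dots> = remainder_const \<alpha> * (t\<^sup>2 * \<delta>\<^sup>2 * (x j)\<^sup>2)\<^sup>2"
        unfolding remainder_const_def by (rule power_mult_distrib)
      also have "(t\<^sup>2 * \<delta>\<^sup>2 * (x j)\<^sup>2)\<^sup>2 = t ^ 4 * \<delta> ^ 4 * (x j) ^ 4"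
        by (simp add: power_mult_distrib flip: power_mult)
      finally show ?thesis by (simp add: mult.assoc)
    qed
    have "A1\<^sup>2 = (\<Sum>j=1..n. r j)\<^sup>2 / n" by (simp add: A1_def power_divide)
    also have "\<dots> \<le> ((\<Sum>j=1..n. (r j)\<^sup>2) * card {1..n}) / n"
      by (intro divide_right_mono sum_squared_le_sum_of_squares) auto
    also have "\<dots> = (\<Sum>j=1..n. (r j)\<^sup>2)" using n by simp
    also have "\<dots> \<le> (\<Sum>j=1..n. remainder_const \<alpha> * t ^ 4 * \<delta> ^ 4 * (x j) ^ 4)" by (intro sum_mono r)
    finally show ?thesis by (simp add: sum_distrib_left)
  qed
  moreover have b3: "A3\<^sup>2 \<le> 4 * real n * t\<^sup>2 * \<delta> ^ 4 / \<alpha> ^ 6"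
  proof -
    have "(m - \<alpha>)\<^sup>2 \<le> \<delta>\<^sup>2" using \<delta>(1) d0 by (simp add: abs_le_square_iff[symmetric])
    moreover have "E \<le> 1" using t a0 by (simp add: E_def)
    ultimately have "E * (t * (m - \<alpha>)\<^sup>2 / (\<alpha>\<^sup>2 * m)) \<le> 1 * (t * \<delta>\<^sup>2 / (\<alpha>\<^sup>2 * (\<alpha> / 2)))"
      using t mp m0 a0 by (intro mult_mono frac_le mult_left_mono) (auto simp: E_def)
    also have "\<dots> = 2 * t * \<delta>\<^sup>2 / \<alpha> ^ 3" by (simp add: power2_eq_square power3_eq_cube)
    finally have "sqrt n * (E * (t * (m - \<alpha>)\<^sup>2 / (\<alpha>\<^sup>2 * m))) \<le> sqrt n * (2 * t * \<delta>\<^sup>2 / \<alpha> ^ 3)"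
      by (intro mult_left_mono) auto
    then have "A3 \<le> sqrt n * (2 * t * \<delta>\<^sup>2 / \<alpha> ^ 3)" by (simp add: A3_def mult.assoc)
    moreover have "A3 \<ge> 0" using t mp by (simp add: A3_def E_def)
    ultimately have "A3\<^sup>2 \<le> (sqrt n * (2 * t * \<delta>\<^sup>2 / \<alpha> ^ 3))\<^sup>2" by (intro power_mono)
    also have "\<dots> = 4 * real n * t\<^sup>2 * \<delta> ^ 4 / \<alpha> ^ 6"
      by (simp add: power_mult_distrib power_divide flip: power_mult)
    finally show ?thesis .
  qed
  ultimately show ?thesis
    unfolding E_def[symmetric] by (simp only:) (rule order_trans[OF sq], intro mult_left_mono add_mono b1 b2 b3, simp)
qed

definition slope_const :: "real \<Rightarrow> real" where
  "slope_const \<alpha> = 2 * (\<alpha> * (\<alpha> + 1)) / \<alpha> ^ 4 + 2 / \<alpha>\<^sup>2"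

lemma borel_measurable_slope [measurable]: "\<alpha> > 0 \<Longrightarrow> slope \<alpha> t \<in> borel_measurable borel"
  unfolding slope_def[abs_def] by measurable

text \<open>
  The mean vanishes by \<open>gamma_integral_hyp01\<close> at the parameter \<open>\<alpha> + 1\<close>, since the factor \<open>x\<close>
  shifts the shape parameter by 1.
\<close>

lemma slope_moments:
  assumes a: "\<alpha> \<ge> 1 / 2" and t: "t \<ge> 0"
  shows "integrable (gamma_distr \<alpha> 1) (slope \<alpha> t)"
    and "(LINT x|gamma_distr \<alpha> 1. slope \<alpha> t x) = 0"
    and "integrable (gamma_distr \<alpha> 1) (\<lambda>x. (slope \<alpha> t x)\<^sup>2)"
    and "(LINT x|gamma_distr \<alpha> 1. (slope \<alpha> t x)\<^sup>2) \<le> slope_const \<alpha>"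
proof -
  have a0: "\<alpha> > 0" using a by simp
  interpret P: prob_space "gamma_distr \<alpha> 1" using a0 by (rule prob_space_gamma_distr)
  have pU: "P.prob UNIV = 1" using P.prob_space by simp
  have [measurable]: "slope \<alpha> t \<in> borel_measurable borel" "hyp01 (\<alpha> + 1) \<in> borel_measurable borel"
    using a0 by auto
  have hb: "AE x in gamma_distr \<alpha> 1. \<bar>x * hyp01 (\<alpha> + 1) (t * x / \<alpha>)\<bar> \<le> \<bar>x\<bar>"
    using AE_gamma_distr_pos[of \<alpha> 1]
  proof eventually_elim
    case (elim x)
    have "\<bar>hyp01 (\<alpha> + 1) (t * x / \<alpha>)\<bar> \<le> 1" using elim a t by (intro abs_hyp01_le_1) auto
    then show ?case using mult_left_mono[of "\<bar>hyp01 (\<alpha> + 1) (t * x / \<alpha>)\<bar>" 1 "\<bar>x\<bar>"] by (simp add: abs_mult)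
  qed
  have i1: "integrable (gamma_distr \<alpha> 1) (\<lambda>x. x * hyp01 (\<alpha> + 1) (t * x / \<alpha>))"
  proof (rule Bochner_Integration.integrable_bound)
    show "integrable (gamma_distr \<alpha> 1) (\<lambda>x. x)" using gamma_moment(1)[OF a0, of 1] by simp
  qed (use hb in \<open>auto simp: borel_measurable_gamma_distr_iff\<close>)
  show "integrable (gamma_distr \<alpha> 1) (slope \<alpha> t)"
    unfolding slope_def[abs_def] by (intro Bochner_Integration.integrable_add integrable_minus integrable_divide i1) auto
  have "(LINT x|gamma_distr \<alpha> 1. x * hyp01 (\<alpha> + 1) (t * x / \<alpha>)) = \<alpha> * exp (- t / \<alpha>)"
    using gamma_integral_hyp01[of "\<alpha> + 1" "t / \<alpha>"] a0 t
    by (subst gamma_size_bias[OF a0]) auto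
  then show "(LINT x|gamma_distr \<alpha> 1. slope \<alpha> t x) = 0"
    unfolding slope_def[abs_def] using i1 a0 by (simp add: pU power2_eq_square)
  have i2: "integrable (gamma_distr \<alpha> 1) (\<lambda>x. 2 * x\<^sup>2 / \<alpha> ^ 4 + 2 / \<alpha>\<^sup>2)"
    using gamma_moment(1)[OF a0, of 2] by auto
  have b: "AE x in gamma_distr \<alpha> 1. (slope \<alpha> t x)\<^sup>2 \<le> 2 * x\<^sup>2 / \<alpha> ^ 4 + 2 / \<alpha>\<^sup>2"
    using hb
  proof eventually_elim
    case (elim x)
    define u where "u = x * hyp01 (\<alpha> + 1) (t * x / \<alpha>)"
    have u: "u\<^sup>2 \<le> x\<^sup>2" using elim by (simp add: u_def abs_le_square_iff)
    have E: "(exp (- t / \<alpha>))\<^sup>2 \<le> 1\<^sup>2" using t a0 by (intro power_mono) auto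
    have "(slope \<alpha> t x)\<^sup>2 = (- (u / \<alpha>\<^sup>2) + exp (- t / \<alpha>) / \<alpha>)\<^sup>2" by (simp add: slope_def u_def)
    also have "\<dots> \<le> 2 * (u / \<alpha>\<^sup>2)\<^sup>2 + 2 * (exp (- t / \<alpha>) / \<alpha>)\<^sup>2"
    proof -
      have "(- p + q)\<^sup>2 \<le> 2 * p\<^sup>2 + 2 * q\<^sup>2" for p q :: real
        using zero_le_power2[of "p + q"] by (simp add: power2_eq_square algebra_simps)
      then show ?thesis .
    qed
    also have "\<dots> = 2 * u\<^sup>2 / \<alpha> ^ 4 + 2 * (exp (- t / \<alpha>))\<^sup>2 / \<alpha>\<^sup>2"
      by (simp add: power_divide flip: power_mult)
    also have "\<dots> \<le> 2 * x\<^sup>2 / \<alpha> ^ 4 + 2 * 1 / \<alpha>\<^sup>2"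
      using u E by (intro add_mono divide_right_mono mult_left_mono) auto
    finally show ?case by simp
  qed
  show i3: "integrable (gamma_distr \<alpha> 1) (\<lambda>x. (slope \<alpha> t x)\<^sup>2)"
  proof (rule Bochner_Integration.integrable_bound[OF i2])
    show "AE x in gamma_distr \<alpha> 1. norm ((slope \<alpha> t x)\<^sup>2) \<le> norm (2 * x\<^sup>2 / \<alpha> ^ 4 + 2 / \<alpha>\<^sup>2)"
      using b by eventually_elim simp
  qed (unfold borel_measurable_gamma_distr_iff, measurable)
  have "(LINT x|gamma_distr \<alpha> 1. (slope \<alpha> t x)\<^sup>2) \<le> (LINT x|gamma_distr \<alpha> 1. 2 * x\<^sup>2 / \<alpha> ^ 4 + 2 / \<alpha>\<^sup>2)"
    by (intro integral_mono_AE i2 i3 b)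
  also have "\<dots> = slope_const \<alpha>"
    using gamma_moment(1,2)[OF a0, of 2] by (simp add: pU slope_const_def numeral_2_eq_2 pochhammer_Suc)
  finally show "(LINT x|gamma_distr \<alpha> 1. (slope \<alpha> t x)\<^sup>2) \<le> slope_const \<alpha>" .
qed

section \<open>The scores of a Gamma sample\<close>

text \<open>
  The observations are numbered from 1, the central limit theorem numbers its variables from
  0.
\<close>

lemma (in prob_space) indep_vars_Suc:
  assumes "indep_vars (\<lambda>_. N) X {1..}"
  shows "indep_vars (\<lambda>_. N) (\<lambda>i. X (Suc i)) UNIV"
  unfolding indep_vars_def2
proof (intro conjI ballI)
  show "random_variable N (X (Suc i))" for i
    using assms by (auto simp: indep_vars_def2)
  have ind: "indep_sets (\<lambda>i. {X i -` A \<inter> space M |A. A \<in> sets N}) {1..}"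
    using assms by (simp add: indep_vars_def2)
  show "indep_sets (\<lambda>i. {X (Suc i) -` A \<inter> space M |A. A \<in> sets N}) UNIV"
  proof (rule indep_setsI)
    show "{X (Suc i) -` A \<inter> space M |A. A \<in> sets N} \<subseteq> events" for i
      using ind by (auto simp: indep_sets_def)
    fix A J assume J: "J \<noteq> {}" "finite (J :: nat set)" and A: "\<forall>j\<in>J. A j \<in> {X (Suc j) -` A \<inter> space M |A. A \<in> sets N}"
    have "prob (\<Inter>j\<in>Suc ` J. A (j - 1)) = (\<Prod>j\<in>Suc ` J. prob (A (j - 1)))"
      by (rule indep_setsD[OF ind]) (use J A in auto)
    then show "prob (\<Inter>j\<in>J. A j) = (\<Prod>j\<in>J. prob (A j))"
      by (simp add: prod.reindex image_image)
  qed
qed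

lemma cos_conv_iexp: "cos (A + c) = Re (iexp c * iexp A)"
proof -
  have "iexp c * iexp A = iexp (A + c)"
    by (simp add: exp_add [symmetric] distrib_left add.commute)
  then show ?thesis by (simp only: Re_exp) simp
qed

locale gamma_sample = prob_space M for M :: "'a measure" +
  fixes \<alpha> :: real and X :: "nat \<Rightarrow> 'a \<Rightarrow> real"
  assumes \<alpha>: "\<alpha> \<ge> 1 / 2"
    and indep: "indep_vars (\<lambda>_. borel) X {1..}"
    and distr_X: "\<And>j. j \<ge> 1 \<Longrightarrow> distr M borel (X j) = gamma_distr \<alpha> 1"
begin

lemma \<alpha>_pos: "\<alpha> > 0" using \<alpha> by simp

sublocale P0: prob_space "gamma_distr \<alpha> 1"
  using \<alpha>_pos by (rule prob_space_gamma_distr)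

lemma X_measurable: "j \<ge> 1 \<Longrightarrow> X j \<in> borel_measurable M"
  using indep by (auto simp: indep_vars_def2)

lemma expectation_X:
  fixes f :: "real \<Rightarrow> 'b :: {banach, second_countable_topology}"
  assumes f: "f \<in> borel_measurable borel" and j: "j \<ge> 1"
  shows "(LINT \<omega>|M. f (X j \<omega>)) = integral\<^sup>L (gamma_distr \<alpha> 1) f"
    and "integrable M (\<lambda>\<omega>. f (X j \<omega>)) \<longleftrightarrow> integrable (gamma_distr \<alpha> 1) f"
  using integral_distr[OF X_measurable[OF j] f] integrable_distr_eq[OF X_measurable[OF j] f] distr_X[OF j]
  by auto

lemma AE_X:
  assumes j: "j \<ge> 1" and Q: "AE x in gamma_distr \<alpha> 1. Q x"
  shows "AE \<omega> in M. Q (X j \<omega>)"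
proof -
  have "AE x in distr M borel (X j). Q x" unfolding distr_X[OF j] by (rule Q)
  then show ?thesis by (rule AE_distrD[OF X_measurable[OF j]])
qed

lemma sum_product_moment:
  fixes f g :: "real \<Rightarrow> real"
  assumes [measurable]: "f \<in> borel_measurable borel" "g \<in> borel_measurable borel"
    and int: "integrable (gamma_distr \<alpha> 1) f" "integrable (gamma_distr \<alpha> 1) g" "integrable (gamma_distr \<alpha> 1) (\<lambda>x. f x * g x)"
    and mean: "(LINT x|gamma_distr \<alpha> 1. f x) = 0" "(LINT x|gamma_distr \<alpha> 1. g x) = 0"
  shows "integrable M (\<lambda>\<omega>. (\<Sum>j=1..n. f (X j \<omega>)) * (\<Sum>j=1..n. g (X j \<omega>)))"
    and "expectation (\<lambda>\<omega>. (\<Sum>j=1..n. f (X j \<omega>)) * (\<Sum>j=1..n. g (X j \<omega>))) = real n * (LINT x|gamma_distr \<alpha> 1. f x * g x)"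
proof -
  have fg: "(\<lambda>x. f x * g x) \<in> borel_measurable borel" by measurable
  have *: "integrable M (\<lambda>\<omega>. f (X i \<omega>) * g (X j \<omega>)) \<and>
      expectation (\<lambda>\<omega>. f (X i \<omega>) * g (X j \<omega>)) = (if i = j then LINT x|gamma_distr \<alpha> 1. f x * g x else 0)"
    if ij: "i \<ge> 1" "j \<ge> 1" for i j
  proof (cases "i = j")
    case True
    then show ?thesis using expectation_X[OF fg ij(1)] int by simp
  next
    case False
    have "integrable M (\<lambda>\<omega>. f (X i \<omega>))" "integrable M (\<lambda>\<omega>. g (X j \<omega>))"
      using ij int by (simp_all add: expectation_X)
    then show ?thesis
      using indep_vars_product_of_functions[OF indep, of i j f g] ij False mean by (simp add: expectation_X)
  qed
  have e: "(\<Sum>j=1..n. f (X j \<omega>)) * (\<Sum>j=1..n. g (X j \<omega>)) = (\<Sum>i=1..n. \<Sum>j=1..n. f (X i \<omega>) * g (X j \<omega>))" for \<omega>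
    by (rule sum_product)
  show "integrable M (\<lambda>\<omega>. (\<Sum>j=1..n. f (X j \<omega>)) * (\<Sum>j=1..n. g (X j \<omega>)))"
    unfolding e using * by (intro Bochner_Integration.integrable_sum) auto
  have "expectation (\<lambda>\<omega>. (\<Sum>j=1..n. f (X j \<omega>)) * (\<Sum>j=1..n. g (X j \<omega>)))
    = (\<Sum>i=1..n. \<Sum>j=1..n. if i = j then LINT x|gamma_distr \<alpha> 1. f x * g x else 0)"
    unfolding e using * by (subst Bochner_Integration.integral_sum, force intro!: Bochner_Integration.integrable_sum)
      (intro sum.cong refl, subst Bochner_Integration.integral_sum, auto)
  also have "\<dots> = (\<Sum>i=1..n. LINT x|gamma_distr \<alpha> 1. f x * g x)"
    by (intro sum.cong refl) (simp add: sum.delta)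
  finally show "expectation (\<lambda>\<omega>. (\<Sum>j=1..n. f (X j \<omega>)) * (\<Sum>j=1..n. g (X j \<omega>))) = real n * (LINT x|gamma_distr \<alpha> 1. f x * g x)"
    by simp
qed

text \<open>
  The random coefficient of the mode with index \<open>k + 2\<close>.
\<close>

definition score :: "nat \<Rightarrow> 'a \<Rightarrow> nat \<Rightarrow> real" where
  "score n \<omega> k = (\<Sum>j=1..n. laguerre_n \<alpha> (k + 2) (X j \<omega>)) / sqrt n"

lemma score_measurable: "(\<lambda>\<omega>. score n \<omega> k) \<in> borel_measurable M"
  unfolding score_def by (auto intro!: borel_measurable_divide borel_measurable_sum measurable_compose[OF X_measurable])

lemma score_moments:
  "integrable M (\<lambda>\<omega>. score n \<omega> j * score n \<omega> k)"
  "n \<ge> 1 \<Longrightarrow> expectation (\<lambda>\<omega>. score n \<omega> j * score n \<omega> k) = (if j = k then 1 else 0)"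
proof -
  have e: "score n \<omega> j * score n \<omega> k =
    ((\<Sum>i=1..n. laguerre_n \<alpha> (j + 2) (X i \<omega>)) * (\<Sum>i=1..n. laguerre_n \<alpha> (k + 2) (X i \<omega>))) / n" for \<omega>
    unfolding score_def by simp
  note m = sum_product_moment[OF borel_measurable_laguerre_n borel_measurable_laguerre_n
      laguerre_n_integral(1)[OF \<alpha>_pos] laguerre_n_integral(1)[OF \<alpha>_pos] laguerre_n_orthonormal(1)[OF \<alpha>_pos]
      laguerre_n_integral(2)[OF \<alpha>_pos] laguerre_n_integral(2)[OF \<alpha>_pos], of "j + 2" "k + 2" n]
  show "integrable M (\<lambda>\<omega>. score n \<omega> j * score n \<omega> k)"
    unfolding e by (intro integrable_divide m(1)) auto
  assume "n \<ge> 1"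
  then show "expectation (\<lambda>\<omega>. score n \<omega> j * score n \<omega> k) = (if j = k then 1 else 0)"
    unfolding e using m(2) laguerre_n_orthonormal(2)[OF \<alpha>_pos] by simp
qed

lemma score_second_moment:
  "integrable M (\<lambda>\<omega>. (score n \<omega> k)\<^sup>2)" "expectation (\<lambda>\<omega>. (score n \<omega> k)\<^sup>2) \<le> 1"
proof -
  show "integrable M (\<lambda>\<omega>. (score n \<omega> k)\<^sup>2)"
    using score_moments(1)[of n k k] by (simp add: power2_eq_square)
  show "expectation (\<lambda>\<omega>. (score n \<omega> k)\<^sup>2) \<le> 1"
  proof (cases "n \<ge> 1")
    case True
    then show ?thesis using score_moments(2)[of n k k] by (simp add: power2_eq_square)
  qed (simp add: score_def not_le)
qed

text \<open>
  The central limit theorem, evaluated at the argument \<open>\<sigma>\<close> of the characteristic function to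
  undo the normalization of the variance. The degenerate case \<open>v = 0\<close> is separate.
\<close>

lemma normalized_sum_char_tendsto:
  fixes f :: "real \<Rightarrow> real"
  assumes [measurable]: "f \<in> borel_measurable borel"
    and int: "integrable (gamma_distr \<alpha> 1) f" "integrable (gamma_distr \<alpha> 1) (\<lambda>x. (f x)\<^sup>2)"
    and mean: "(LINT x|gamma_distr \<alpha> 1. f x) = 0" and var: "(LINT x|gamma_distr \<alpha> 1. (f x)\<^sup>2) = v"
  shows "(\<lambda>n. CLINT \<omega>|M. iexp ((\<Sum>j=1..n. f (X j \<omega>)) / sqrt n)) \<longlonglongrightarrow> complex_of_real (exp (- v / 2))"
proof (cases "v = 0")
  case True
  then have "AE x in gamma_distr \<alpha> 1. (f x)\<^sup>2 = 0"
    using integral_nonneg_eq_0_iff_AE[OF int(2)] var by simp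
  then have f0: "AE x in gamma_distr \<alpha> 1. f x = 0" by simp
  have "AE \<omega> in M. f (X j \<omega>) = 0" if "j \<ge> 1" for j
    by (rule AE_X[OF that f0])
  then have all0: "AE \<omega> in M. \<forall>j\<in>{1..n}. f (X j \<omega>) = 0" for n
    by (intro AE_finite_allI) auto
  have "(CLINT \<omega>|M. iexp ((\<Sum>j=1..n. f (X j \<omega>)) / sqrt n)) = (CLINT \<omega>|M. 1)" for n
  proof (rule integral_cong_AE)
    have [measurable]: "(\<lambda>\<omega>. \<Sum>j=1..n. f (X j \<omega>)) \<in> borel_measurable M"
      by (intro borel_measurable_sum measurable_compose[OF X_measurable]) auto
    show "(\<lambda>\<omega>. iexp ((\<Sum>j=1..n. f (X j \<omega>)) / sqrt n)) \<in> borel_measurable M" by measurable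
    show "AE \<omega> in M. iexp ((\<Sum>j=1..n. f (X j \<omega>)) / sqrt n) = 1"
      using all0[of n]
    proof eventually_elim
      case (elim \<omega>)
      then have "(\<Sum>j=1..n. f (X j \<omega>)) = 0" by (intro sum.neutral)
      then show ?case by (simp only: div_0 of_real_0 mult_zero_right exp_zero)
    qed
  qed auto
  then show ?thesis using True by (simp add: prob_space)
next
  case False
  have "v \<ge> 0" unfolding var[symmetric] by simp
  with False have v: "v > 0" by simp
  define \<sigma> where "\<sigma> = sqrt v"
  have \<sigma>: "\<sigma> > 0" "\<sigma>\<^sup>2 = v" using v by (simp_all add: \<sigma>_def)
  define Y where "Y i \<omega> = f (X (Suc i) \<omega>)" for i \<omega>
  have Ym [measurable]: "Y i \<in> borel_measurable M" for i
    unfolding Y_def[abs_def] by (rule measurable_compose[OF X_measurable]) auto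
  have f2: "(\<lambda>x. (f x)\<^sup>2) \<in> borel_measurable borel" by measurable
  have "weak_conv_m (\<lambda>n. distr M borel (\<lambda>\<omega>. (\<Sum>i<n. Y i \<omega>) / sqrt (n * \<sigma>\<^sup>2))) std_normal_distribution"
  proof (rule central_limit_theorem_zero_mean)
    show "indep_vars (\<lambda>i. borel) Y UNIV"
      unfolding Y_def[abs_def] by (rule indep_vars_compose2[OF indep_vars_Suc[OF indep]]) auto
    show "expectation (Y n) = 0" for n
      unfolding Y_def[abs_def] using expectation_X(1)[of f "Suc n"] mean by simp
    moreover show "integrable M (\<lambda>\<omega>. (Y n \<omega>)\<^sup>2)" for n
      unfolding Y_def using expectation_X(2)[OF f2, of "Suc n"] int by simp
    ultimately show "variance (Y n) = \<sigma>\<^sup>2" for n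
      unfolding Y_def using expectation_X(1)[OF f2, of "Suc n"] var \<sigma> by simp
    show "distr M borel (Y n) = distr (gamma_distr \<alpha> 1) borel f" for n
      unfolding Y_def[abs_def] using distr_distr[of f borel borel "X (Suc n)" M] X_measurable[of "Suc n"] distr_X[of "Suc n"]
      by (simp add: comp_def)
  qed (rule \<sigma>)
  then have "(\<lambda>n. char (distr M borel (\<lambda>\<omega>. (\<Sum>i<n. Y i \<omega>) / sqrt (n * \<sigma>\<^sup>2))) \<sigma>) \<longlonglongrightarrow> char std_normal_distribution \<sigma>"
    by (intro levy_continuity1 real_dist_normal_dist real_distribution_distr) measurable
  moreover have "char (distr M borel (\<lambda>\<omega>. (\<Sum>i<n. Y i \<omega>) / sqrt (n * \<sigma>\<^sup>2))) \<sigma>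
    = (CLINT \<omega>|M. iexp ((\<Sum>j=1..n. f (X j \<omega>)) / sqrt n))" for n
  proof -
    have e: "\<sigma> * ((\<Sum>i<n. Y i \<omega>) / sqrt (n * \<sigma>\<^sup>2)) = (\<Sum>j=1..n. f (X j \<omega>)) / sqrt n" for \<omega>
    proof -
      have "(\<Sum>i<n. Y i \<omega>) = (\<Sum>j=1..n. f (X j \<omega>))"
        unfolding Y_def by (rule sum.reindex_bij_witness[of _ "\<lambda>j. j - 1" Suc]) auto
      moreover have "sqrt (n * \<sigma>\<^sup>2) = \<sigma> * sqrt n" using \<sigma>(1) by (simp add: real_sqrt_mult)
      ultimately show ?thesis using \<sigma>(1) by (simp del: sum.cl_ivl_Suc)
    qed
    have "char (distr M borel (\<lambda>\<omega>. (\<Sum>i<n. Y i \<omega>) / sqrt (n * \<sigma>\<^sup>2))) \<sigma>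
      = (CLINT \<omega>|M. iexp (\<sigma> * ((\<Sum>i<n. Y i \<omega>) / sqrt (n * \<sigma>\<^sup>2))))"
      unfolding char_def by (rule integral_distr) measurable
    then show ?thesis unfolding e .
  qed
  moreover have "char std_normal_distribution \<sigma> = complex_of_real (exp (- v / 2))"
    by (simp add: char_std_normal_distribution \<sigma>)
  ultimately show ?thesis by simp
qed

lemma score_char_tendsto:
  "(\<lambda>n. expectation (\<lambda>\<omega>. cos ((\<Sum>k<m. u k * score n \<omega> k) + c))) \<longlonglongrightarrow> (LINT \<omega>|gauss_seq. cos ((\<Sum>k<m. u k * \<omega> k) + c))"
proof -
  define F where "F x = (\<Sum>k<m. u k * laguerre_n \<alpha> (k + 2) x)" for x
  have Fm: "F \<in> borel_measurable borel" unfolding F_def[abs_def] by measurable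
  have i: "integrable (gamma_distr \<alpha> 1) F"
    unfolding F_def[abs_def] by (intro Bochner_Integration.integrable_sum integrable_mult_right laguerre_n_integral \<alpha>_pos)
  have mean: "(LINT x|gamma_distr \<alpha> 1. F x) = 0"
    unfolding F_def by (subst Bochner_Integration.integral_sum) (auto intro!: integrable_mult_right laguerre_n_integral \<alpha>_pos simp: laguerre_n_integral(2)[OF \<alpha>_pos])
  have F2: "(F x)\<^sup>2 = (\<Sum>j<m. \<Sum>k<m. u j * u k * (laguerre_n \<alpha> (j + 2) x * laguerre_n \<alpha> (k + 2) x))" for x
    unfolding F_def power2_eq_square sum_product by (intro sum.cong refl) (simp add: mult_ac)
  have i2: "integrable (gamma_distr \<alpha> 1) (\<lambda>x. (F x)\<^sup>2)"
    unfolding F2 by (intro Bochner_Integration.integrable_sum integrable_mult_right laguerre_n_orthonormal \<alpha>_pos)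
  have "(LINT x|gamma_distr \<alpha> 1. (F x)\<^sup>2) = (\<Sum>j<m. \<Sum>k<m. u j * u k * (if j = k then 1 else 0))"
    unfolding F2 by (simp add: Bochner_Integration.integral_sum integrable_mult_right laguerre_n_orthonormal[OF \<alpha>_pos])
  also have "\<dots> = (\<Sum>k<m. (u k)\<^sup>2)"
    by (intro sum.cong refl) (simp add: power2_eq_square sum.delta if_distrib cong: if_cong)
  finally have var: "(LINT x|gamma_distr \<alpha> 1. (F x)\<^sup>2) = (\<Sum>k<m. (u k)\<^sup>2)" .
  have e: "(\<Sum>k<m. u k * score n \<omega> k) = (\<Sum>j=1..n. F (X j \<omega>)) / sqrt n" for n \<omega>
    unfolding score_def F_def times_divide_eq_right sum_divide_distrib[symmetric] sum_distrib_left
    by (subst sum.swap) simp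
  have "(\<lambda>n. CLINT \<omega>|M. iexp (\<Sum>k<m. u k * score n \<omega> k)) \<longlonglongrightarrow> (CLINT \<omega>|gauss_seq. iexp (\<Sum>k<m. u k * \<omega> k))"
    unfolding e gauss_seq_char by (rule normalized_sum_char_tendsto[OF Fm i i2 mean var])
  then have lim: "(\<lambda>n. Re (iexp c * (CLINT \<omega>|M. iexp (\<Sum>k<m. u k * score n \<omega> k)))) \<longlonglongrightarrow> Re (iexp c * (CLINT \<omega>|gauss_seq. iexp (\<Sum>k<m. u k * \<omega> k)))"
    by (intro tendsto_intros)
  have cosE: "(LINT \<omega>|Q. cos (A \<omega> + c)) = Re (iexp c * (CLINT \<omega>|Q. iexp (A \<omega>)))"
    if Q: "prob_space Q" and A [measurable]: "A \<in> borel_measurable Q" for Q :: "'c measure" and A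
  proof -
    interpret Q: prob_space Q by fact
    have "integrable Q (\<lambda>\<omega>. iexp (A \<omega>))"
      by (rule Q.integrable_const_bound[where B = 1]) auto
    then have "(LINT \<omega>|Q. Re (iexp c * iexp (A \<omega>))) = Re (CLINT \<omega>|Q. iexp c * iexp (A \<omega>))"
      by (intro integral_Re integrable_mult_right)
    then show ?thesis
      unfolding cos_conv_iexp integral_mult_right_zero .
  qed
  have "(\<lambda>\<omega>. \<Sum>k<m. u k * score n \<omega> k) \<in> borel_measurable M" for n
    by (intro borel_measurable_sum borel_measurable_times score_measurable) auto
  moreover have "(\<lambda>\<omega>. \<Sum>k<m. u k * \<omega> k) \<in> borel_measurable gauss_seq" by measurable
  ultimately show ?thesis
    using lim by (simp only: cosE[OF prob_space_axioms] cosE[OF gauss_seq.prob_space_axioms])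
qed

end

context gamma_sample
begin

section \<open>The empirical process\<close>

text \<open>
  The empirical process as a continuous function of the scaled observations \<open>y\<close>. The maximum
  with 0 reproduces the constant value of the kernel at negative arguments.
\<close>

definition process_of :: "nat \<Rightarrow> (nat \<Rightarrow> real) \<Rightarrow> real \<Rightarrow> real" where
  "process_of n y t = (\<Sum>j=1..n. hyp01 \<alpha> (max 0 (t * y j)) - exp (- t / \<alpha>)) / sqrt n"

lemma hankel_process_eq: "hankel_process \<alpha> X n t \<omega> = process_of n (\<lambda>j. scaled_obs X n j \<omega>) t"
  unfolding hankel_process_def process_of_def Gamma_hankel_J[OF \<alpha>_pos] by simp

lemma sample_mean_measurable [measurable]: "sample_mean X n \<in> borel_measurable M"
  unfolding sample_mean_def[abs_def]
  by (intro borel_measurable_divide borel_measurable_sum) (auto intro: X_measurable)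

lemma scaled_obs_measurable: "j \<ge> 1 \<Longrightarrow> scaled_obs X n j \<in> borel_measurable M"
  unfolding scaled_obs_def[abs_def]
  by (intro borel_measurable_divide sample_mean_measurable X_measurable)

lemma process_of_measurable: "process_of n y \<in> borel_measurable (gamma_distr \<alpha> 1)"
proof -
  have [measurable]: "hyp01 \<alpha> \<in> borel_measurable borel" by (rule borel_measurable_hyp01[OF \<alpha>_pos])
  show ?thesis unfolding borel_measurable_gamma_distr_iff process_of_def[abs_def] by measurable
qed

lemma process_of_L2:
  shows "square_integrable (gamma_distr \<alpha> 1) (process_of n y)"
    and "(\<lambda>y. L2_real (gamma_distr \<alpha> 1) (process_of n y)) \<in> borel \<rightarrow>\<^sub>M borel_of_topology (L2_topology (gamma_distr \<alpha> 1))"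
proof -
  define b where "b i t = 2 * real n / sqrt n" for i :: nat and t :: real
  have closed: "closed (UNIV :: (nat \<Rightarrow> real) set)" by simp
  have b: "square_integrable (gamma_distr \<alpha> 1) (b i)" for i
    by (simp add: square_integrable_def b_def[abs_def])
  have cont: "continuous_on UNIV (\<lambda>y. process_of n y t)" for t
  proof (cases "n = 0")
    case False
    then show ?thesis
      unfolding process_of_def
      by (intro continuous_intros continuous_on_compose2[OF continuous_on_hyp01[OF \<alpha>_pos, of UNIV]]
          continuous_on_product_coordinates) auto
  qed (simp add: process_of_def)
  have bound: "AE t in gamma_distr \<alpha> 1. \<bar>process_of n y t\<bar> \<le> b i t" for i y
    using AE_gamma_distr_pos[of \<alpha> 1]
  proof eventually_elim
    case (elim t)
    have "\<bar>hyp01 \<alpha> (max 0 (t * y j)) - exp (- t / \<alpha>)\<bar> \<le> 2" for j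
    proof -
      have "\<bar>hyp01 \<alpha> (max 0 (t * y j))\<bar> \<le> 1" by (rule abs_hyp01_le_1[OF \<alpha>]) simp
      moreover have "exp (- t / \<alpha>) \<le> 1" using elim \<alpha>_pos by simp
      moreover have "exp (- t / \<alpha>) \<ge> 0" by simp
      ultimately show ?thesis by linarith
    qed
    then have "\<bar>\<Sum>j=1..n. hyp01 \<alpha> (max 0 (t * y j)) - exp (- t / \<alpha>)\<bar> \<le> (\<Sum>j=1..n. 2)"
      by (intro order_trans[OF sum_abs] sum_mono)
    also have "\<dots> = 2 * real n" by simp
    finally show ?case unfolding process_of_def b_def abs_divide by (simp add: divide_right_mono)
  qed
  show "square_integrable (gamma_distr \<alpha> 1) (process_of n y)"
    by (rule measurable_L2_real_of_continuous(1)[where A = "\<lambda>_. UNIV", OF closed process_of_measurable cont bound b]) auto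
  show "(\<lambda>y. L2_real (gamma_distr \<alpha> 1) (process_of n y)) \<in> borel \<rightarrow>\<^sub>M borel_of_topology (L2_topology (gamma_distr \<alpha> 1))"
    by (rule measurable_L2_real_of_continuous(2)[where A = "\<lambda>_. UNIV", OF closed process_of_measurable cont bound b]) auto
qed

lemma hankel_process_square_integrable: "square_integrable (gamma_distr \<alpha> 1) (\<lambda>t. hankel_process \<alpha> X n t \<omega>)"
  unfolding hankel_process_eq by (rule process_of_L2)

lemma hankel_process_L2_measurable:
  "(\<lambda>\<omega>. L2_real (gamma_distr \<alpha> 1) (\<lambda>t. hankel_process \<alpha> X n t \<omega>)) \<in> M \<rightarrow>\<^sub>M borel_of_topology (L2_topology (gamma_distr \<alpha> 1))"
proof -
  define Y where "Y \<omega> j = (if 1 \<le> j then scaled_obs X n j \<omega> else 0)" for \<omega> and j :: nat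
  have "Y \<in> borel_measurable M"
  proof (rule measurable_coordinatewise_borel)
    show "(\<lambda>\<omega>. Y \<omega> j) \<in> borel_measurable M" for j
      unfolding Y_def using scaled_obs_measurable[of j n] by (cases "1 \<le> j") auto
  qed
  from measurable_compose[OF this process_of_L2(2)[of n]]
  have "(\<lambda>\<omega>. L2_real (gamma_distr \<alpha> 1) (process_of n (Y \<omega>))) \<in> M \<rightarrow>\<^sub>M borel_of_topology (L2_topology (gamma_distr \<alpha> 1))" .
  moreover have "process_of n (Y \<omega>) = (\<lambda>t. hankel_process \<alpha> X n t \<omega>)" for \<omega>
    unfolding hankel_process_eq process_of_def Y_def by (intro ext arg_cong2[where f = "(/)"] sum.cong) auto
  ultimately show ?thesis by simp
qed

lemma hankel_process_jointly_measurable: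
  "(\<lambda>(\<omega>, t). hankel_process \<alpha> X n t \<omega>) \<in> borel_measurable (M \<Otimes>\<^sub>M gamma_distr \<alpha> 1)"
proof -
  have [measurable]: "hyp01 \<alpha> \<in> borel_measurable borel" by (rule borel_measurable_hyp01[OF \<alpha>_pos])
  have snd [measurable]: "snd \<in> borel_measurable (M \<Otimes>\<^sub>M gamma_distr \<alpha> 1)"
    using measurable_snd[of M "gamma_distr \<alpha> 1"] by (simp cong: measurable_cong_sets)
  have "(\<lambda>p. (\<Sum>j=1..n. hyp01 \<alpha> (max 0 (snd p * scaled_obs X n j (fst p))) - exp (- snd p / \<alpha>)) / sqrt n)
      \<in> borel_measurable (M \<Otimes>\<^sub>M gamma_distr \<alpha> 1)"
  proof (intro borel_measurable_divide borel_measurable_sum borel_measurable_diff)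
    fix j assume "j \<in> {1..n}"
    then have [measurable]: "scaled_obs X n j \<in> borel_measurable M" by (intro scaled_obs_measurable) auto
    show "(\<lambda>p. hyp01 \<alpha> (max 0 (snd p * scaled_obs X n j (fst p)))) \<in> borel_measurable (M \<Otimes>\<^sub>M gamma_distr \<alpha> 1)"
      by measurable
  qed measurable
  then show ?thesis by (simp add: hankel_process_eq process_of_def split_beta)
qed

text \<open>
  The exponent \<open>-1/3\<close> lies between \<open>-1/2\<close>, which keeps the event likely, and \<open>-1/4\<close>, which
  makes \<open>n \<delta>\<^sup>4\<close> tend to 0.
\<close>

definition radius :: "nat \<Rightarrow> real" where
  "radius n = real n powr (- 1 / 3)"

definition good_event :: "nat \<Rightarrow> 'a set" where
  "good_event n = {\<omega> \<in> space M. (\<forall>j\<in>{1..n}. 0 < X j \<omega>) \<and> \<bar>sample_mean X n \<omega> - \<alpha>\<bar> \<le> radius n}"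

lemma radius_tendsto: "radius \<longlonglongrightarrow> 0"
  unfolding radius_def[abs_def] by (rule tendsto_neg_powr) (auto intro: filterlim_real_sequentially)

lemma radius_power4:
  assumes n: "n \<ge> 1" shows "real n * radius n ^ 4 = radius n"
proof -
  have "radius n ^ 4 = real n powr (- 4 / 3)"
    using n by (simp add: radius_def powr_powr flip: powr_numeral)
  then have "real n * radius n ^ 4 = real n powr 1 * real n powr (- 4 / 3)" using n by simp
  also have "\<dots> = radius n" unfolding radius_def powr_add[symmetric] by simp
  finally show ?thesis .
qed

lemma good_event_sets [measurable]: "good_event n \<in> events"
proof -
  have "{\<omega> \<in> space M. \<forall>j\<in>{1..n}. 0 < X j \<omega>} \<in> events"
  proof (rule sets.sets_Collect_finite_All)
    fix j assume "j \<in> {1..n}"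
    then have [measurable]: "X j \<in> borel_measurable M" by (intro X_measurable) auto
    show "{\<omega> \<in> space M. 0 < X j \<omega>} \<in> events" by measurable
  qed simp
  moreover have "{\<omega> \<in> space M. \<bar>sample_mean X n \<omega> - \<alpha>\<bar> \<le> radius n} \<in> events" by measurable
  ultimately have "{\<omega> \<in> space M. \<forall>j\<in>{1..n}. 0 < X j \<omega>} \<inter> {\<omega> \<in> space M. \<bar>sample_mean X n \<omega> - \<alpha>\<bar> \<le> radius n} \<in> events"
    by (rule sets.Int)
  then show ?thesis by (rule back_subst[where P = "\<lambda>A. A \<in> events"]) (auto simp: good_event_def)
qed

text \<open>
  Chebyshev's inequality for the sample mean, whose variance is \<open>\<alpha> / n\<close>.
\<close>

lemma prob_good_event_ge:
  assumes n: "n \<ge> 1"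
  shows "prob (good_event n) \<ge> 1 - \<alpha> * radius n"
proof -
  define f where "f \<omega> = (\<Sum>j=1..n. X j \<omega> - \<alpha>) / n" for \<omega>
  have f: "f \<omega> = sample_mean X n \<omega> - \<alpha>" for \<omega>
    using n by (simp add: f_def sample_mean_def sum_subtractf field_simps)
  have fm [measurable]: "f \<in> borel_measurable M" unfolding f[abs_def] by measurable
  have r: "radius n > 0" using n by (simp add: radius_def)
  have c: "(\<lambda>x. x - \<alpha>) \<in> borel_measurable borel" by measurable
  note g1 = gamma_moment(1,2)[OF \<alpha>_pos, of 1, unfolded power_one_right]
  note g2 = gamma_moment(1,2)[OF \<alpha>_pos, of 2]
  have pU: "P0.prob UNIV = 1" using P0.prob_space by simp
  have i: "integrable (gamma_distr \<alpha> 1) (\<lambda>x. x - \<alpha>)" using g1 by auto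
  have m: "(LINT x|gamma_distr \<alpha> 1. x - \<alpha>) = 0" using g1 by (simp add: pU)
  have sq: "(x - \<alpha>) * (x - \<alpha>) = x\<^sup>2 - 2 * \<alpha> * x + \<alpha>\<^sup>2" for x by (simp add: power2_eq_square algebra_simps)
  have i2: "integrable (gamma_distr \<alpha> 1) (\<lambda>x. (x - \<alpha>) * (x - \<alpha>))"
    unfolding sq using g1 g2 by auto
  have v: "(LINT x|gamma_distr \<alpha> 1. (x - \<alpha>) * (x - \<alpha>)) = \<alpha>"
    unfolding sq using g1 g2 by (simp add: pU numeral_2_eq_2 pochhammer_Suc algebra_simps)
  note s = sum_product_moment[OF c c i i i2 m m, of n]
  have f2: "(f \<omega>)\<^sup>2 = ((\<Sum>j=1..n. X j \<omega> - \<alpha>) * (\<Sum>j=1..n. X j \<omega> - \<alpha>)) / (real n)\<^sup>2" for \<omega>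
    by (simp add: f_def power2_eq_square)
  have fi2: "integrable M (\<lambda>\<omega>. (f \<omega>)\<^sup>2)" unfolding f2 by (intro integrable_divide s(1))
  have fE2: "expectation (\<lambda>\<omega>. (f \<omega>)\<^sup>2) = \<alpha> / n"
    unfolding f2 using s(2) n by (simp add: v power2_eq_square)
  have "integrable M (\<lambda>\<omega>. X j \<omega> - \<alpha>) \<and> expectation (\<lambda>\<omega>. X j \<omega> - \<alpha>) = 0" if "j \<in> {1..n}" for j
    using expectation_X[OF c, of j] that i m by auto
  then have fE: "expectation f = 0"
    unfolding f_def[abs_def] by (subst integral_divide_zero, subst Bochner_Integration.integral_sum) auto
  have "prob {\<omega> \<in> space M. radius n \<le> \<bar>f \<omega> - expectation f\<bar>} \<le> variance f / (radius n)\<^sup>2"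
    by (rule Chebyshev_inequality[OF fm fi2 r])
  then have "prob {\<omega> \<in> space M. radius n \<le> \<bar>f \<omega>\<bar>} \<le> \<alpha> / n / (radius n)\<^sup>2"
    by (simp add: fE fE2)
  also have "\<dots> = \<alpha> * radius n"
  proof -
    have "radius n * (real n * (radius n)\<^sup>2) = 1"
    proof -
      have "radius n * (radius n * (real n * (radius n)\<^sup>2)) = radius n"
        using radius_power4[OF n] by (simp add: power2_eq_square power4_eq_xxxx mult_ac)
      then show ?thesis using r by simp
    qed
    then show ?thesis using r n by (simp add: field_simps)
  qed
  finally have bad: "prob {\<omega> \<in> space M. radius n \<le> \<bar>f \<omega>\<bar>} \<le> \<alpha> * radius n" .
  have "AE \<omega> in M. \<forall>j\<in>{1..n}. 0 < X j \<omega>"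
    by (intro AE_finite_allI AE_X AE_gamma_distr_pos) auto
  then have "AE \<omega> in M. \<omega> \<in> space M - {\<omega> \<in> space M. radius n \<le> \<bar>f \<omega>\<bar>} \<longrightarrow> \<omega> \<in> good_event n"
    by eventually_elim (auto simp: good_event_def f)
  then have "prob (space M - {\<omega> \<in> space M. radius n \<le> \<bar>f \<omega>\<bar>}) \<le> prob (good_event n)"
    by (intro finite_measure_mono_AE good_event_sets) auto
  moreover have "prob (space M - {\<omega> \<in> space M. radius n \<le> \<bar>f \<omega>\<bar>}) = 1 - prob {\<omega> \<in> space M. radius n \<le> \<bar>f \<omega>\<bar>}"
    by (rule prob_compl) measurable
  ultimately show ?thesis using bad by linarith
qed

lemma prob_good_event_tendsto: "(\<lambda>n. prob (good_event n)) \<longlonglongrightarrow> 1"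
proof (rule tendsto_sandwich)
  show "eventually (\<lambda>n. 1 - \<alpha> * radius n \<le> prob (good_event n)) sequentially"
    using eventually_ge_at_top[of 1] by eventually_elim (rule prob_good_event_ge)
  show "eventually (\<lambda>n. prob (good_event n) \<le> 1) sequentially" by simp
  have "(\<lambda>n. 1 - \<alpha> * radius n) \<longlonglongrightarrow> 1 - \<alpha> * 0" by (intro tendsto_intros radius_tendsto)
  then show "(\<lambda>n. 1 - \<alpha> * radius n) \<longlonglongrightarrow> 1" by simp
qed simp

definition linear_process :: "nat \<Rightarrow> real \<Rightarrow> 'a \<Rightarrow> real" where
  "linear_process n t \<omega> = (\<Sum>j=1..n. linearized \<alpha> t (X j \<omega>)) / sqrt n"

lemma linear_process_measurable: "linear_process n t \<in> borel_measurable M"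
proof -
  have [measurable]: "hyp01 \<alpha> \<in> borel_measurable borel" by (rule borel_measurable_hyp01[OF \<alpha>_pos])
  have "linearized \<alpha> t \<in> borel_measurable borel" unfolding linearized_def[abs_def] by measurable
  then show ?thesis
    unfolding linear_process_def[abs_def]
    by (intro borel_measurable_divide borel_measurable_sum) (auto intro: measurable_compose[OF X_measurable])
qed

lemma linear_process_sums:
  assumes t: "t \<ge> 0"
  shows "(\<lambda>k. mode \<alpha> (k + 2) t * score n \<omega> k) sums linear_process n t \<omega>"
proof -
  have "(\<lambda>k. (\<Sum>j=1..n. mode \<alpha> (k + 2) t * laguerre_n \<alpha> (k + 2) (X j \<omega>)) / sqrt n) sums linear_process n t \<omega>"
    unfolding linear_process_def by (intro sums_divide sums_sum linearized_sums \<alpha>_pos t)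
  then show ?thesis unfolding score_def times_divide_eq_right sum_distrib_left .
qed

text \<open>
  The bound of \<open>linearization_error\<close> after taking expectations over the sample.
\<close>

definition error_bound :: "nat \<Rightarrow> real \<Rightarrow> real" where
  "error_bound n t = 3 * (4 * t\<^sup>2 * (radius n)\<^sup>2 / \<alpha>\<^sup>2 * slope_const \<alpha>
      + remainder_const \<alpha> * t ^ 4 * (real n * radius n ^ 4) * pochhammer \<alpha> 4
      + 4 * t\<^sup>2 * (real n * radius n ^ 4) / \<alpha> ^ 6)"

lemma linearization_error_integral:
  assumes n: "n \<ge> 1" and r: "radius n \<le> \<alpha> / 2" and t: "t > 0"
  shows "(\<integral>\<^sup>+\<omega>. indicator (good_event n) \<omega> * ennreal ((hankel_process \<alpha> X n t \<omega> - linear_process n t \<omega>)\<^sup>2) \<partial>M) \<le> ennreal (error_bound n t)"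
proof -
  have [measurable]: "slope \<alpha> t \<in> borel_measurable borel" by (rule borel_measurable_slope[OF \<alpha>_pos])
  define Q where "Q \<omega> = ((\<Sum>j=1..n. slope \<alpha> t (X j \<omega>)) / sqrt n)\<^sup>2" for \<omega>
  define E where "E \<omega> = 3 * (4 * t\<^sup>2 * (radius n)\<^sup>2 / \<alpha>\<^sup>2 * Q \<omega>
      + remainder_const \<alpha> * t ^ 4 * radius n ^ 4 * (\<Sum>j=1..n. (X j \<omega>) ^ 4)
      + 4 * real n * t\<^sup>2 * radius n ^ 4 / \<alpha> ^ 6)" for \<omega>
  note sm = slope_moments[OF \<alpha> less_imp_le[OF t]]
  have Qe: "Q \<omega> = ((\<Sum>j=1..n. slope \<alpha> t (X j \<omega>)) * (\<Sum>j=1..n. slope \<alpha> t (X j \<omega>))) / n" for \<omega>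
    by (simp add: Q_def power_divide power2_eq_square)
  have sl2: "integrable (gamma_distr \<alpha> 1) (\<lambda>x. slope \<alpha> t x * slope \<alpha> t x)" "(LINT x|gamma_distr \<alpha> 1. slope \<alpha> t x * slope \<alpha> t x) \<le> slope_const \<alpha>"
    using sm(3,4) by (simp_all add: power2_eq_square)
  have slm: "slope \<alpha> t \<in> borel_measurable borel" by measurable
  note s = sum_product_moment[OF slm slm sm(1) sm(1) sl2(1) sm(2) sm(2), of n]
  have Qi: "integrable M Q" unfolding Qe[abs_def] by (intro integrable_divide s(1))
  have QE: "expectation Q \<le> slope_const \<alpha>"
  proof -
    have "expectation Q = (LINT x|gamma_distr \<alpha> 1. slope \<alpha> t x * slope \<alpha> t x)"
      unfolding Qe[abs_def] using n s(2) by simp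
    then show ?thesis using sl2 by simp
  qed
  have p4: "(\<lambda>x::real. x ^ 4) \<in> borel_measurable borel" by measurable
  have X4: "integrable M (\<lambda>\<omega>. (X j \<omega>) ^ 4)" "expectation (\<lambda>\<omega>. (X j \<omega>) ^ 4) = pochhammer \<alpha> 4" if "j \<in> {1..n}" for j
    using expectation_X[OF p4, of j] that gamma_moment(1,2)[OF \<alpha>_pos, of 4] by auto
  have X4s: "integrable M (\<lambda>\<omega>. \<Sum>j=1..n. (X j \<omega>) ^ 4)" "expectation (\<lambda>\<omega>. \<Sum>j=1..n. (X j \<omega>) ^ 4) = n * pochhammer \<alpha> 4"
    using X4 by (auto intro!: Bochner_Integration.integrable_sum simp: Bochner_Integration.integral_sum)
  have Ei: "integrable M E" unfolding E_def[abs_def] using Qi X4s(1) by auto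
  have "expectation E = 3 * (4 * t\<^sup>2 * (radius n)\<^sup>2 / \<alpha>\<^sup>2 * expectation Q
      + remainder_const \<alpha> * t ^ 4 * radius n ^ 4 * (n * pochhammer \<alpha> 4)
      + 4 * real n * t\<^sup>2 * radius n ^ 4 / \<alpha> ^ 6)"
    unfolding E_def[abs_def] using Qi X4s by (simp add: prob_space)
  also have "\<dots> \<le> 3 * (4 * t\<^sup>2 * (radius n)\<^sup>2 / \<alpha>\<^sup>2 * slope_const \<alpha>
      + remainder_const \<alpha> * t ^ 4 * radius n ^ 4 * (n * pochhammer \<alpha> 4)
      + 4 * real n * t\<^sup>2 * radius n ^ 4 / \<alpha> ^ 6)"
    by (intro mult_left_mono add_mono order_refl QE) auto
  also have "\<dots> = error_bound n t" by (simp add: error_bound_def mult_ac)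
  finally have EE: "expectation E \<le> error_bound n t" .
  have E0: "E \<omega> \<ge> 0" for \<omega>
    unfolding E_def Q_def remainder_const_def by (intro mult_nonneg_nonneg add_nonneg_nonneg sum_nonneg divide_nonneg_nonneg) auto
  have "(\<integral>\<^sup>+\<omega>. indicator (good_event n) \<omega> * ennreal ((hankel_process \<alpha> X n t \<omega> - linear_process n t \<omega>)\<^sup>2) \<partial>M) \<le> (\<integral>\<^sup>+\<omega>. ennreal (E \<omega>) \<partial>M)"
  proof (intro nn_integral_mono)
    fix \<omega> assume "\<omega> \<in> space M"
    show "indicator (good_event n) \<omega> * ennreal ((hankel_process \<alpha> X n t \<omega> - linear_process n t \<omega>)\<^sup>2) \<le> ennreal (E \<omega>)"
    proof (cases "\<omega> \<in> good_event n")
      case True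
      then have g: "\<And>j. j \<in> {1..n} \<Longrightarrow> X j \<omega> > 0" "\<bar>sample_mean X n \<omega> - \<alpha>\<bar> \<le> radius n" by (auto simp: good_event_def)
      have mp: "sample_mean X n \<omega> > 0" using g(2) r \<alpha>_pos by linarith
      have "hankel_process \<alpha> X n t \<omega> = (\<Sum>j=1..n. hyp01 \<alpha> (t * (X j \<omega> / sample_mean X n \<omega>)) - exp (- t / \<alpha>)) / sqrt n"
        unfolding hankel_process_eq process_of_def scaled_obs_def
        using g(1) mp t by (intro arg_cong2[where f = "(/)"] sum.cong refl arg_cong2[where f = "(-)"] arg_cong[where f = "hyp01 \<alpha>"])
          (auto simp: max_def not_le less_imp_le)
      then have "(hankel_process \<alpha> X n t \<omega> - linear_process n t \<omega>)\<^sup>2 \<le> E \<omega>"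
        unfolding linear_process_def E_def Q_def
        using linearization_error[OF \<alpha> n g(1) sample_mean_def g(2) r less_imp_le[OF t]] by simp
      then show ?thesis using True by (simp add: ennreal_leI)
    qed simp
  qed
  also have "\<dots> = ennreal (expectation E)" by (intro nn_integral_eq_integral Ei AE_I2 E0)
  also have "\<dots> \<le> ennreal (error_bound n t)" by (rule ennreal_leI[OF EE])
  finally show ?thesis .
qed

lemma score_series_tail:
  assumes n: "n \<ge> 1" and t: "t > 0"
  shows "(\<integral>\<^sup>+\<omega>. ennreal ((linear_process n t \<omega> - (\<Sum>k<K. mode \<alpha> (k + 2) t * score n \<omega> k))\<^sup>2) \<partial>M) \<le> ennreal (exp (\<bar>t\<bar> / 2) * mode_tail \<alpha> K)"
  by (rule mode_series_tail[OF \<alpha> score_measurable linear_process_measurable score_moments(1) score_moments(2)[OF n]])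
    (use linear_process_sums t in auto)

lemma error_bound_nonneg: "error_bound n t \<ge> 0"
proof -
  have "slope_const \<alpha> \<ge> 0" "pochhammer \<alpha> 4 \<ge> 0"
    using \<alpha>_pos by (auto simp: slope_const_def intro!: add_nonneg_nonneg divide_nonneg_nonneg less_imp_le[OF pochhammer_pos])
  moreover have "real n * radius n ^ 4 \<ge> 0" by simp
  ultimately show ?thesis
    unfolding error_bound_def remainder_const_def using \<alpha>_pos
    by (intro mult_nonneg_nonneg add_nonneg_nonneg divide_nonneg_nonneg) auto
qed

text \<open>
  Linearization error plus tail of the mode series, at a fixed time.
\<close>

lemma truncation_error_integral:
  assumes n: "n \<ge> 1" and r: "radius n \<le> \<alpha> / 2" and t: "t > 0"
  shows "(\<integral>\<^sup>+\<omega>. indicator (good_event n) \<omega> * ennreal ((hankel_process \<alpha> X n t \<omega> - (\<Sum>k<K. mode \<alpha> (k + 2) t * score n \<omega> k))\<^sup>2) \<partial>M)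
    \<le> ennreal (2 * error_bound n t + 2 * (exp (\<bar>t\<bar> / 2) * mode_tail \<alpha> K))"
proof -
  have hm: "(\<lambda>\<omega>. hankel_process \<alpha> X n t \<omega>) \<in> borel_measurable M"
    using measurable_compose[OF measurable_Pair2'[of t "gamma_distr \<alpha> 1" M] hankel_process_jointly_measurable[of n]] by simp
  note [measurable] = linear_process_measurable score_measurable hm
  have "(\<integral>\<^sup>+\<omega>. indicator (good_event n) \<omega> * ennreal ((hankel_process \<alpha> X n t \<omega> - (\<Sum>k<K. mode \<alpha> (k + 2) t * score n \<omega> k))\<^sup>2) \<partial>M)
    \<le> (\<integral>\<^sup>+\<omega>. 2 * (indicator (good_event n) \<omega> * ennreal ((hankel_process \<alpha> X n t \<omega> - linear_process n t \<omega>)\<^sup>2))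
        + 2 * ennreal ((linear_process n t \<omega> - (\<Sum>k<K. mode \<alpha> (k + 2) t * score n \<omega> k))\<^sup>2) \<partial>M)"
  proof (rule nn_integral_mono)
    fix \<omega>
    have "(x - z)\<^sup>2 \<le> 2 * (x - y)\<^sup>2 + 2 * (y - z)\<^sup>2" for x y z :: real
      using zero_le_power2[of "(x - y) - (y - z)"] by (simp add: power2_eq_square algebra_simps)
    then have "ennreal ((x - z)\<^sup>2) \<le> 2 * ennreal ((x - y)\<^sup>2) + 2 * ennreal ((y - z)\<^sup>2)" for x y z :: real
      by (simp add: ennreal_leI flip: ennreal_plus ennreal_numeral ennreal_mult')
    then show "indicator (good_event n) \<omega> * ennreal ((hankel_process \<alpha> X n t \<omega> - (\<Sum>k<K. mode \<alpha> (k + 2) t * score n \<omega> k))\<^sup>2)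
      \<le> 2 * (indicator (good_event n) \<omega> * ennreal ((hankel_process \<alpha> X n t \<omega> - linear_process n t \<omega>)\<^sup>2))
        + 2 * ennreal ((linear_process n t \<omega> - (\<Sum>k<K. mode \<alpha> (k + 2) t * score n \<omega> k))\<^sup>2)"
      by (auto simp: indicator_def)
  qed
  also have "\<dots> = 2 * (\<integral>\<^sup>+\<omega>. indicator (good_event n) \<omega> * ennreal ((hankel_process \<alpha> X n t \<omega> - linear_process n t \<omega>)\<^sup>2) \<partial>M)
    + 2 * (\<integral>\<^sup>+\<omega>. ennreal ((linear_process n t \<omega> - (\<Sum>k<K. mode \<alpha> (k + 2) t * score n \<omega> k))\<^sup>2) \<partial>M)"
    by (simp add: nn_integral_add nn_integral_cmult)
  also have "\<dots> \<le> 2 * ennreal (error_bound n t) + 2 * ennreal (exp (\<bar>t\<bar> / 2) * mode_tail \<alpha> K)"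
    by (intro add_mono mult_left_mono linearization_error_integral[OF assms] score_series_tail[OF n t]) auto
  also have "\<dots> = ennreal (2 * error_bound n t + 2 * (exp (\<bar>t\<bar> / 2) * mode_tail \<alpha> K))"
  proof -
    have "2 * ennreal a + 2 * ennreal b = ennreal (2 * a + 2 * b)" if "a \<ge> 0" "b \<ge> 0" for a b
      using that by (simp add: ennreal_plus ennreal_mult)
    then show ?thesis
      using error_bound_nonneg[of n t] mode_tail_nonneg[OF \<alpha>_pos, of K] by simp
  qed
  finally show ?thesis .
qed

end

section \<open>Convergence of the empirical process\<close>

lemma (in gamma_sample) error_bound_integral:
  "integrable (gamma_distr \<alpha> 1) (error_bound n)"
  "(\<lambda>n. LINT t|gamma_distr \<alpha> 1. error_bound n t) \<longlonglongrightarrow> 0"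
proof -
  note g = gamma_moment(1,2)[OF \<alpha>_pos, of 2] gamma_moment(1,2)[OF \<alpha>_pos, of 4]
  have e: "error_bound n t = (12 * (radius n)\<^sup>2 / \<alpha>\<^sup>2 * slope_const \<alpha> + 12 * (real n * radius n ^ 4) / \<alpha> ^ 6) * t\<^sup>2
      + (3 * remainder_const \<alpha> * (real n * radius n ^ 4) * pochhammer \<alpha> 4) * t ^ 4" for n t
    unfolding error_bound_def by (simp add: algebra_simps)
  show "integrable (gamma_distr \<alpha> 1) (error_bound n)"
    unfolding e[abs_def] by (intro Bochner_Integration.integrable_add integrable_mult_right g)
  have "(\<lambda>n. (12 * (radius n)\<^sup>2 / \<alpha>\<^sup>2 * slope_const \<alpha> + 12 * radius n / \<alpha> ^ 6) * pochhammer \<alpha> 2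
      + (3 * remainder_const \<alpha> * radius n * pochhammer \<alpha> 4) * pochhammer \<alpha> 4) \<longlonglongrightarrow>
    (12 * 0\<^sup>2 / \<alpha>\<^sup>2 * slope_const \<alpha> + 12 * 0 / \<alpha> ^ 6) * pochhammer \<alpha> 2
      + (3 * remainder_const \<alpha> * 0 * pochhammer \<alpha> 4) * pochhammer \<alpha> 4"
    using \<alpha>_pos by (intro tendsto_intros radius_tendsto) auto
  then have "(\<lambda>n. (12 * (radius n)\<^sup>2 / \<alpha>\<^sup>2 * slope_const \<alpha> + 12 * radius n / \<alpha> ^ 6) * pochhammer \<alpha> 2
      + (3 * remainder_const \<alpha> * radius n * pochhammer \<alpha> 4) * pochhammer \<alpha> 4) \<longlonglongrightarrow> 0" by simp
  moreover have "eventually (\<lambda>n. (12 * (radius n)\<^sup>2 / \<alpha>\<^sup>2 * slope_const \<alpha> + 12 * radius n / \<alpha> ^ 6) * pochhammer \<alpha> 2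
      + (3 * remainder_const \<alpha> * radius n * pochhammer \<alpha> 4) * pochhammer \<alpha> 4 = (LINT t|gamma_distr \<alpha> 1. error_bound n t)) sequentially"
    using eventually_ge_at_top[of 1]
  proof eventually_elim
    case (elim n)
    have "(LINT t|gamma_distr \<alpha> 1. error_bound n t) =
      (12 * (radius n)\<^sup>2 / \<alpha>\<^sup>2 * slope_const \<alpha> + 12 * (real n * radius n ^ 4) / \<alpha> ^ 6) * pochhammer \<alpha> 2
      + (3 * remainder_const \<alpha> * (real n * radius n ^ 4) * pochhammer \<alpha> 4) * pochhammer \<alpha> 4"
      unfolding e[abs_def] using g by (subst Bochner_Integration.integral_add) auto
    then show ?case unfolding radius_power4[OF elim] by simp
  qed
  ultimately show "(\<lambda>n. LINT t|gamma_distr \<alpha> 1. error_bound n t) \<longlonglongrightarrow> 0"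
    by (rule Lim_transform_eventually)
qed

lemma nn_integral_indicator_Fubini:
  assumes "sigma_finite_measure P" "sigma_finite_measure T"
    and D [measurable]: "(\<lambda>(\<omega>, t). D \<omega> t) \<in> borel_measurable (P \<Otimes>\<^sub>M T)" and [measurable]: "G \<in> sets P"
  shows "(\<integral>\<^sup>+\<omega>. indicator G \<omega> * (\<integral>\<^sup>+t. ennreal ((D \<omega> t)\<^sup>2) \<partial>T) \<partial>P) = (\<integral>\<^sup>+t. (\<integral>\<^sup>+\<omega>. indicator G \<omega> * ennreal ((D \<omega> t)\<^sup>2) \<partial>P) \<partial>T)"
proof -
  interpret sigma_finite_measure T by fact
  interpret pair_sigma_finite P T using assms by (simp add: pair_sigma_finite_def)
  have "(\<integral>\<^sup>+\<omega>. indicator G \<omega> * (\<integral>\<^sup>+t. ennreal ((D \<omega> t)\<^sup>2) \<partial>T) \<partial>P) = (\<integral>\<^sup>+\<omega>. (\<integral>\<^sup>+t. indicator G \<omega> * ennreal ((D \<omega> t)\<^sup>2) \<partial>T) \<partial>P)"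
  proof (rule nn_integral_cong)
    fix \<omega> assume "\<omega> \<in> space P"
    then have "(\<lambda>t. ennreal ((D \<omega> t)\<^sup>2)) \<in> borel_measurable T"
      using measurable_compose[OF measurable_Pair1'[of \<omega> P T] D] by simp
    then show "indicator G \<omega> * (\<integral>\<^sup>+t. ennreal ((D \<omega> t)\<^sup>2) \<partial>T) = (\<integral>\<^sup>+t. indicator G \<omega> * ennreal ((D \<omega> t)\<^sup>2) \<partial>T)"
      by (simp add: nn_integral_cmult)
  qed
  also have "\<dots> = (\<integral>\<^sup>+t. (\<integral>\<^sup>+\<omega>. indicator G \<omega> * ennreal ((D \<omega> t)\<^sup>2) \<partial>P) \<partial>T)"
    by (rule Fubini'[symmetric]) measurable
  finally show ?thesis .
qed

context gamma_sample
begin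

definition tilt_mass :: real where
  "tilt_mass = (LINT t|gamma_distr \<alpha> 1. exp (\<bar>t\<bar> / 2))"

lemma integrable_exp_half: "integrable (gamma_distr \<alpha> 1) (\<lambda>t. exp (\<bar>t\<bar> / 2))"
proof -
  have "(exp (\<bar>t\<bar> / 4))\<^sup>2 = exp (\<bar>t\<bar> / 2)" for t :: real by (simp add: power2_eq_square exp_add [symmetric])
  then show ?thesis using square_integrable_exp_quarter[OF \<alpha>_pos] by (simp add: square_integrable_def)
qed

lemma mode_combination_measurable:
  assumes "\<And>k. (\<lambda>\<omega>. S \<omega> k) \<in> borel_measurable P"
  shows "(\<lambda>(\<omega>, t). \<Sum>k<K. mode \<alpha> (k + 2) t * S \<omega> k) \<in> borel_measurable (P \<Otimes>\<^sub>M gamma_distr \<alpha> 1)"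
proof -
  note [measurable] = assms
  have [measurable]: "mode \<alpha> k \<in> borel_measurable (gamma_distr \<alpha> 1)" for k
    unfolding borel_measurable_gamma_distr_iff by (rule borel_measurable_mode)
  show ?thesis by measurable
qed

lemma truncation_error_total:
  assumes n: "n \<ge> 1" and r: "radius n \<le> \<alpha> / 2"
  shows "(\<integral>\<^sup>+\<omega>. indicator (good_event n) \<omega> * (\<integral>\<^sup>+t. ennreal ((hankel_process \<alpha> X n t \<omega> - (\<Sum>k<K. mode \<alpha> (k + 2) t * score n \<omega> k))\<^sup>2) \<partial>gamma_distr \<alpha> 1) \<partial>M)
    \<le> ennreal (2 * (LINT t|gamma_distr \<alpha> 1. error_bound n t) + 2 * (tilt_mass * mode_tail \<alpha> K))"
proof -
  have "(\<lambda>(\<omega>, t). hankel_process \<alpha> X n t \<omega> - (\<Sum>k<K. mode \<alpha> (k + 2) t * score n \<omega> k)) \<in> borel_measurable (M \<Otimes>\<^sub>M gamma_distr \<alpha> 1)"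
    using borel_measurable_diff[OF hankel_process_jointly_measurable[of n] mode_combination_measurable[where S = "score n" and K = K, OF score_measurable]]
    by (simp add: split_beta)
  then have "(\<integral>\<^sup>+\<omega>. indicator (good_event n) \<omega> * (\<integral>\<^sup>+t. ennreal ((hankel_process \<alpha> X n t \<omega> - (\<Sum>k<K. mode \<alpha> (k + 2) t * score n \<omega> k))\<^sup>2) \<partial>gamma_distr \<alpha> 1) \<partial>M)
    = (\<integral>\<^sup>+t. (\<integral>\<^sup>+\<omega>. indicator (good_event n) \<omega> * ennreal ((hankel_process \<alpha> X n t \<omega> - (\<Sum>k<K. mode \<alpha> (k + 2) t * score n \<omega> k))\<^sup>2) \<partial>M) \<partial>gamma_distr \<alpha> 1)"
    by (intro nn_integral_indicator_Fubini good_event_sets) unfold_locales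
  also have "\<dots> \<le> (\<integral>\<^sup>+t. ennreal (2 * error_bound n t + 2 * (exp (\<bar>t\<bar> / 2) * mode_tail \<alpha> K)) \<partial>gamma_distr \<alpha> 1)"
    using AE_gamma_distr_pos[of \<alpha> 1]
    by (intro nn_integral_mono_AE) (elim eventually_mono, rule truncation_error_integral[OF n r])
  also have "\<dots> = ennreal (LINT t|gamma_distr \<alpha> 1. 2 * error_bound n t + 2 * (exp (\<bar>t\<bar> / 2) * mode_tail \<alpha> K))"
    using error_bound_nonneg mode_tail_nonneg[OF \<alpha>_pos] error_bound_integral(1) integrable_exp_half
    by (intro nn_integral_eq_integral) auto
  also have "(LINT t|gamma_distr \<alpha> 1. 2 * error_bound n t + 2 * (exp (\<bar>t\<bar> / 2) * mode_tail \<alpha> K))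
    = 2 * (LINT t|gamma_distr \<alpha> 1. error_bound n t) + 2 * (tilt_mass * mode_tail \<alpha> K)"
    using error_bound_integral(1)[of n] integrable_exp_half by (simp add: tilt_mass_def)
  finally show ?thesis .
qed

lemma limit_truncation_error_total:
  "(\<integral>\<^sup>+\<omega>. (\<integral>\<^sup>+t. ennreal ((limit_process \<alpha> t \<omega> - (\<Sum>k<K. mode \<alpha> (k + 2) t * \<omega> k))\<^sup>2) \<partial>gamma_distr \<alpha> 1) \<partial>gauss_seq)
    \<le> ennreal (tilt_mass * mode_tail \<alpha> K)"
proof -
  have "(\<lambda>(\<omega>, t). limit_process \<alpha> t \<omega> - (\<Sum>k<K. mode \<alpha> (k + 2) t * \<omega> k)) \<in> borel_measurable (gauss_seq \<Otimes>\<^sub>M gamma_distr \<alpha> 1)"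
    using borel_measurable_diff[OF limit_process_jointly_measurable[OF \<alpha>] mode_combination_measurable[of "\<lambda>\<omega>. \<omega>" gauss_seq K]]
    by (simp add: split_beta)
  then have "(\<integral>\<^sup>+\<omega>. indicator (space gauss_seq) \<omega> * (\<integral>\<^sup>+t. ennreal ((limit_process \<alpha> t \<omega> - (\<Sum>k<K. mode \<alpha> (k + 2) t * \<omega> k))\<^sup>2) \<partial>gamma_distr \<alpha> 1) \<partial>gauss_seq)
    = (\<integral>\<^sup>+t. (\<integral>\<^sup>+\<omega>. indicator (space gauss_seq) \<omega> * ennreal ((limit_process \<alpha> t \<omega> - (\<Sum>k<K. mode \<alpha> (k + 2) t * \<omega> k))\<^sup>2) \<partial>gauss_seq) \<partial>gamma_distr \<alpha> 1)"
    by (intro nn_integral_indicator_Fubini sets.top) unfold_locales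
  also have "\<dots> \<le> (\<integral>\<^sup>+t. ennreal (exp (\<bar>t\<bar> / 2) * mode_tail \<alpha> K) \<partial>gamma_distr \<alpha> 1)"
    using limit_process_tail[OF \<alpha>] by (intro nn_integral_mono) simp
  also have "\<dots> = ennreal (tilt_mass * mode_tail \<alpha> K)"
    using mode_tail_nonneg[OF \<alpha>_pos, of K] integrable_exp_half
    by (subst nn_integral_eq_integral) (auto simp: tilt_mass_def)
  finally show ?thesis by simp
qed

text \<open>
  The index \<open>K\<close> is chosen first, from the tail of the modes, and works for all \<open>n\<close>. The
  linearization error then vanishes as \<open>n\<close> grows.
\<close>

theorem hankel_process_converges:
  "converges_in_distribution (L2_topology (gamma_distr \<alpha> 1))
    M (\<lambda>n \<omega>. L2_real (gamma_distr \<alpha> 1) (\<lambda>t. hankel_process \<alpha> X n t \<omega>))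
    gauss_seq (\<lambda>\<omega>. L2_real (gamma_distr \<alpha> 1) (\<lambda>t. limit_process \<alpha> t \<omega>))"
proof (rule L2_random_series_limit[where \<phi> = "\<lambda>k. mode \<alpha> (k + 2)" and S = score and \<xi> = "\<lambda>\<omega>. \<omega>" and G = good_event])
  show "prob_space M" "prob_space gauss_seq" "sigma_finite_measure (gamma_distr \<alpha> 1)" by unfold_locales
  show "square_integrable (gamma_distr \<alpha> 1) (mode \<alpha> (k + 2))" for k by (rule square_integrable_mode[OF \<alpha>])
  show "(\<lambda>\<omega>. \<omega> k) \<in> borel_measurable gauss_seq" for k by measurable
  show "integrable gauss_seq (\<lambda>\<omega>. (\<omega> k)\<^sup>2)" "(LINT \<omega>|gauss_seq. (\<omega> k)\<^sup>2) \<le> 1" for k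
    using gauss_seq_moments(3,4)[of k k] by (simp_all add: power2_eq_square)
  fix e :: real assume e: "e > 0"
  have "(\<lambda>K. tilt_mass * mode_tail \<alpha> K) \<longlonglongrightarrow> tilt_mass * 0"
    by (intro tendsto_intros mode_tail_tendsto \<alpha>_pos)
  then have "eventually (\<lambda>K. tilt_mass * mode_tail \<alpha> K < e / 4) sequentially"
    using e by (intro order_tendstoD(2)) auto
  then obtain K where K: "tilt_mass * mode_tail \<alpha> K < e / 4"
    using eventually_happens'[OF sequentially_bot] by blast
  have "eventually (\<lambda>n. (LINT t|gamma_distr \<alpha> 1. error_bound n t) < e / 4) sequentially"
    using e by (intro order_tendstoD(2)[OF error_bound_integral(2)]) auto
  moreover have "eventually (\<lambda>n. radius n < \<alpha> / 2) sequentially"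
    using \<alpha>_pos by (intro order_tendstoD(2)[OF radius_tendsto]) auto
  ultimately have "eventually (\<lambda>n. (\<integral>\<^sup>+\<omega>. indicator (good_event n) \<omega> * (\<integral>\<^sup>+t. ennreal ((hankel_process \<alpha> X n t \<omega> - (\<Sum>k<K. mode \<alpha> (k + 2) t * score n \<omega> k))\<^sup>2) \<partial>gamma_distr \<alpha> 1) \<partial>M) \<le> ennreal e) sequentially"
    using eventually_ge_at_top[of 1]
  proof eventually_elim
    case (elim n)
    have "2 * (LINT t|gamma_distr \<alpha> 1. error_bound n t) + 2 * (tilt_mass * mode_tail \<alpha> K) \<le> e"
      using elim(1) K by linarith
    then show ?case
      by (intro order_trans[OF truncation_error_total[OF elim(3) less_imp_le[OF elim(2)]] ennreal_leI])
  qed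
  moreover have "(\<integral>\<^sup>+\<omega>. (\<integral>\<^sup>+t. ennreal ((limit_process \<alpha> t \<omega> - (\<Sum>k<K. mode \<alpha> (k + 2) t * \<omega> k))\<^sup>2) \<partial>gamma_distr \<alpha> 1) \<partial>gauss_seq) \<le> ennreal e"
    using K e by (intro order_trans[OF limit_truncation_error_total ennreal_leI]) linarith
  ultimately show "\<exists>K. eventually (\<lambda>n. (\<integral>\<^sup>+\<omega>. indicator (good_event n) \<omega> * (\<integral>\<^sup>+t. ennreal ((hankel_process \<alpha> X n t \<omega> - (\<Sum>k<K. mode \<alpha> (k + 2) t * score n \<omega> k))\<^sup>2) \<partial>gamma_distr \<alpha> 1) \<partial>M) \<le> ennreal e) sequentially \<and>
    (\<integral>\<^sup>+\<omega>. (\<integral>\<^sup>+t. ennreal ((limit_process \<alpha> t \<omega> - (\<Sum>k<K. mode \<alpha> (k + 2) t * \<omega> k))\<^sup>2) \<partial>gamma_distr \<alpha> 1) \<partial>gauss_seq) \<le> ennreal e"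
    by blast
next
  show "square_integrable (gamma_distr \<alpha> 1) (\<lambda>t. hankel_process \<alpha> X n t \<omega>)" for n \<omega>
    by (rule hankel_process_square_integrable)
  show "square_integrable (gamma_distr \<alpha> 1) (\<lambda>t. limit_process \<alpha> t \<omega>)" for \<omega>
    by (rule limit_process_L2(1)[OF \<alpha>])
  show "(\<lambda>(\<omega>, t). hankel_process \<alpha> X n t \<omega>) \<in> borel_measurable (M \<Otimes>\<^sub>M gamma_distr \<alpha> 1)" for n
    by (rule hankel_process_jointly_measurable)
  show "(\<lambda>(\<omega>, t). limit_process \<alpha> t \<omega>) \<in> borel_measurable (gauss_seq \<Otimes>\<^sub>M gamma_distr \<alpha> 1)"
    by (rule limit_process_jointly_measurable[OF \<alpha>])
  show "(\<lambda>\<omega>. L2_real (gamma_distr \<alpha> 1) (\<lambda>t. hankel_process \<alpha> X n t \<omega>)) \<in> M \<rightarrow>\<^sub>M borel_of_topology (L2_topology (gamma_distr \<alpha> 1))" for n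
    by (rule hankel_process_L2_measurable)
  show "(\<lambda>\<omega>. L2_real (gamma_distr \<alpha> 1) (\<lambda>t. limit_process \<alpha> t \<omega>)) \<in> gauss_seq \<rightarrow>\<^sub>M borel_of_topology (L2_topology (gamma_distr \<alpha> 1))"
    by (rule limit_process_L2(2)[OF \<alpha>])
  show "good_event n \<in> events" for n by (rule good_event_sets)
  show "(\<lambda>n. prob (good_event n)) \<longlonglongrightarrow> 1" by (rule prob_good_event_tendsto)
qed (fact score_measurable score_second_moment score_char_tendsto)+

end

theorem theorem3p5:
  fixes \<alpha> :: real and M :: "'a measure" and X :: "nat \<Rightarrow> 'a \<Rightarrow> real"
  assumes "\<alpha> \<ge> 1 / 2"
    and "prob_space M"
    and "prob_space.indep_vars M (\<lambda>_. borel) X {1..}"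
    and "\<And>j. j \<ge> 1 \<Longrightarrow> distr M borel (X j) = gamma_distr \<alpha> 1"
  shows "\<exists>(N :: (nat \<Rightarrow> real) measure) (Z :: real \<Rightarrow> (nat \<Rightarrow> real) \<Rightarrow> real).
    prob_space N \<and>
    gaussian_process N {0..} Z \<and>
    (\<forall>t\<ge>0. (LINT \<omega>|N. Z t \<omega>) = 0) \<and>
    (\<forall>s\<ge>0. \<forall>t\<ge>0. covariance N (Z s) (Z t) = limit_covariance \<alpha> s t) \<and>
    (\<forall>\<omega>\<in>space N. (\<lambda>t. complex_of_real (Z t \<omega>)) \<in> L2_fun (gamma_distr \<alpha> 1)) \<and>
    converges_in_distribution (L2_topology (gamma_distr \<alpha> 1))
      M (\<lambda>n \<omega>. L2_path \<alpha> (\<lambda>t. hankel_process \<alpha> X n t \<omega>))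
      N (\<lambda>\<omega>. L2_path \<alpha> (\<lambda>t. Z t \<omega>)) \<and>
    weak_conv_m
      (\<lambda>n. distr M borel (hankel_statistic \<alpha> X n))
      (distr N borel (\<lambda>\<omega>. LINT t:{0..}|gamma_distr \<alpha> 1. (Z t \<omega>)\<^sup>2))"
proof -
  interpret prob_space M by fact
  interpret gamma_sample M \<alpha> X by unfold_locales (use assms in auto)
  have path: "L2_path \<alpha> z = L2_real (gamma_distr \<alpha> 1) z" for z
    by (simp add: L2_path_def L2_real_def)
  have half_line: "(LINT t:{0..}|gamma_distr \<alpha> 1. (z t)\<^sup>2) = (LINT t|gamma_distr \<alpha> 1. (z t)\<^sup>2)"
    if z: "square_integrable (gamma_distr \<alpha> 1) z" for z
    unfolding set_lebesgue_integral_def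
  proof (rule integral_cong_AE)
    have "z \<in> borel_measurable borel" using z by (simp add: square_integrable_def borel_measurable_gamma_distr_iff)
    then show "(\<lambda>t. (z t)\<^sup>2) \<in> borel_measurable (gamma_distr \<alpha> 1)" "(\<lambda>t. indicator {0..} t *\<^sub>R (z t)\<^sup>2) \<in> borel_measurable (gamma_distr \<alpha> 1)"
      unfolding borel_measurable_gamma_distr_iff by measurable
    show "AE t in gamma_distr \<alpha> 1. indicator {0..} t *\<^sub>R (z t)\<^sup>2 = (z t)\<^sup>2"
      using AE_gamma_distr_pos[of \<alpha> 1] by eventually_elim simp
  qed
  have "weak_conv_m (\<lambda>n. distr M borel (\<lambda>\<omega>. LINT t|gamma_distr \<alpha> 1. (hankel_process \<alpha> X n t \<omega>)\<^sup>2))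
    (distr gauss_seq borel (\<lambda>\<omega>. LINT t|gamma_distr \<alpha> 1. (limit_process \<alpha> t \<omega>)\<^sup>2))"
    by (rule weak_conv_L2_norm_square[OF prob_space_axioms gauss_seq.prob_space_axioms
          hankel_process_square_integrable limit_process_L2(1)[OF \<alpha>] hankel_process_converges])
  moreover have "(\<lambda>\<omega>. LINT t|gamma_distr \<alpha> 1. (hankel_process \<alpha> X n t \<omega>)\<^sup>2) = hankel_statistic \<alpha> X n" for n
    by (rule ext) (simp add: hankel_statistic_def half_line[OF hankel_process_square_integrable])
  moreover have "(\<lambda>\<omega>. LINT t|gamma_distr \<alpha> 1. (limit_process \<alpha> t \<omega>)\<^sup>2) = (\<lambda>\<omega>. LINT t:{0..}|gamma_distr \<alpha> 1. (limit_process \<alpha> t \<omega>)\<^sup>2)"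
    by (rule ext) (simp add: half_line[OF limit_process_L2(1)[OF \<alpha>]])
  ultimately have weak: "weak_conv_m (\<lambda>n. distr M borel (hankel_statistic \<alpha> X n))
    (distr gauss_seq borel (\<lambda>\<omega>. LINT t:{0..}|gamma_distr \<alpha> 1. (limit_process \<alpha> t \<omega>)\<^sup>2))" by simp
  show ?thesis
  proof (intro exI[of _ gauss_seq] exI[of _ "limit_process \<alpha>"] conjI allI ballI impI)
    show "converges_in_distribution (L2_topology (gamma_distr \<alpha> 1))
      M (\<lambda>n \<omega>. L2_path \<alpha> (\<lambda>t. hankel_process \<alpha> X n t \<omega>)) gauss_seq (\<lambda>\<omega>. L2_path \<alpha> (\<lambda>t. limit_process \<alpha> t \<omega>))"
      unfolding path by (rule hankel_process_converges)
    show "(\<lambda>t. complex_of_real (limit_process \<alpha> t \<omega>)) \<in> L2_fun (gamma_distr \<alpha> 1)" for \<omega>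
      using limit_process_L2(1)[OF \<alpha>] by (simp add: square_integrable_L2_fun_iff)
    show "(LINT \<omega>|gauss_seq. limit_process \<alpha> t \<omega>) = 0" for t
      by (rule limit_process_mean[OF \<alpha>])
    show "covariance gauss_seq (limit_process \<alpha> s) (limit_process \<alpha> t) = limit_covariance \<alpha> s t"
      if "0 \<le> s" "0 \<le> t" for s t
      using that by (rule limit_process_covariance[OF \<alpha>])
    show "gaussian_process gauss_seq {0..} (limit_process \<alpha>)"
      by (rule limit_process_gaussian[OF \<alpha>])
  qed (fact gauss_seq.prob_space_axioms weak)+
qed

end
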